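(* For every integer $n \geq 0$ and every graph $G \in \{\Gamma_{n,5}, \Lambda_{n,5}, A_{n,5}, B_{n,5}, C_{n,5}, D_{n,5}, E_{n,5}, F_{n,5}\}$ (defined below), the independence complex $\mathrm{Ind}(G)$ is homotopy equivalent to a wedge of spheres.
   Context: The independence complex $\mathrm{Ind}(G)$ of a graph $G$ is the simplicial complex on $V(G)$ whose simplices are the independent sets of $G$. A contractible space is regarded as a (trivial, empty) wedge of spheres. All graphs are simple; edges are written $uv$. For $n \geq 0$, $\Gamma_{n,5}$ has vertices $g_{ij}$, $1 \leq i \leq 4$, $1 \leq j \leq 2n+1$, and edges: $g_{ij}g_{i+1,j}$ for $i=1,2,3$ and all $j$; $g_{ij}g_{i,j+1}$ for $i=1,\dots,4$ and $j=1,\dots,2n$; and $g_{ij}g_{i+1,j+1}$, $g_{i,j+1}g_{i+1,j}$ for $i=1,2,3$, $j=1,\dots,2n$ with $i+j \equiv 1 \pmod 2$. Each of the following graphs is $\Gamma_{n,5}$ together with the listed new vertices and new edges: - $\Lambda_{n,5}$: vertices $l_1,l_2,l_3,l_4$; edges $l_1l_2, l_2l_3, l_3l_4, g_{11}l_1, g_{11}l_2, g_{21}l_1, g_{21}l_2, g_{31}l_3, g_{31}l_4, g_{41}l_3, g_{41}l_4$. - $A_{n,5}$: vertices $a_1,a_2$; edges $a_1g_{11}, a_1g_{21}, a_2g_{31}, a_2g_{41}$. - $B_{n,5}$: vertices $b_1,\dots,b_6$; edges $b_1b_2, b_1b_4, b_1b_5, b_2b_6, b_3b_4, b_4b_5,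 b_5b_6, b_3g_{11}, b_3g_{21}, b_4g_{11}, b_4g_{21}, b_5g_{31}, b_5g_{41}, b_6g_{31}, b_6g_{41}$. - $C_{n,5}$: vertex $c_1$; edges $c_1g_{31}, c_1g_{41}$. - $D_{n,5}$: vertices $d_1,d_2$; edges $d_1d_2, d_1g_{11}, d_1g_{21}, d_2g_{31}, d_2g_{41}$. - $E_{n,5}$: vertex $e_1$; edges $e_1g_{11}, e_1g_{21}, e_1g_{31}, e_1g_{41}$. - $F_{n,5}$: vertices $f_1,f_2,f_3$; edges $f_1f_2, f_2f_3, f_1g_{11}, f_1g_{21}, f_2g_{31}, f_2g_{41}, f_3g_{31}, f_3g_{41}$. *)

theory Defs
  imports "HOL-Analysis.Analysis"
begin

section \<open>Simple graphs and independence complexes\<close>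

record 'a ugraph =
  verts :: "'a set"
  edges :: "'a set set"

definition simple_graph :: "'a ugraph \<Rightarrow> bool" where
  "simple_graph G \<longleftrightarrow> (\<forall>e \<in> edges G. e \<subseteq> verts G \<and> card e = 2)"

definition independent_set :: "'a ugraph \<Rightarrow> 'a set \<Rightarrow> bool" where
  "independent_set G S \<longleftrightarrow> S \<subseteq> verts G \<and> (\<forall>u \<in> S. \<forall>v \<in> S. {u, v} \<notin> edges G)"

definition Ind :: "'a ugraph \<Rightarrow> 'a set set" where
  "Ind G = {S. independent_set G S}"

text \<open>
  A simplicial complex is given by its set of simplices; the empty simplex may be present and
  contributes no point to the realization. Points are given by barycentric coordinates.
  The topology of pointwise convergence is the usual one for finite complexes, the only ones
  used here; for infinite complexes it need not be the weak topology.
\<close>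

definition geometric_realization :: "'a set set \<Rightarrow> ('a \<Rightarrow> real) topology" where
  "geometric_realization K = subtopology (powertop_real UNIV)
     {x. (\<forall>v. 0 \<le> x v) \<and> finite {v. x v \<noteq> 0} \<and> {v. x v \<noteq> 0} \<in> K \<and> (\<Sum>v | x v \<noteq> 0. x v) = 1}"

section \<open>Wedges of spheres\<close>

text \<open>
  The wedge of the pointed spaces \<open>(X i, p i)\<close>, \<open>i \<in> I\<close>: the quotient of their disjoint union
  that identifies all base points. The common base point of the wedge is \<open>None\<close>; it is present
  also when \<open>I\<close> is empty, so that the empty wedge is a one-point space.
\<close>

definition wedge_proj :: "('i \<Rightarrow> 'b) \<Rightarrow> 'i \<times> 'b \<Rightarrow> ('i \<times> 'b) option" where
  "wedge_proj p z = (if snd z = p (fst z) then None else Some z)"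

definition wedge :: "('i \<Rightarrow> 'b topology) \<Rightarrow> ('i \<Rightarrow> 'b) \<Rightarrow> 'i set \<Rightarrow> ('i \<times> 'b) option topology" where
  "wedge X p I = topology (\<lambda>U.
     U \<subseteq> insert None (wedge_proj p ` topspace (sum_topology X I)) \<and>
     openin (sum_topology X I) {z \<in> topspace (sum_topology X I). wedge_proj p z \<in> U})"

lemma openin_wedge:
  "openin (wedge X p I) U \<longleftrightarrow>
     U \<subseteq> insert None (wedge_proj p ` topspace (sum_topology X I)) \<and>
     openin (sum_topology X I) {z \<in> topspace (sum_topology X I). wedge_proj p z \<in> U}"
proof -
  let ?Y = "sum_topology X I"
  let ?A = "insert None (wedge_proj p ` topspace ?Y)"
  let ?P = "\<lambda>U. {z \<in> topspace ?Y. wedge_proj p z \<in> U}"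
  have 1: "?P (S \<inter> T) = ?P S \<inter> ?P T" for S T by blast
  have 2: "?P (\<Union>\<K>) = \<Union> (?P ` \<K>)" for \<K> by blast
  have "istopology (\<lambda>U. U \<subseteq> ?A \<and> openin ?Y (?P U))"
    unfolding istopology_def
  proof (rule conjI; intro allI impI)
    fix S T assume S: "S \<subseteq> ?A \<and> openin ?Y (?P S)" and T: "T \<subseteq> ?A \<and> openin ?Y (?P T)"
    have "S \<inter> T \<subseteq> ?A" using S by blast
    moreover have "openin ?Y (?P (S \<inter> T))"
      unfolding 1 using S T by (intro openin_Int) simp_all
    ultimately show "S \<inter> T \<subseteq> ?A \<and> openin ?Y (?P (S \<inter> T))" ..
  next
    fix \<K> assume K: "\<forall>K\<in>\<K>. K \<subseteq> ?A \<and> openin ?Y (?P K)"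
    then have "\<Union>\<K> \<subseteq> ?A" by (intro Union_least) simp
    moreover have "openin ?Y (?P (\<Union>\<K>))"
      unfolding 2 using K by (intro openin_Union) blast
    ultimately show "\<Union>\<K> \<subseteq> ?A \<and> openin ?Y (?P (\<Union>\<K>))" ..
  qed
  then show ?thesis
    by (simp add: wedge_def)
qed

lemma topspace_wedge:
  "topspace (wedge X p I) = insert None (wedge_proj p ` topspace (sum_topology X I))" (is "_ = ?A")
proof
  have "{z \<in> topspace (sum_topology X I). wedge_proj p z \<in> ?A} = topspace (sum_topology X I)"
    by blast
  then have "openin (sum_topology X I) {z \<in> topspace (sum_topology X I). wedge_proj p z \<in> ?A}"
    by (simp only: openin_topspace)
  then have "openin (wedge X p I) ?A"
    unfolding openin_wedge by (rule conjI[OF subset_refl])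
  then show "?A \<subseteq> topspace (wedge X p I)"
    by (rule openin_subset)
  show "topspace (wedge X p I) \<subseteq> ?A"
    using openin_topspace[of "wedge X p I"] unfolding openin_wedge by (rule conjunct1)
qed

lemma quotient_map_wedge_proj:
  assumes "I \<noteq> {}" "\<And>i. i \<in> I \<Longrightarrow> p i \<in> topspace (X i)"
  shows "quotient_map (sum_topology X I) (wedge X p I) (wedge_proj p)"
proof -
  obtain i where "i \<in> I" using assms(1) by blast
  then have "(i, p i) \<in> topspace (sum_topology X I)" using assms(2) by simp
  then have "None \<in> wedge_proj p ` topspace (sum_topology X I)"
    by (force simp: wedge_proj_def)
  then have "topspace (wedge X p I) = wedge_proj p ` topspace (sum_topology X I)"
    by (simp only: topspace_wedge insert_absorb)
  then show ?thesis
    unfolding quotient_map_def openin_wedge topspace_wedge by simp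
qed

definition sphere_basepoint :: "nat \<Rightarrow> real" where
  "sphere_basepoint = (\<lambda>k. if k = 0 then 1 else 0)"

text \<open>
  The entries of \<open>ds\<close> are the dimensions of the spheres, which may differ and may be \<open>0\<close>.
\<close>

definition wedge_of_spheres :: "nat list \<Rightarrow> (nat \<times> (nat \<Rightarrow> real)) option topology" where
  "wedge_of_spheres ds = wedge (\<lambda>k. nsphere (ds ! k)) (\<lambda>_. sphere_basepoint) {..<length ds}"

lemma sphere_basepoint_in_nsphere: "sphere_basepoint \<in> topspace (nsphere d)"
  unfolding sphere_basepoint_def by (rule in_topspace_nsphere)

lemma wedge_of_spheres_Nil: "wedge_of_spheres [] = discrete_topology {None}"
  by (rule topology_eq[THEN iffD2])
     (simp add: wedge_of_spheres_def openin_wedge openin_sum_topology)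

lemma homotopy_equivalent_empty_wedge_iff:
  "X homotopy_equivalent_space wedge_of_spheres [] \<longleftrightarrow> contractible_space X \<and> topspace X \<noteq> {}"
proof
  assume *: "X homotopy_equivalent_space wedge_of_spheres []"
  then have "contractible_space X"
    using homotopy_equivalent_space_contractibility
    unfolding wedge_of_spheres_Nil by (metis contractible_space_singleton)
  moreover have "topspace X \<noteq> {}"
  proof -
    obtain g where "continuous_map (wedge_of_spheres []) X g"
      using * unfolding homotopy_equivalent_space_def by blast
    then have "g None \<in> topspace X"
      by (simp add: continuous_map_def wedge_of_spheres_Nil)
    then show ?thesis by blast
  qed
  ultimately show "contractible_space X \<and> topspace X \<noteq> {}" ..
next
  assume "contractible_space X \<and> topspace X \<noteq> {}"
  then obtain a where a: "a \<in> topspace X" "X homotopy_equivalent_space subtopology X {a}"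
    by (auto simp: contractible_eq_homotopy_equivalent_singleton_subtopology)
  have "subtopology X {a} = discrete_topology {a}"
    using a(1) by (simp add: subtopology_eq_discrete_topology_sing)
  moreover have "discrete_topology {a} homeomorphic_space wedge_of_spheres []"
    unfolding wedge_of_spheres_Nil homeomorphic_space_def homeomorphic_maps_def
    by (intro exI[of _ "\<lambda>_. None"] exI[of _ "\<lambda>_. a"]) simp
  ultimately show "X homotopy_equivalent_space wedge_of_spheres []"
    using a(2) by (metis homeomorphic_imp_homotopy_equivalent_space homotopy_eqv_trans)
qed

definition homotopy_equivalent_to_wedge_of_spheres :: "'a topology \<Rightarrow> bool" where
  "homotopy_equivalent_to_wedge_of_spheres X \<longleftrightarrow>
     (\<exists>ds. X homotopy_equivalent_space wedge_of_spheres ds)"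

section \<open>The graphs\<close>

datatype vertex =
    Vg nat nat | Vl nat | Va nat | Vb nat | Vc nat | Vd nat | Ve nat | Vf nat

definition Gamma5 :: "nat \<Rightarrow> vertex ugraph" where
  "Gamma5 n = \<lparr>
     verts = {Vg i j | i j. i \<in> {1..4} \<and> j \<in> {1..2*n+1}},
     edges =
       {{Vg i j, Vg (i+1) j} | i j. i \<in> {1..3} \<and> j \<in> {1..2*n+1}} \<union>
       {{Vg i j, Vg i (j+1)} | i j. i \<in> {1..4} \<and> j \<in> {1..2*n}} \<union>
       {{Vg i j, Vg (i+1) (j+1)} | i j. i \<in> {1..3} \<and> j \<in> {1..2*n} \<and> (i + j) mod 2 = 1} \<union>
       {{Vg i (j+1), Vg (i+1) j} | i j. i \<in> {1..3} \<and> j \<in> {1..2*n} \<and> (i + j) mod 2 = 1}\<rparr>"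

definition extend_graph :: "'a ugraph \<Rightarrow> 'a set \<Rightarrow> 'a set set \<Rightarrow> 'a ugraph" where
  "extend_graph G W F = \<lparr>verts = verts G \<union> W, edges = edges G \<union> F\<rparr>"

definition Lambda5 :: "nat \<Rightarrow> vertex ugraph" where
  "Lambda5 n = extend_graph (Gamma5 n) {Vl 1, Vl 2, Vl 3, Vl 4}
     {{Vl 1, Vl 2}, {Vl 2, Vl 3}, {Vl 3, Vl 4},
      {Vg 1 1, Vl 1}, {Vg 1 1, Vl 2}, {Vg 2 1, Vl 1}, {Vg 2 1, Vl 2},
      {Vg 3 1, Vl 3}, {Vg 3 1, Vl 4}, {Vg 4 1, Vl 3}, {Vg 4 1, Vl 4}}"

definition A5 :: "nat \<Rightarrow> vertex ugraph" where
  "A5 n = extend_graph (Gamma5 n) {Va 1, Va 2}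
     {{Va 1, Vg 1 1}, {Va 1, Vg 2 1}, {Va 2, Vg 3 1}, {Va 2, Vg 4 1}}"

definition B5 :: "nat \<Rightarrow> vertex ugraph" where
  "B5 n = extend_graph (Gamma5 n) {Vb 1, Vb 2, Vb 3, Vb 4, Vb 5, Vb 6}
     {{Vb 1, Vb 2}, {Vb 1, Vb 4}, {Vb 1, Vb 5}, {Vb 2, Vb 6},
      {Vb 3, Vb 4}, {Vb 4, Vb 5}, {Vb 5, Vb 6},
      {Vb 3, Vg 1 1}, {Vb 3, Vg 2 1}, {Vb 4, Vg 1 1}, {Vb 4, Vg 2 1},
      {Vb 5, Vg 3 1}, {Vb 5, Vg 4 1}, {Vb 6, Vg 3 1}, {Vb 6, Vg 4 1}}"

definition C5 :: "nat \<Rightarrow> vertex ugraph" where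
  "C5 n = extend_graph (Gamma5 n) {Vc 1} {{Vc 1, Vg 3 1}, {Vc 1, Vg 4 1}}"

definition D5 :: "nat \<Rightarrow> vertex ugraph" where
  "D5 n = extend_graph (Gamma5 n) {Vd 1, Vd 2}
     {{Vd 1, Vd 2}, {Vd 1, Vg 1 1}, {Vd 1, Vg 2 1}, {Vd 2, Vg 3 1}, {Vd 2, Vg 4 1}}"

definition E5 :: "nat \<Rightarrow> vertex ugraph" where
  "E5 n = extend_graph (Gamma5 n) {Ve 1}
     {{Ve 1, Vg 1 1}, {Ve 1, Vg 2 1}, {Ve 1, Vg 3 1}, {Ve 1, Vg 4 1}}"

definition F5 :: "nat \<Rightarrow> vertex ugraph" where
  "F5 n = extend_graph (Gamma5 n) {Vf 1, Vf 2, Vf 3}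
     {{Vf 1, Vf 2}, {Vf 2, Vf 3}, {Vf 1, Vg 1 1}, {Vf 1, Vg 2 1},
      {Vf 2, Vg 3 1}, {Vf 2, Vg 4 1}, {Vf 3, Vg 3 1}, {Vf 3, Vg 4 1}}"

lemma simple_graph_Gamma5: "simple_graph (Gamma5 n)"
  unfolding simple_graph_def Gamma5_def by auto

lemma finite_verts_Gamma5: "finite (verts (Gamma5 n))"
proof -
  have "verts (Gamma5 n) = (\<lambda>(i, j). Vg i j) ` ({1..4} \<times> {1..2*n+1})"
    by (auto simp: Gamma5_def)
  then show ?thesis by simp
qed

lemma simple_graph_extend:
  assumes "simple_graph G"
    and "\<forall>e \<in> F. e \<subseteq> verts G \<union> W \<and> card e = 2"
  shows "simple_graph (extend_graph G W F)"
  using assms unfolding simple_graph_def extend_graph_def by auto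

lemma first_column_in_Gamma5:
  "Vg 1 1 \<in> verts (Gamma5 n)" "Vg 2 1 \<in> verts (Gamma5 n)"
  "Vg 3 1 \<in> verts (Gamma5 n)" "Vg 4 1 \<in> verts (Gamma5 n)"
  by (auto simp: Gamma5_def)

lemma finite_simple_graphs:
  assumes "G \<in> {Gamma5 n, Lambda5 n, A5 n, B5 n, C5 n, D5 n, E5 n, F5 n}"
  shows "simple_graph G" and "finite (verts G)"
proof -
  note first_column_in_Gamma5[simp] first_column_in_Gamma5[unfolded One_nat_def, simp]
  note ext = simple_graph_extend[OF simple_graph_Gamma5]
  have "simple_graph (Lambda5 n)"
    unfolding Lambda5_def by (rule ext) simp
  moreover have "simple_graph (A5 n)"
    unfolding A5_def by (rule ext) simp
  moreover have "simple_graph (B5 n)"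
    unfolding B5_def by (rule ext) simp
  moreover have "simple_graph (C5 n)"
    unfolding C5_def by (rule ext) simp
  moreover have "simple_graph (D5 n)"
    unfolding D5_def by (rule ext) simp
  moreover have "simple_graph (E5 n)"
    unfolding E5_def by (rule ext) simp
  moreover have "simple_graph (F5 n)"
    unfolding F5_def by (rule ext) simp
  ultimately show "simple_graph G"
    using assms simple_graph_Gamma5 by auto
  show "finite (verts G)"
    using assms finite_verts_Gamma5[of n]
    by (auto simp: Lambda5_def A5_def B5_def C5_def D5_def E5_def F5_def extend_graph_def)
qed

end

theory Submission
  imports Defs
begin

text \<open>
  If the inclusion of the link of a vertex \<open>v\<close> into the complex of \<open>G - v\<close> is null-homotopic, then
  \<open>Ind G\<close>, which is its mapping cone, is the wedge of \<open>Ind (G - v)\<close> with the suspension of the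
  link. The proof is an induction on \<open>n\<close> for a family of eleven graphs, the eight given ones and
  three more, each consisting of a small gadget attached to the pairs \<open>{g11, g21}\<close>, \<open>{g31, g41}\<close>
  of \<open>\<Gamma>\<^sub>n\<close>. Viewing the first two columns of \<open>\<Gamma>\<^sub>n\<^sub>+\<^sub>1\<close> as part of the gadget leaves a larger
  gadget attached to \<open>\<Gamma>\<^sub>n\<close>, which folds and vertex deletions with null-homotopic link inclusions
  reduce to gadgets of the family. To make the null-homotopies available, the induction also
  carries path-connectedness for every gadget but the one of \<open>E\<close>.
\<close>

text \<open>The three extra gadgets close the family under the reductions: K and Y are paths on four
  and six vertices from the first pair to the second (D is the one on two vertices), and X is A with
  a leaf attached. E is exempt from connectedness because Ind(E_0) is a 0-sphere: its extra vertex
  is joined to all of a path whose complex is contractible. No reduction ends in E, so nothing is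
  lost. Connectedness of the base is needed to slide the point at which a suspension is attached to
  the wedge point; without it the result could depend on the component. Some links lose both pairs,
  that is, the whole first column. What is left of Gamma_n is then empty for n = 0 and a copy of
  Lambda_{n-1} otherwise. Hence a second statement runs through the induction, and levels start at
  the empty space. Two columns are peeled off at a time because the diagonals depend on a parity.
  The many reductions are data for a checker, whose soundness is proved once for an arbitrary host
  graph; null-homotopies enter it as finite lists of moves of single vertices.\<close>

abbreviation unit_interval :: "real topology" where
  "unit_interval \<equiv> top_of_set {0..1}"

section \<open>Homotopies out of spaces with a final topology\<close>

text \<open>The tube lemma: an open set containing \<open>J \<times> {x}\<close> contains
  \<open>J \<times> V\<close> for some neighbourhood \<open>V\<close> of \<open>x\<close>.\<close>

lemma openin_tube:
  assumes "continuous_map (prod_topology T X) Z g" "openin Z W" "compactin T J"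
  shows "openin X {x \<in> topspace X. \<forall>s\<in>J. g (s, x) \<in> W}"
proof (subst openin_subopen, intro ballI)
  fix x assume x: "x \<in> {x \<in> topspace X. \<forall>s\<in>J. g (s, x) \<in> W}"
  let ?O = "{z \<in> topspace (prod_topology T X). g z \<in> W}"
  have O: "openin (prod_topology T X) ?O"
    using assms(1,2) by (rule openin_continuous_map_preimage)
  have "J \<times> {x} \<subseteq> ?O"
    using x compactin_subset_topspace[OF assms(3)] by auto
  then obtain U V where UV: "openin T U" "openin X V" "J \<subseteq> U" "x \<in> V" "U \<times> V \<subseteq> ?O"
    using tube_lemma_left[OF O assms(3), of x] x by auto
  have "V \<subseteq> {x \<in> topspace X. \<forall>s\<in>J. g (s, x) \<in> W}"
    using UV openin_subset by fastforce
  then show "\<exists>V. openin X V \<and> x \<in> V \<and> V \<subseteq> {x \<in> topspace X. \<forall>s\<in>J. g (s, x) \<in> W}"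
    using UV by blast
qed

text \<open>
  Together with \<open>openin_tube\<close> this makes homotopies out of a space with a quotient (final)
  topology continuous as soon as their pullbacks are.
\<close>

lemma continuous_map_prod_final:
  assumes T: "compact_space T" "Hausdorff_space T"
    and tube: "\<And>J W. compactin T J \<Longrightarrow> openin Z W \<Longrightarrow>
      openin X {x \<in> topspace X. \<forall>s\<in>J. k (s, x) \<in> W}"
    and slice: "\<And>x. x \<in> topspace X \<Longrightarrow> continuous_map T Z (\<lambda>s. k (s, x))"
  shows "continuous_map (prod_topology T X) Z k"
  unfolding continuous_map_def
proof (intro conjI allI impI)
  show "k \<in> topspace (prod_topology T X) \<rightarrow> topspace Z"
    using slice by (auto simp: continuous_map_def Pi_iff)
  fix W assume W: "openin Z W"
  let ?O = "{z \<in> topspace (prod_topology T X). k z \<in> W}"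
  show "openin (prod_topology T X) ?O"
  proof (subst openin_subopen, intro ballI)
    fix z assume z: "z \<in> ?O"
    obtain s x where zs: "z = (s, x)" by (cases z)
    have sx: "s \<in> topspace T" "x \<in> topspace X" "k (s, x) \<in> W" using z zs by auto
    \<comment> \<open>The tube condition speaks of compact sets of parameters only. Local
      compactness of \<open>T\<close> supplies a compact neighbourhood \<open>J\<close> of
      \<open>s\<close> on which the slice at \<open>x\<close> stays in \<open>W\<close>.\<close>
    have "neighbourhood_base_of (compactin T) T"
      using T locally_compact_space_neighbourhood_base compact_imp_locally_compact_space by blast
    moreover have "openin T {r \<in> topspace T. k (r, x) \<in> W}"
      using slice[OF sx(2)] W by (rule openin_continuous_map_preimage)
    ultimately obtain U J where UJ: "openin T U" "compactin T J" "s \<in> U" "U \<subseteq> J" "J \<subseteq> {r \<in> topspace T. k (r, x) \<in> W}"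
      using sx unfolding neighbourhood_base_of by (metis (mono_tags, lifting) mem_Collect_eq)
    let ?V = "{x \<in> topspace X. \<forall>s\<in>J. k (s, x) \<in> W}"
    have "x \<in> ?V" using sx UJ by auto
    moreover have "U \<times> ?V \<subseteq> ?O" using UJ by auto
    ultimately show "\<exists>V. openin (prod_topology T X) V \<and> z \<in> V \<and> V \<subseteq> ?O"
      using UJ tube[OF UJ(2) W] zs by (intro exI[of _ "U \<times> ?V"]) (auto simp: openin_prod_Times_iff)
  qed
qed

lemma compact_unit_interval: "compact_space unit_interval"
  and Hausdorff_unit_interval: "Hausdorff_space unit_interval"
  by (auto simp: compact_space_subtopology Hausdorff_space_subtopology)

section \<open>Mapping cones\<close>

text \<open>Normal forms of the points of the cone: parameter 0 is glued to the base by
  \<open>f\<close>, parameter 1 is the apex \<open>None\<close>, and only points strictly in between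
  keep their own name.\<close>

definition cone_pt :: "('l \<Rightarrow> 'y) \<Rightarrow> real \<times> 'l \<Rightarrow> ('y + real \<times> 'l) option" where
  "cone_pt f z = (if fst z \<le> 0 then Some (Inl (f (snd z)))
                  else if 1 \<le> fst z then None else Some (Inr z))"

definition base_pt :: "'y \<Rightarrow> ('y + real \<times> 'l) option" where
  "base_pt y = Some (Inl y)"

text \<open>The final topology for \<open>base_pt\<close> and \<open>cone_pt f\<close>. The apex is
  inserted separately, so that the cone over the empty space is a point and the mapping cone of an
  empty \<open>L\<close> is \<open>Y\<close> with an isolated point added.\<close>

definition mapping_cone :: "'l topology \<Rightarrow> 'y topology \<Rightarrow> ('l \<Rightarrow> 'y) \<Rightarrow> ('y + real \<times> 'l) option topology" where
  "mapping_cone L Y f = topology (\<lambda>U.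
     U \<subseteq> insert None (base_pt ` topspace Y \<union> cone_pt f ` ({0..1} \<times> topspace L)) \<and>
     openin Y {y \<in> topspace Y. base_pt y \<in> U} \<and>
     openin (prod_topology unit_interval L) {z \<in> {0..1} \<times> topspace L. cone_pt f z \<in> U})"

lemma openin_mapping_cone:
  "openin (mapping_cone L Y f) U \<longleftrightarrow>
     U \<subseteq> insert None (base_pt ` topspace Y \<union> cone_pt f ` ({0..1} \<times> topspace L)) \<and>
     openin Y {y \<in> topspace Y. base_pt y \<in> U} \<and>
     openin (prod_topology unit_interval L) {z \<in> {0..1} \<times> topspace L. cone_pt f z \<in> U}"
proof -
  have 1: "{x \<in> A. p x \<in> S \<inter> T} = {x \<in> A. p x \<in> S} \<inter> {x \<in> A. p x \<in> T}" for A S T and p :: "'c \<Rightarrow> 'd"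
    by blast
  have 2: "{x \<in> A. p x \<in> \<Union>\<K>} = (\<Union>K\<in>\<K>. {x \<in> A. p x \<in> K})" for A \<K> and p :: "'c \<Rightarrow> 'd"
    by blast
  let ?P = "\<lambda>U. U \<subseteq> insert None (base_pt ` topspace Y \<union> cone_pt f ` ({0..1} \<times> topspace L)) \<and>
     openin Y {y \<in> topspace Y. base_pt y \<in> U} \<and>
     openin (prod_topology unit_interval L) {z \<in> {0..1} \<times> topspace L. cone_pt f z \<in> U}"
  have "istopology ?P"
    unfolding istopology_def
  proof (rule conjI; intro allI impI)
    fix S T assume "?P S" "?P T"
    then show "?P (S \<inter> T)" unfolding 1 by (auto intro: openin_Int)
  next
    fix \<K> assume K: "\<forall>K\<in>\<K>. ?P K"
    then show "?P (\<Union>\<K>)" unfolding 2 by (intro conjI Union_least openin_Union) auto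
  qed
  then show ?thesis by (simp add: mapping_cone_def)
qed

lemma topspace_mapping_cone:
  "topspace (mapping_cone L Y f) =
     insert None (base_pt ` topspace Y \<union> cone_pt f ` ({0..1} \<times> topspace L))" (is "_ = ?A")
proof
  show "topspace (mapping_cone L Y f) \<subseteq> ?A"
    using openin_topspace[of "mapping_cone L Y f"] unfolding openin_mapping_cone by blast
  have "{y \<in> topspace Y. base_pt y \<in> ?A} = topspace Y"
    "{z \<in> {0..1} \<times> topspace L. cone_pt f z \<in> ?A} = topspace (prod_topology unit_interval L)"
    by auto
  then have "openin (mapping_cone L Y f) ?A"
    unfolding openin_mapping_cone by (simp only: openin_topspace subset_refl conj_absorb simp_thms)
  then show "?A \<subseteq> topspace (mapping_cone L Y f)" by (rule openin_subset)
qed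

lemma continuous_map_base_pt: "continuous_map Y (mapping_cone L Y f) base_pt"
  by (auto simp: continuous_map_def openin_mapping_cone topspace_mapping_cone)

lemma continuous_map_cone_pt:
  "continuous_map (prod_topology unit_interval L) (mapping_cone L Y f) (cone_pt f)"
  by (auto simp: continuous_map_def openin_mapping_cone topspace_mapping_cone)

text \<open>The universal property of the final topology. The apex has its own hypothesis because it
  is not of the form \<open>cone_pt f z\<close> when \<open>L\<close> is empty.\<close>

lemma continuous_map_from_mapping_cone:
  assumes "continuous_map Y Z (\<lambda>y. k (base_pt y))"
    "continuous_map (prod_topology unit_interval L) Z (\<lambda>z. k (cone_pt f z))"
    "k None \<in> topspace Z"
  shows "continuous_map (mapping_cone L Y f) Z k"
  unfolding continuous_map_def
proof (intro conjI allI impI)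
  show "k \<in> topspace (mapping_cone L Y f) \<rightarrow> topspace Z"
    using assms unfolding topspace_mapping_cone continuous_map_def by auto
  fix W assume W: "openin Z W"
  let ?U = "{x \<in> topspace (mapping_cone L Y f). k x \<in> W}"
  have "{y \<in> topspace Y. base_pt y \<in> ?U} = {y \<in> topspace Y. k (base_pt y) \<in> W}"
    "{z \<in> {0..1} \<times> topspace L. cone_pt f z \<in> ?U} =
       {z \<in> topspace (prod_topology unit_interval L). k (cone_pt f z) \<in> W}"
    by (auto simp: topspace_mapping_cone)
  moreover have "openin Y {y \<in> topspace Y. k (base_pt y) \<in> W}"
    using assms(1) W by (rule openin_continuous_map_preimage)
  moreover have "openin (prod_topology unit_interval L)
      {z \<in> topspace (prod_topology unit_interval L). k (cone_pt f z) \<in> W}"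
    using assms(2) W by (rule openin_continuous_map_preimage)
  ultimately show "openin (mapping_cone L Y f) ?U"
    unfolding openin_mapping_cone topspace_mapping_cone by auto
qed

text \<open>The product with the compact interval respects the final topology, by
  \<open>continuous_map_prod_final\<close>; the tube condition can be tested on the base and on the
  cylinder separately.\<close>

lemma continuous_map_homotopy_from_mapping_cone:
  assumes base: "continuous_map (prod_topology unit_interval Y) Z (\<lambda>(s, y). k (s, base_pt y))"
    and cone: "continuous_map (prod_topology unit_interval (prod_topology unit_interval L)) Z
      (\<lambda>(s, z). k (s, cone_pt f z))"
    and apex: "continuous_map unit_interval Z (\<lambda>s. k (s, None))"
  shows "continuous_map (prod_topology unit_interval (mapping_cone L Y f)) Z k"
proof (rule continuous_map_prod_final[OF compact_unit_interval Hausdorff_unit_interval])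
  fix x assume x: "x \<in> topspace (mapping_cone L Y f)"
  have 1: "continuous_map unit_interval Z (\<lambda>s. k (s, base_pt y))" if "y \<in> topspace Y" for y
    using continuous_map_compose[OF _ base, of unit_interval "\<lambda>s. (s, y)"] that
    by (auto simp: o_def continuous_map_pairwise)
  have 2: "continuous_map unit_interval Z (\<lambda>s. k (s, cone_pt f z))"
    if "z \<in> {0..1} \<times> topspace L" for z
    using continuous_map_compose[OF _ cone, of unit_interval "\<lambda>s. (s, z)"] that
    by (auto simp: o_def continuous_map_pairwise)
  from x show "continuous_map unit_interval Z (\<lambda>s. k (s, x))"
    unfolding topspace_mapping_cone using 1 2 apex by blast
next
  fix J W assume J: "compactin unit_interval J" and W: "openin Z W"
  let ?U = "{x \<in> topspace (mapping_cone L Y f). \<forall>s\<in>J. k (s, x) \<in> W}"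
  have "{y \<in> topspace Y. base_pt y \<in> ?U} = {y \<in> topspace Y. \<forall>s\<in>J. k (s, base_pt y) \<in> W}"
    "{z \<in> {0..1} \<times> topspace L. cone_pt f z \<in> ?U} =
       {z \<in> topspace (prod_topology unit_interval L). \<forall>s\<in>J. k (s, cone_pt f z) \<in> W}"
    by (auto simp: topspace_mapping_cone)
  then show "openin (mapping_cone L Y f) ?U"
    unfolding openin_mapping_cone topspace_mapping_cone
    using openin_tube[OF base W J] openin_tube[OF cone W J] by auto
qed

text \<open>
  The cone over \<open>L\<close> prolonged by the trace of a homotopy \<open>h\<close> starting at \<open>f\<close>:
  the parameter runs over \<open>{-1..1}\<close>.
\<close>

definition long_cone_pt :: "(real \<times> 'l \<Rightarrow> 'y) \<Rightarrow> ('l \<Rightarrow> 'y) \<Rightarrow> real \<times> 'l \<Rightarrow> ('y + real \<times> 'l) option" where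
  "long_cone_pt h f z = (if fst z \<le> 0 then base_pt (h (- fst z, snd z)) else cone_pt f z)"

lemma continuous_map_long_cone_pt:
  assumes h: "continuous_map (prod_topology unit_interval L) Y h"
    and h0: "\<And>l. l \<in> topspace L \<Longrightarrow> h (0, l) = f l"
    and a: "continuous_map X euclideanreal a" "\<And>x. x \<in> topspace X \<Longrightarrow> -1 \<le> a x \<and> a x \<le> 1"
    and b: "continuous_map X L b"
  shows "continuous_map X (mapping_cone L Y f) (\<lambda>x. long_cone_pt h f (a x, b x))"
proof -
  have "continuous_map X (mapping_cone L Y f)
     (\<lambda>x. if a x \<le> 0 then base_pt (h (- a x, b x)) else cone_pt f (a x, b x))"
  proof (rule continuous_map_cases_le)
    show "continuous_map X euclideanreal a" by (rule a)
    let ?X1 = "subtopology X {x \<in> topspace X. a x \<le> 0}"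
    have "continuous_map ?X1 (prod_topology unit_interval L) (\<lambda>x. (- a x, b x))"
      using a b by (auto simp: continuous_map_pairwise o_def continuous_map_in_subtopology
          intro!: continuous_map_from_subtopology continuous_map_minus)
    then show "continuous_map ?X1 (mapping_cone L Y f) (\<lambda>x. base_pt (h (- a x, b x)))"
      using continuous_map_compose[OF continuous_map_compose[OF _ h] continuous_map_base_pt]
      by (fastforce simp: o_def)
    let ?X2 = "subtopology X {x \<in> topspace X. 0 \<le> a x}"
    have "continuous_map ?X2 (prod_topology unit_interval L) (\<lambda>x. (a x, b x))"
      using a b by (auto simp: continuous_map_pairwise o_def continuous_map_in_subtopology
          intro!: continuous_map_from_subtopology)
    then show "continuous_map ?X2 (mapping_cone L Y f) (\<lambda>x. cone_pt f (a x, b x))"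
      using continuous_map_compose[OF _ continuous_map_cone_pt] by (fastforce simp: o_def)
    \<comment> \<open>On the seam both formulas give \<open>base_pt (f (b x))\<close>, because
      \<open>h\<close> starts at \<open>f\<close>.\<close>
    fix x assume "x \<in> topspace X" "a x = 0"
    then show "base_pt (h (- a x, b x)) = cone_pt f (a x, b x)"
      using h0[of "b x"] b by (auto simp: cone_pt_def base_pt_def continuous_map_def)
  qed auto
  then show ?thesis unfolding long_cone_pt_def fst_conv snd_conv .
qed

section \<open>Maps and homotopies out of a mapping cone\<close>

definition cone_map :: "('y \<Rightarrow> 'z) \<Rightarrow> (real \<times> 'l \<Rightarrow> 'z) \<Rightarrow> 'z \<Rightarrow> ('y + real \<times> 'l) option \<Rightarrow> 'z" where
  "cone_map A B e x = (case x of None \<Rightarrow> e | Some (Inl y) \<Rightarrow> A y | Some (Inr z) \<Rightarrow> B z)"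

lemma cone_map_None [simp]: "cone_map A B e None = e"
  by (simp add: cone_map_def)

lemma cone_map_base [simp]: "cone_map A B e (base_pt y) = A y"
  by (simp add: cone_map_def base_pt_def)

lemma cone_map_cone:
  assumes "0 \<le> t" "t \<le> 1" "B (0, l) = A (f l)" "B (1, l) = e"
  shows "cone_map A B e (cone_pt f (t, l)) = B (t, l)"
  using assms by (auto simp: cone_map_def cone_pt_def dest: antisym)

lemma cone_pt_0 [simp]: "cone_pt f (0, l) = base_pt (f l)"
  and cone_pt_1 [simp]: "cone_pt f (1, l) = None"
  by (auto simp: cone_pt_def base_pt_def)

lemma long_cone_pt_minus1 [simp]: "long_cone_pt h f (-1, l) = base_pt (h (1, l))"
  and long_cone_pt_1 [simp]: "long_cone_pt h f (1, l) = None"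
  and long_cone_pt_nonpos: "t \<le> 0 \<Longrightarrow> long_cone_pt h f (t, l) = base_pt (h (-t, l))"
  and long_cone_pt_pos: "0 < t \<Longrightarrow> long_cone_pt h f (t, l) = cone_pt f (t, l)"
  and long_cone_pt_nonneg: "h (0, l) = f l \<Longrightarrow> 0 \<le> t \<Longrightarrow> long_cone_pt h f (t, l) = cone_pt f (t, l)"
  by (auto simp: long_cone_pt_def cone_pt_def base_pt_def)

lemma continuous_map_cone_map:
  assumes "continuous_map Y Z A" "continuous_map (prod_topology unit_interval L) Z B" "e \<in> topspace Z"
    and "\<And>l. l \<in> topspace L \<Longrightarrow> B (0, l) = A (f l)" "\<And>l. l \<in> topspace L \<Longrightarrow> B (1, l) = e"
  shows "continuous_map (mapping_cone L Y f) Z (cone_map A B e)"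
proof (rule continuous_map_from_mapping_cone)
  show "continuous_map (prod_topology unit_interval L) Z (\<lambda>z. cone_map A B e (cone_pt f z))"
    by (rule continuous_map_eq[OF assms(2)]) (use assms(4,5) in \<open>auto simp: cone_map_cone\<close>)
qed (use assms in auto)

text \<open>The apex may travel along the path \<open>e\<close>. This freedom is used for cones over
  wedges of spheres, where the arc ending in the apex is contracted.\<close>

lemma homotopic_cone_map:
  assumes A: "continuous_map (prod_topology unit_interval Y) Z A"
    and B: "continuous_map (prod_topology unit_interval (prod_topology unit_interval L)) Z B"
    and e: "continuous_map unit_interval Z e"
    and B0: "\<And>s l. 0 \<le> s \<Longrightarrow> s \<le> 1 \<Longrightarrow> l \<in> topspace L \<Longrightarrow> B (s, (0, l)) = A (s, f l)"
    and B1: "\<And>s l. 0 \<le> s \<Longrightarrow> s \<le> 1 \<Longrightarrow> l \<in> topspace L \<Longrightarrow> B (s, (1, l)) = e s"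
  shows "homotopic_with (\<lambda>_. True) (mapping_cone L Y f) Z
     (cone_map (\<lambda>y. A (0, y)) (\<lambda>z. B (0, z)) (e 0)) (cone_map (\<lambda>y. A (1, y)) (\<lambda>z. B (1, z)) (e 1))"
proof -
  let ?k = "\<lambda>(s, x). cone_map (\<lambda>y. A (s, y)) (\<lambda>z. B (s, z)) (e s) x"
  have "continuous_map (prod_topology unit_interval (mapping_cone L Y f)) Z ?k"
  proof (rule continuous_map_homotopy_from_mapping_cone)
    show "continuous_map (prod_topology unit_interval (prod_topology unit_interval L)) Z
        (\<lambda>(s, z). ?k (s, cone_pt f z))"
      by (rule continuous_map_eq[OF B]) (use B0 B1 in \<open>auto simp: cone_map_cone\<close>)
  qed (use A e in \<open>auto simp: case_prod_unfold\<close>)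
  then show ?thesis
    unfolding homotopic_with_def by (intro exI[of _ ?k]) auto
qed

lemma homotopic_from_mapping_cone_eq:
  assumes "homotopic_with (\<lambda>_. True) (mapping_cone L Y f) Z p q"
    and "\<And>y. y \<in> topspace Y \<Longrightarrow> p' (base_pt y) = p (base_pt y)"
    and "\<And>y. y \<in> topspace Y \<Longrightarrow> q' (base_pt y) = q (base_pt y)"
    and "\<And>t l. 0 \<le> t \<Longrightarrow> t \<le> 1 \<Longrightarrow> l \<in> topspace L \<Longrightarrow> p' (cone_pt f (t, l)) = p (cone_pt f (t, l))"
    and "\<And>t l. 0 \<le> t \<Longrightarrow> t \<le> 1 \<Longrightarrow> l \<in> topspace L \<Longrightarrow> q' (cone_pt f (t, l)) = q (cone_pt f (t, l))"
    and "p' None = p None" "q' None = q None"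
  shows "homotopic_with (\<lambda>_. True) (mapping_cone L Y f) Z p' q'"
  using assms(1) by (rule homotopic_with_eq) (use assms(2-) in \<open>auto simp: topspace_mapping_cone\<close>)

section \<open>Homotopy equivalences\<close>

abbreviation homotopic :: "'a topology \<Rightarrow> 'b topology \<Rightarrow> ('a \<Rightarrow> 'b) \<Rightarrow> ('a \<Rightarrow> 'b) \<Rightarrow> bool" where
  "homotopic \<equiv> homotopic_with (\<lambda>_. True)"

definition homotopy_equivalence :: "'a topology \<Rightarrow> 'b topology \<Rightarrow> ('a \<Rightarrow> 'b) \<Rightarrow> bool" where
  "homotopy_equivalence X Y f \<longleftrightarrow> continuous_map X Y f \<and>
     (\<exists>g. continuous_map Y X g \<and> homotopic X X (g \<circ> f) id \<and> homotopic Y Y (f \<circ> g) id)"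

lemma homotopic_compose:
  assumes "homotopic X Y f f'" "homotopic Y Z g g'"
  shows "homotopic X Z (g \<circ> f) (g' \<circ> f')"
  using homotopic_with_trans[OF homotopic_with_compose_continuous_map_right[OF assms(2), of X f]
      homotopic_with_compose_continuous_map_left[OF assms(1), of Z g']]
    homotopic_with_imp_continuous_maps[OF assms(1)] homotopic_with_imp_continuous_maps[OF assms(2)]
  by auto

lemma homotopy_equivalence_homotopic:
  assumes "homotopy_equivalence X Y f" "homotopic X Y f f'"
  shows "homotopy_equivalence X Y f'"
proof -
  obtain g where g: "continuous_map Y X g" "homotopic X X (g \<circ> f) id" "homotopic Y Y (f \<circ> g) id"
    using assms by (auto simp: homotopy_equivalence_def)
  have f': "continuous_map X Y f'" "homotopic X Y f' f"
    using assms(2) homotopic_with_imp_continuous_maps homotopic_with_symD by blast+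
  have "homotopic X X (g \<circ> f') id"
    using homotopic_with_trans[OF homotopic_compose[OF f'(2), of X g g] g(2)] g(1) by simp
  moreover have "homotopic Y Y (f' \<circ> g) id"
    using homotopic_with_trans[OF homotopic_compose[OF _ f'(2), of Y g g] g(3)] g(1) by simp
  ultimately show ?thesis
    using f' g(1) unfolding homotopy_equivalence_def by blast
qed

text \<open>With \<open>p\<close> inverse to \<open>b \<circ> a\<close> and \<open>q\<close> inverse
  to \<open>c \<circ> b\<close>, the inverse of \<open>a\<close> is \<open>p \<circ> b\<close>. It
  is a left inverse by the choice of \<open>p\<close>; for the other side,
  \<open>q \<circ> c \<circ> b\<close> is put in front so that \<open>b \<circ> a \<circ> p\<close>
  can be cancelled in the middle.\<close>

lemma homotopy_equivalence_2_of_6: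
  assumes a: "continuous_map A B a" and b: "continuous_map B C b" and c: "continuous_map C D c"
    and ba: "homotopy_equivalence A C (b \<circ> a)" and cb: "homotopy_equivalence B D (c \<circ> b)"
  shows "homotopy_equivalence A B a"
proof -
  note homotopic_with_trans [trans]
  obtain p where p: "continuous_map C A p" "homotopic A A (p \<circ> (b \<circ> a)) id" "homotopic C C ((b \<circ> a) \<circ> p) id"
    using ba by (auto simp: homotopy_equivalence_def)
  obtain q where q: "continuous_map D B q" "homotopic B B (q \<circ> (c \<circ> b)) id"
    using cb by (auto simp: homotopy_equivalence_def)
  have apb: "continuous_map B B (a \<circ> p \<circ> b)"
    using a b p by (auto intro: continuous_map_compose)
  have "homotopic B B ((a \<circ> p \<circ> b)) (q \<circ> (c \<circ> b) \<circ> (a \<circ> p \<circ> b))"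
    using homotopic_compose[OF _ q(2), of B "a \<circ> p \<circ> b" "a \<circ> p \<circ> b"] apb homotopic_with_symD by fastforce
  also have "q \<circ> (c \<circ> b) \<circ> (a \<circ> p \<circ> b) = (q \<circ> c) \<circ> (((b \<circ> a) \<circ> p) \<circ> b)"
    by (simp add: o_assoc)
  also have "homotopic B B \<dots> ((q \<circ> c) \<circ> (id \<circ> b))"
    by (intro homotopic_compose[OF homotopic_compose[OF _ p(3)]])
       (use b c q in \<open>auto intro: continuous_map_compose\<close>)
  also have "(q \<circ> c) \<circ> (id \<circ> b) = q \<circ> (c \<circ> b)" by auto
  also have "homotopic B B \<dots> id" by (rule q(2))
  finally have "homotopic B B (a \<circ> (p \<circ> b)) id" by (simp add: o_def)
  moreover have "homotopic A A ((p \<circ> b) \<circ> a) id" using p(2) by (simp add: o_assoc)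
  moreover have "continuous_map B A (p \<circ> b)" using b p by (auto intro: continuous_map_compose)
  ultimately show ?thesis unfolding homotopy_equivalence_def using a by blast
qed

lemma homotopy_equivalence_imp_space:
  "homotopy_equivalence X Y f \<Longrightarrow> X homotopy_equivalent_space Y"
  unfolding homotopy_equivalence_def homotopy_equivalent_space_def by blast

section \<open>Homotopy invariance of mapping cones\<close>

text \<open>For a homotopy \<open>h\<close> from \<open>f\<close> to \<open>f'\<close> this maps the
  cone of \<open>f'\<close> to the cone of \<open>f\<close>. The parameter \<open>2 * t - 1\<close>
  covers the prolonged cone: the lower half of the cone runs through \<open>h\<close> backwards,
  from \<open>f'\<close> to \<open>f\<close>, and the upper half covers the whole cone of
  \<open>f\<close>.\<close>

definition cone_shift :: "(real \<times> 'l \<Rightarrow> 'y) \<Rightarrow> ('l \<Rightarrow> 'y) \<Rightarrow> ('y + real \<times> 'l) option \<Rightarrow> ('y + real \<times> 'l) option" where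
  "cone_shift h f = cone_map base_pt (\<lambda>z. long_cone_pt h f (2 * fst z - 1, snd z)) None"

lemma continuous_map_cone_shift:
  assumes "continuous_map (prod_topology unit_interval L) Y h"
    and "\<And>l. l \<in> topspace L \<Longrightarrow> h (0, l) = f l" "\<And>l. l \<in> topspace L \<Longrightarrow> h (1, l) = f' l"
  shows "continuous_map (mapping_cone L Y f') (mapping_cone L Y f) (cone_shift h f)"
  unfolding cone_shift_def
proof (rule continuous_map_cone_map)
  have "continuous_map (prod_topology unit_interval L) euclideanreal fst"
    using continuous_map_fst[of unit_interval L] by (simp add: continuous_map_in_subtopology)
  then show "continuous_map (prod_topology unit_interval L) (mapping_cone L Y f)
      (\<lambda>z. long_cone_pt h f (2 * fst z - 1, snd z))"
    by (intro continuous_map_long_cone_pt[OF assms(1,2)] continuous_map_snd) (auto intro!: continuous_intros)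
qed (use assms in \<open>auto simp: continuous_map_base_pt topspace_mapping_cone\<close>)

lemma cone_shift_cone_shift:
  assumes h: "continuous_map (prod_topology unit_interval L) Y h"
    and h0: "\<And>l. l \<in> topspace L \<Longrightarrow> h (0, l) = f l" and h1: "\<And>l. l \<in> topspace L \<Longrightarrow> h (1, l) = f' l"
  shows "homotopic (mapping_cone L Y f) (mapping_cone L Y f)
     (cone_shift h f \<circ> cone_shift (\<lambda>(s, l). h (1 - s, l)) f') id"
proof -
  let ?C = "mapping_cone L Y f"
  \<comment> \<open>At \<open>s = 0\<close> this is the height of the composite in the prolonged
    cone: \<open>- (2 * t)\<close> for \<open>t \<le> 1/2\<close>, where the first shift follows the
    reversed homotopy, and \<open>4 * t - 3 = 2 * (2 * t - 1) - 1\<close> afterwards. Both are -1 at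
    \<open>t = 1/2\<close>, where they cross, so the composite is their maximum. The path down and
    back up is pulled straight to the height \<open>t\<close> at \<open>s = 1\<close>, with both
    ends fixed.\<close>
  let ?c = "\<lambda>s t :: real. (1 - s) * max (- (2 * t)) (4 * t - 3) + s * t"
  let ?B = "\<lambda>z. long_cone_pt h f (?c (fst z) (fst (snd z)), snd (snd z))"
  have c: "-1 \<le> ?c s t \<and> ?c s t \<le> 1" if "0 \<le> s" "s \<le> 1" "0 \<le> t" "t \<le> 1" for s t
  proof
    have "-1 \<le> max (- (2 * t)) (4 * t - 3)" using that by (auto simp: max_def)
    then have "(1 - s) * (-1) + s * (-1) \<le> ?c s t" using that
      by (intro add_mono mult_left_mono) auto
    then show "-1 \<le> ?c s t" by simp
    have "max (- (2 * t)) (4 * t - 3) \<le> 1" using that by (auto simp: max_def)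
    then have "?c s t \<le> (1 - s) * 1 + s * 1" using that
      by (intro add_mono mult_left_mono) auto
    then show "?c s t \<le> 1" by simp
  qed
  let ?P = "prod_topology unit_interval (prod_topology unit_interval L)"
  have s: "continuous_map ?P euclideanreal fst" and t: "continuous_map ?P euclideanreal (fst \<circ> snd)"
    and l: "continuous_map ?P L (snd \<circ> snd)"
    using continuous_map_fst[of unit_interval "prod_topology unit_interval L"]
      continuous_map_compose[OF continuous_map_snd[of unit_interval "prod_topology unit_interval L"] continuous_map_fst]
      continuous_map_compose[OF continuous_map_snd[of unit_interval "prod_topology unit_interval L"] continuous_map_snd]
    by (auto simp: continuous_map_in_subtopology)
  have "homotopic ?C ?C (cone_map (\<lambda>y. base_pt (snd (0 :: real, y))) (\<lambda>z. ?B (0, z)) None)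
      (cone_map (\<lambda>y. base_pt (snd (1 :: real, y))) (\<lambda>z. ?B (1, z)) None)"
  proof (rule homotopic_cone_map[where A="\<lambda>z. base_pt (snd z)" and e="\<lambda>_. None" and B="?B"])
    show "continuous_map (prod_topology unit_interval Y) ?C (\<lambda>z. base_pt (snd z))"
      using continuous_map_compose[OF continuous_map_snd continuous_map_base_pt] by (simp add: o_def)
    have cc: "continuous_map ?P euclideanreal (\<lambda>x. ?c (fst x) (fst (snd x)))"
      using s t by (intro continuous_intros continuous_map_real_max) (simp_all add: o_def)
    show "continuous_map ?P ?C ?B"
    proof (rule continuous_map_long_cone_pt[OF h h0 cc])
      show "-1 \<le> ?c (fst x) (fst (snd x)) \<and> ?c (fst x) (fst (snd x)) \<le> 1" if "x \<in> topspace ?P" for x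
        using that by (intro c) auto
    qed (use l in \<open>simp_all add: o_def\<close>)
  qed (use h0 in \<open>auto simp: topspace_mapping_cone max_def long_cone_pt_nonneg\<close>)
  then show ?thesis
  proof (rule homotopic_from_mapping_cone_eq)
    fix t :: real and l assume t: "0 \<le> t" "t \<le> 1" and l: "l \<in> topspace L"
    have 1: "cone_shift (\<lambda>(s, l). h (1 - s, l)) f' (cone_pt f (t, l)) = long_cone_pt (\<lambda>(s, l). h (1 - s, l)) f' (2 * t - 1, l)"
      unfolding cone_shift_def using t l h0 h1 by (subst cone_map_cone) auto
    have 2: "cone_shift h f (cone_pt f' (r, l)) = long_cone_pt h f (2 * r - 1, l)" if "0 \<le> r" "r \<le> 1" for r
      unfolding cone_shift_def using that l h0 h1 by (subst cone_map_cone) auto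
    have 3: "cone_map (\<lambda>y. base_pt (snd (0 :: real, y))) (\<lambda>z. ?B (0, z)) None (cone_pt f (t, l)) = ?B (0, (t, l))"
      using t l h0 by (subst cone_map_cone) (auto simp: long_cone_pt_nonneg max_def)
    show "(cone_shift h f \<circ> cone_shift (\<lambda>(s, l). h (1 - s, l)) f') (cone_pt f (t, l)) =
        cone_map (\<lambda>y. base_pt (snd (0 :: real, y))) (\<lambda>z. ?B (0, z)) None (cone_pt f (t, l))"
    proof (cases "2 * t \<le> 1")
      case True
      then have "max (- (2 * t)) (4 * t - 3) = - (2 * t)" by simp
      with True show ?thesis using t unfolding o_def 1 3
        by (simp add: long_cone_pt_nonpos cone_shift_def)
    next
      case False
      then have "max (- (2 * t)) (4 * t - 3) = 4 * t - 3" by simp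
      with False show ?thesis using t unfolding o_def 1 3
        by (simp add: long_cone_pt_pos 2)
    qed
    show "id (cone_pt f (t, l)) = cone_map (\<lambda>y. base_pt (snd (1 :: real, y))) (\<lambda>z. ?B (1, z)) None (cone_pt f (t, l))"
      using t l h0 by (subst cone_map_cone) (auto simp: long_cone_pt_nonneg)
  qed (auto simp: cone_shift_def)
qed

text \<open>The inverse is the shift along the reversed homotopy; the same cancellation lemma
  applies to both composites, since reversing twice gives \<open>h\<close> back.\<close>

lemma homotopy_equivalence_cone_shift:
  assumes h: "continuous_map (prod_topology unit_interval L) Y h"
    and h0: "\<And>l. l \<in> topspace L \<Longrightarrow> h (0, l) = f l" and h1: "\<And>l. l \<in> topspace L \<Longrightarrow> h (1, l) = f' l"
  shows "homotopy_equivalence (mapping_cone L Y f') (mapping_cone L Y f) (cone_shift h f)"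
proof -
  let ?h = "\<lambda>(s, l). h (1 - s, l)"
  have "continuous_map (prod_topology unit_interval L) (prod_topology unit_interval L) (\<lambda>(s, l). (1 - s, l))"
    using continuous_map_fst[of unit_interval L] continuous_map_snd[of unit_interval L]
    by (auto simp: continuous_map_pairwise o_def case_prod_unfold continuous_map_in_subtopology
        intro!: continuous_map_diff)
  from continuous_map_compose[OF this h]
  have h': "continuous_map (prod_topology unit_interval L) Y ?h"
    by (simp add: o_def case_prod_unfold)
  have h'': "(\<lambda>(s, l). ?h (1 - s, l)) = h" by auto
  show ?thesis
    unfolding homotopy_equivalence_def
  proof (intro conjI exI)
    show "continuous_map (mapping_cone L Y f') (mapping_cone L Y f) (cone_shift h f)"
      using continuous_map_cone_shift[OF h h0 h1] .
    show "continuous_map (mapping_cone L Y f) (mapping_cone L Y f') (cone_shift ?h f')"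
      by (rule continuous_map_cone_shift[OF h']) (simp_all add: h0 h1)
    show "homotopic (mapping_cone L Y f) (mapping_cone L Y f) (cone_shift h f \<circ> cone_shift ?h f') id"
      by (rule cone_shift_cone_shift[OF h h0 h1])
    show "homotopic (mapping_cone L Y f') (mapping_cone L Y f') (cone_shift ?h f' \<circ> cone_shift h f) id"
      using cone_shift_cone_shift[OF h', of f' f, unfolded h''] by (simp add: h0 h1)
  qed
qed

lemma mapping_cone_homotopic:
  assumes "homotopic L Y f f'"
  shows "mapping_cone L Y f homotopy_equivalent_space mapping_cone L Y f'"
proof -
  obtain h where h: "continuous_map (prod_topology unit_interval L) Y h" "\<And>l. h (0, l) = f l" "\<And>l. h (1, l) = f' l"
    using assms unfolding homotopic_with_def by blast
  show ?thesis
    unfolding homotopy_equivalent_space_sym[of "mapping_cone L Y f"]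
    by (intro homotopy_equivalence_imp_space[OF homotopy_equivalence_cone_shift[OF h(1)]] h)
qed

section \<open>Changing the base of a mapping cone\<close>

definition cone_base_map :: "('y \<Rightarrow> 'z) \<Rightarrow> ('l \<Rightarrow> 'y) \<Rightarrow> ('y + real \<times> 'l) option \<Rightarrow> ('z + real \<times> 'l) option" where
  "cone_base_map u f = cone_map (\<lambda>y. base_pt (u y)) (cone_pt (u \<circ> f)) None"

lemma continuous_map_cone_base_map:
  assumes "continuous_map Y Z u"
  shows "continuous_map (mapping_cone L Y f) (mapping_cone L Z (u \<circ> f)) (cone_base_map u f)"
  unfolding cone_base_map_def
  using continuous_map_compose[OF assms continuous_map_base_pt]
  by (intro continuous_map_cone_map) (auto simp: o_def continuous_map_cone_pt topspace_mapping_cone)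

text \<open>A deformation \<open>U\<close> of the identity to \<open>u\<close> also deforms
  \<open>f\<close> to \<open>u \<circ> f\<close>. The induced map on cones is homotopic to the shift
  along that deformation, which is already known to be an equivalence.\<close>

lemma homotopy_equivalence_cone_base_map_id:
  assumes u: "homotopic Y Y u id" and f: "continuous_map L Y f"
  shows "homotopy_equivalence (mapping_cone L Y f) (mapping_cone L Y (u \<circ> f)) (cone_base_map u f)"
proof -
  obtain U where U: "continuous_map (prod_topology unit_interval Y) Y U" "\<And>y. U (0, y) = y" "\<And>y. U (1, y) = u y"
    using homotopic_with_symD[OF u] unfolding homotopic_with_def by auto
  let ?h = "\<lambda>z. U (1 - fst z, f (snd z))"
  let ?C = "mapping_cone L Y (u \<circ> f)"
  have "continuous_map (prod_topology unit_interval L) (prod_topology unit_interval Y) (\<lambda>z. (1 - fst z, f (snd z)))"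
    using continuous_map_fst[of unit_interval L] continuous_map_compose[OF continuous_map_snd[of unit_interval L] f]
    by (auto simp: continuous_map_pairwise o_def continuous_map_in_subtopology intro!: continuous_map_diff)
  from continuous_map_compose[OF this U(1)]
  have h: "continuous_map (prod_topology unit_interval L) Y ?h" by (simp add: o_def)
  have h0: "?h (0, l) = (u \<circ> f) l" and h1: "?h (1, l) = f l" for l by (simp_all add: U)
  have shift: "homotopy_equivalence (mapping_cone L Y f) ?C (cone_shift ?h (u \<circ> f))"
    by (rule homotopy_equivalence_cone_shift[OF h h0 h1])
  \<comment> \<open>The height \<open>s - 1 + (2 - s) * t\<close> interpolates linearly in
    \<open>t\<close> between \<open>s - 1\<close> and 1: it is \<open>2 * t - 1\<close>, the shift,
    at \<open>s = 0\<close> and \<open>t\<close>, the base map, at \<open>s = 1\<close>. At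
    \<open>t = 0\<close> the point is \<open>U (s, f l)\<close>, which matches the deformation of
    the base.\<close>
  let ?B = "\<lambda>z. long_cone_pt ?h (u \<circ> f) (fst z - 1 + (2 - fst z) * fst (snd z), snd (snd z))"
  let ?P = "prod_topology unit_interval (prod_topology unit_interval L)"
  have s: "continuous_map ?P euclideanreal fst" and t: "continuous_map ?P euclideanreal (fst \<circ> snd)"
    and l: "continuous_map ?P L (snd \<circ> snd)"
    using continuous_map_fst[of unit_interval "prod_topology unit_interval L"]
      continuous_map_compose[OF continuous_map_snd[of unit_interval "prod_topology unit_interval L"] continuous_map_fst]
      continuous_map_compose[OF continuous_map_snd[of unit_interval "prod_topology unit_interval L"] continuous_map_snd]
    by (auto simp: continuous_map_in_subtopology)
  have c: "-1 \<le> s - 1 + (2 - s) * t \<and> s - 1 + (2 - s) * t \<le> 1" if "0 \<le> s" "s \<le> 1" "0 \<le> t" "t \<le> 1" for s t :: real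
  proof
    have "0 \<le> (2 - s) * t" using that by simp
    then show "-1 \<le> s - 1 + (2 - s) * t" using that by linarith
    have "(2 - s) * t \<le> (2 - s) * 1" using that by (intro mult_left_mono) auto
    then show "s - 1 + (2 - s) * t \<le> 1" by (simp add: algebra_simps)
  qed
  have "homotopic (mapping_cone L Y f) ?C (cone_map (\<lambda>y. base_pt (U (0, y))) (\<lambda>z. ?B (0, z)) None)
      (cone_map (\<lambda>y. base_pt (U (1, y))) (\<lambda>z. ?B (1, z)) None)"
  proof (rule homotopic_cone_map[where A="\<lambda>z. base_pt (U z)" and e="\<lambda>_. None" and B="?B"])
    show "continuous_map (prod_topology unit_interval Y) ?C (\<lambda>z. base_pt (U z))"
      using continuous_map_compose[OF U(1) continuous_map_base_pt] by (simp add: o_def)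
    have cc: "continuous_map ?P euclideanreal (\<lambda>x. fst x - 1 + (2 - fst x) * fst (snd x))"
      using s t by (intro continuous_intros) (simp_all add: o_def)
    show "continuous_map ?P ?C ?B"
    proof (rule continuous_map_long_cone_pt[OF h h0 cc])
      show "-1 \<le> fst x - 1 + (2 - fst x) * fst (snd x) \<and> fst x - 1 + (2 - fst x) * fst (snd x) \<le> 1"
        if "x \<in> topspace ?P" for x
        using that by (intro c) auto
    qed (use l in \<open>simp_all add: o_def\<close>)
  qed (auto simp: topspace_mapping_cone long_cone_pt_nonpos)
  then have "homotopic (mapping_cone L Y f) ?C (cone_shift ?h (u \<circ> f)) (cone_base_map u f)"
  proof (rule homotopic_from_mapping_cone_eq)
    fix t :: real and l assume t: "0 \<le> t" "t \<le> 1" and l: "l \<in> topspace L"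
    show "cone_shift ?h (u \<circ> f) (cone_pt f (t, l)) =
        cone_map (\<lambda>y. base_pt (U (0, y))) (\<lambda>z. ?B (0, z)) None (cone_pt f (t, l))"
      unfolding cone_shift_def using t by (subst (1 2) cone_map_cone) (auto simp: U algebra_simps)
    show "cone_base_map u f (cone_pt f (t, l)) =
        cone_map (\<lambda>y. base_pt (U (1, y))) (\<lambda>z. ?B (1, z)) None (cone_pt f (t, l))"
      unfolding cone_base_map_def using t h0 by (subst (1 2) cone_map_cone) (auto simp: U long_cone_pt_nonneg)
  qed (auto simp: cone_shift_def cone_base_map_def U)
  then show ?thesis
    using shift homotopy_equivalence_homotopic by blast
qed

lemma cone_base_map_compose:
  assumes "x \<in> topspace (mapping_cone L Y f)"
  shows "(cone_base_map v (u \<circ> f) \<circ> cone_base_map u f) x = cone_base_map (v \<circ> u) f x"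
  using assms unfolding topspace_mapping_cone
  by (auto simp: cone_base_map_def cone_map_cone o_assoc)

lemma homotopy_equivalence_eq:
  assumes "homotopy_equivalence X Y f" "\<And>x. x \<in> topspace X \<Longrightarrow> f x = g x"
  shows "homotopy_equivalence X Y g"
proof (rule homotopy_equivalence_homotopic[OF assms(1)])
  show "homotopic X Y f g"
    using assms by (intro homotopic_with_equal) (auto simp: homotopy_equivalence_def intro: continuous_map_eq)
qed

text \<open>The map induced by \<open>v\<close> does not return to the cone of \<open>f\<close> but
  to the cone of \<open>v \<circ> u \<circ> f\<close>, so it is not an inverse as it stands. In the
  chain induced by \<open>u\<close>, \<open>v\<close>, \<open>u\<close> the two consecutive
  composites are equivalences, and the two-out-of-six property applies.\<close>

proposition mapping_cone_base_homotopy_equivalence: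
  assumes u: "continuous_map Y Z u" and v: "continuous_map Z Y v"
    and vu: "homotopic Y Y (v \<circ> u) id" and uv: "homotopic Z Z (u \<circ> v) id"
    and f: "continuous_map L Y f"
  shows "mapping_cone L Y f homotopy_equivalent_space mapping_cone L Z (u \<circ> f)"
proof (rule homotopy_equivalence_imp_space, rule homotopy_equivalence_2_of_6)
  have uf: "continuous_map L Z (u \<circ> f)" using f u by (rule continuous_map_compose)
  show "continuous_map (mapping_cone L Y f) (mapping_cone L Z (u \<circ> f)) (cone_base_map u f)"
    by (rule continuous_map_cone_base_map[OF u])
  show "continuous_map (mapping_cone L Z (u \<circ> f)) (mapping_cone L Y (v \<circ> (u \<circ> f))) (cone_base_map v (u \<circ> f))"
    by (rule continuous_map_cone_base_map[OF v])
  show "continuous_map (mapping_cone L Y (v \<circ> (u \<circ> f))) (mapping_cone L Z (u \<circ> (v \<circ> (u \<circ> f))))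
      (cone_base_map u (v \<circ> (u \<circ> f)))"
    by (rule continuous_map_cone_base_map[OF u])
  show "homotopy_equivalence (mapping_cone L Y f) (mapping_cone L Y (v \<circ> (u \<circ> f)))
      (cone_base_map v (u \<circ> f) \<circ> cone_base_map u f)"
    by (rule homotopy_equivalence_eq[OF homotopy_equivalence_cone_base_map_id[OF vu f, unfolded comp_assoc]])
       (rule cone_base_map_compose[symmetric])
  show "homotopy_equivalence (mapping_cone L Z (u \<circ> f)) (mapping_cone L Z (u \<circ> (v \<circ> (u \<circ> f))))
      (cone_base_map u (v \<circ> (u \<circ> f)) \<circ> cone_base_map v (u \<circ> f))"
    by (rule homotopy_equivalence_eq[OF homotopy_equivalence_cone_base_map_id[OF uv uf, unfolded comp_assoc]])
       (rule cone_base_map_compose[symmetric])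
qed

section \<open>Changing the fibre of a cone with constant attaching map\<close>

text \<open>As the attaching map is the constant \<open>c\<close>, any map of the fibres is
  compatible with the gluing and needs no correcting homotopy.\<close>

definition cone_fibre_map :: "('l \<Rightarrow> 'm) \<Rightarrow> 'y \<Rightarrow> ('y + real \<times> 'l) option \<Rightarrow> ('y + real \<times> 'm) option" where
  "cone_fibre_map p c = cone_map base_pt (\<lambda>z. cone_pt (\<lambda>_. c) (fst z, p (snd z))) None"

lemma continuous_map_cone_fibre_map:
  assumes "continuous_map L M p"
  shows "continuous_map (mapping_cone L Y (\<lambda>_. c)) (mapping_cone M Y (\<lambda>_. c)) (cone_fibre_map p c)"
  unfolding cone_fibre_map_def
proof (rule continuous_map_cone_map)
  have "continuous_map (prod_topology unit_interval L) (prod_topology unit_interval M) (\<lambda>z. (fst z, p (snd z)))"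
    using continuous_map_fst[of unit_interval L] continuous_map_compose[OF continuous_map_snd[of unit_interval L] assms]
    by (auto simp: continuous_map_pairwise o_def)
  from continuous_map_compose[OF this continuous_map_cone_pt]
  show "continuous_map (prod_topology unit_interval L) (mapping_cone M Y (\<lambda>_. c))
      (\<lambda>z. cone_pt (\<lambda>_. c) (fst z, p (snd z)))" by (simp add: o_def)
qed (auto simp: continuous_map_base_pt topspace_mapping_cone)

lemma cone_fibre_map_homotopic_id:
  assumes "homotopic L L (q \<circ> p) id"
  shows "homotopic (mapping_cone L Y (\<lambda>_. c)) (mapping_cone L Y (\<lambda>_. c)) (cone_fibre_map q c \<circ> cone_fibre_map p c) id"
proof -
  obtain H where H: "continuous_map (prod_topology unit_interval L) L H" "\<And>y. H (0, y) = q (p y)" "\<And>y. H (1, y) = y"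
    using assms unfolding homotopic_with_def by auto
  let ?C = "mapping_cone L Y (\<lambda>_. c)"
  let ?B = "\<lambda>z. cone_pt (\<lambda>_. c) (fst (snd z), H (fst z, snd (snd z)))"
  let ?P = "prod_topology unit_interval (prod_topology unit_interval L)"
  have s: "continuous_map ?P unit_interval fst" and t: "continuous_map ?P unit_interval (fst \<circ> snd)"
    and l: "continuous_map ?P L (snd \<circ> snd)"
    using continuous_map_fst[of unit_interval "prod_topology unit_interval L"]
      continuous_map_compose[OF continuous_map_snd[of unit_interval "prod_topology unit_interval L"] continuous_map_fst]
      continuous_map_compose[OF continuous_map_snd[of unit_interval "prod_topology unit_interval L"] continuous_map_snd]
    by auto
  have "homotopic ?C ?C (cone_map (\<lambda>y. base_pt (snd (0 :: real, y))) (\<lambda>z. ?B (0, z)) None)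
      (cone_map (\<lambda>y. base_pt (snd (1 :: real, y))) (\<lambda>z. ?B (1, z)) None)"
  proof (rule homotopic_cone_map[where A="\<lambda>z. base_pt (snd z)" and e="\<lambda>_. None" and B="?B"])
    show "continuous_map (prod_topology unit_interval Y) ?C (\<lambda>z. base_pt (snd z))"
      using continuous_map_compose[OF continuous_map_snd continuous_map_base_pt] by (simp add: o_def)
    have "continuous_map ?P (prod_topology unit_interval L) (\<lambda>z. (fst (snd z), H (fst z, snd (snd z))))"
      using s t l continuous_map_compose[OF _ H(1), of ?P "\<lambda>z. (fst z, snd (snd z))"]
      by (auto simp: continuous_map_pairwise o_def)
    from continuous_map_compose[OF this continuous_map_cone_pt]
    show "continuous_map ?P ?C ?B" by (simp add: o_def)
  qed (auto simp: topspace_mapping_cone)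
  then show ?thesis
  proof (rule homotopic_from_mapping_cone_eq)
    fix t :: real and l assume t: "0 \<le> t" "t \<le> 1"
    show "(cone_fibre_map q c \<circ> cone_fibre_map p c) (cone_pt (\<lambda>_. c) (t, l)) =
        cone_map (\<lambda>y. base_pt (snd (0 :: real, y))) (\<lambda>z. ?B (0, z)) None (cone_pt (\<lambda>_. c) (t, l))"
      unfolding cone_fibre_map_def o_def using t H by (simp add: cone_map_cone)
    show "id (cone_pt (\<lambda>_. c) (t, l)) = cone_map (\<lambda>y. base_pt (snd (1 :: real, y))) (\<lambda>z. ?B (1, z)) None (cone_pt (\<lambda>_. c) (t, l))"
      using t H by (simp add: cone_map_cone)
  qed (auto simp: cone_fibre_map_def)
qed

lemma mapping_cone_const:
  assumes "L homotopy_equivalent_space M"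
  shows "mapping_cone L Y (\<lambda>_. c) homotopy_equivalent_space mapping_cone M Y (\<lambda>_. c)"
proof -
  obtain p q where "continuous_map L M p" "continuous_map M L q"
    "homotopic L L (q \<circ> p) id" "homotopic M M (p \<circ> q) id"
    using assms unfolding homotopy_equivalent_space_def by blast
  then show ?thesis
    unfolding homotopy_equivalent_space_def
    by (intro exI[of _ "cone_fibre_map p c"] exI[of _ "cone_fibre_map q c"] conjI
        continuous_map_cone_fibre_map cone_fibre_map_homotopic_id)
qed

lemma homotopic_constants:
  assumes "path_component_of Y c d"
  shows "homotopic L Y (\<lambda>_. c) (\<lambda>_. d)"
proof -
  obtain g where g: "pathin Y g" "g 0 = c" "g 1 = d"
    using assms unfolding path_component_of_def by blast
  have "continuous_map (prod_topology unit_interval L) Y (g \<circ> fst)"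
    using g(1) unfolding pathin_def by (intro continuous_map_compose[OF continuous_map_fst])
  then show ?thesis
    unfolding homotopic_with_def using g by (intro exI[of _ "g \<circ> fst"]) auto
qed

text \<open>The homotopy type of the cone depends only on those of \<open>L\<close> and
  \<open>Y\<close>. The constant \<open>c\<close> is first moved along a path in \<open>Y\<close> to
  \<open>v z\<close>, the image of the prescribed point under an equivalence; only then can base and
  fibre be replaced.\<close>

proposition mapping_cone_nullhomotopic:
  assumes f: "homotopic L Y f (\<lambda>_. c)" and c: "c \<in> topspace Y" and Y: "path_connected_space Y"
    and YZ: "Y homotopy_equivalent_space Z" and LM: "L homotopy_equivalent_space M" and z: "z \<in> topspace Z"
  shows "mapping_cone L Y f homotopy_equivalent_space mapping_cone M Z (\<lambda>_. z)"
proof -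
  obtain u v where uv: "continuous_map Y Z u" "continuous_map Z Y v"
    "homotopic Y Y (v \<circ> u) id" "homotopic Z Z (u \<circ> v) id"
    using YZ unfolding homotopy_equivalent_space_def by blast
  have vz: "v z \<in> topspace Y" using uv(2) z by (auto simp: continuous_map_def)
  have "mapping_cone L Y f homotopy_equivalent_space mapping_cone L Y (\<lambda>_. c)"
    by (rule mapping_cone_homotopic[OF f])
  also have "\<dots> homotopy_equivalent_space mapping_cone L Y (\<lambda>_. v z)"
    using Y c vz by (intro mapping_cone_homotopic homotopic_constants)
      (simp add: path_connected_space_iff_path_component)
  also have "\<dots> homotopy_equivalent_space mapping_cone L Z (\<lambda>_. z)"
    unfolding homotopy_equivalent_space_sym[of "mapping_cone L Y _"]
    using mapping_cone_base_homotopy_equivalence[OF uv(2,1,4,3), of L "\<lambda>_. z"] z by (simp add: o_def)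
  also have "\<dots> homotopy_equivalent_space mapping_cone M Z (\<lambda>_. z)"
    by (rule mapping_cone_const[OF LM])
  finally show ?thesis .
qed

text \<open>Each generator of the cone joins its points to the base. Nonemptiness of
  \<open>L\<close> provides a generator that reaches the apex.\<close>

lemma path_connected_mapping_cone:
  assumes f: "continuous_map L Y f" and Y: "path_connected_space Y" and L: "topspace L \<noteq> {}"
  shows "path_connected_space (mapping_cone L Y f)"
proof -
  let ?C = "mapping_cone L Y f"
  obtain l0 where l0: "l0 \<in> topspace L" using L by blast
  have fl: "f l \<in> topspace Y" if "l \<in> topspace L" for l
    by (rule subsetD[OF continuous_map_image_subset_topspace[OF f] imageI[OF that]])
  have base: "path_component_of ?C (base_pt y) (base_pt y')" if yy: "y \<in> topspace Y" "y' \<in> topspace Y" for y y'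
  proof -
    obtain g where g: "pathin Y g" "g 0 = y" "g 1 = y'"
      using Y yy unfolding path_connected_space_def by blast
    have "pathin ?C (base_pt \<circ> g)"
      using g(1) continuous_map_base_pt unfolding pathin_def by (rule continuous_map_compose)
    then show ?thesis
      unfolding path_component_of_def using g(2,3) by (intro exI[of _ "base_pt \<circ> g"]) simp
  qed
  have cone: "path_component_of ?C (base_pt (f l)) (cone_pt f (t, l))" if "0 \<le> t" "t \<le> 1" "l \<in> topspace L" for t l
  proof -
    have "continuous_map unit_interval (prod_topology unit_interval L) (\<lambda>s. (s * t, l))"
      unfolding continuous_map_pairwise o_def fst_conv snd_conv
      using that by (auto simp: continuous_map_in_subtopology mult_le_one intro: continuous_on_mult_right continuous_on_id)
    from continuous_map_compose[OF this continuous_map_cone_pt]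
    have "pathin ?C (\<lambda>s. cone_pt f (s * t, l))" unfolding pathin_def by (simp add: o_def)
    then show ?thesis unfolding path_component_of_def by (intro exI[of _ "\<lambda>s. cone_pt f (s * t, l)"]) auto
  qed
  have "path_component_of ?C (base_pt (f l0)) x" if "x \<in> topspace ?C" for x
    using that unfolding topspace_mapping_cone
  proof (elim insertE UnE imageE)
    assume "x = None" then show ?thesis using cone[of 1 l0] l0 by simp
  next
    fix y assume "x = base_pt y" "y \<in> topspace Y" then show ?thesis using base fl[OF l0] by blast
  next
    fix z assume z: "x = cone_pt f z" "z \<in> {0..1} \<times> topspace L"
    then have "path_component_of ?C (base_pt (f (snd z))) x" using cone[of "fst z" "snd z"] by auto
    moreover have "path_component_of ?C (base_pt (f l0)) (base_pt (f (snd z)))" using z base fl l0 by auto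
    ultimately show ?thesis by (rule path_component_of_trans[rotated])
  qed
  then have "path_component_of ?C x y" if "x \<in> topspace ?C" "y \<in> topspace ?C" for x y
    using that path_component_of_trans[OF path_component_of_sym] by metis
  then show ?thesis
    unfolding path_connected_space_iff_path_component by blast
qed

section \<open>Wedges of spheres\<close>

abbreviation wedge_pt :: "nat \<times> (nat \<Rightarrow> real) \<Rightarrow> (nat \<times> (nat \<Rightarrow> real)) option" where
  "wedge_pt \<equiv> wedge_proj (\<lambda>_. sphere_basepoint)"

lemma wedge_pt_basepoint [simp]: "wedge_pt (k, sphere_basepoint) = None"
  by (simp add: wedge_proj_def)

lemma topspace_wedge_of_spheres:
  "topspace (wedge_of_spheres ds) =
     insert None {wedge_pt (k, x) | k x. k < length ds \<and> x \<in> topspace (nsphere (ds ! k))}"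
  unfolding wedge_of_spheres_def topspace_wedge by (fastforce simp: image_iff)

lemma openin_wedge_of_spheres:
  "openin (wedge_of_spheres ds) U \<longleftrightarrow> U \<subseteq> topspace (wedge_of_spheres ds) \<and>
     (\<forall>k<length ds. openin (nsphere (ds ! k)) {x \<in> topspace (nsphere (ds ! k)). wedge_pt (k, x) \<in> U})"
proof -
  have "{x. (k, x) \<in> {z \<in> Sigma {..<length ds} (topspace \<circ> (\<lambda>k. nsphere (ds ! k))). wedge_pt z \<in> U}}
     = {x \<in> topspace (nsphere (ds ! k)). wedge_pt (k, x) \<in> U}" if "k < length ds" for k
    using that by auto
  then show ?thesis
    unfolding wedge_of_spheres_def openin_wedge topspace_wedge openin_sum_topology by auto
qed

lemma continuous_map_wedge_pt:
  assumes "k < length ds"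
  shows "continuous_map (nsphere (ds ! k)) (wedge_of_spheres ds) (\<lambda>x. wedge_pt (k, x))"
  using assms unfolding continuous_map_def topspace_wedge_of_spheres openin_wedge_of_spheres by auto

lemma continuous_map_from_wedge_of_spheres:
  assumes "\<And>k. k < length ds \<Longrightarrow> continuous_map (nsphere (ds ! k)) Z (\<lambda>x. h (wedge_pt (k, x)))"
    and "h None \<in> topspace Z"
  shows "continuous_map (wedge_of_spheres ds) Z h"
  unfolding continuous_map_def
proof (intro conjI allI impI)
  show "h \<in> topspace (wedge_of_spheres ds) \<rightarrow> topspace Z"
    using assms unfolding continuous_map_def topspace_wedge_of_spheres by auto
  fix W assume W: "openin Z W"
  have "{x \<in> topspace (nsphere (ds ! k)). wedge_pt (k, x) \<in> {x \<in> topspace (wedge_of_spheres ds). h x \<in> W}}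
     = {x \<in> topspace (nsphere (ds ! k)). h (wedge_pt (k, x)) \<in> W}" if "k < length ds" for k
    using that unfolding topspace_wedge_of_spheres by auto
  then show "openin (wedge_of_spheres ds) {x \<in> topspace (wedge_of_spheres ds). h x \<in> W}"
    unfolding openin_wedge_of_spheres using openin_continuous_map_preimage[OF assms(1) W] by auto
qed

lemma continuous_map_prod_wedge_of_spheres:
  assumes T: "compact_space T" "Hausdorff_space T"
    and h: "\<And>k. k < length ds \<Longrightarrow>
      continuous_map (prod_topology T (nsphere (ds ! k))) Z (\<lambda>z. h (fst z, wedge_pt (k, snd z)))"
    and h0: "continuous_map T Z (\<lambda>s. h (s, None))"
  shows "continuous_map (prod_topology T (wedge_of_spheres ds)) Z h"
proof (rule continuous_map_prod_final[OF T])
  fix J W assume J: "compactin T J" and W: "openin Z W"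
  let ?U = "{x \<in> topspace (wedge_of_spheres ds). \<forall>s\<in>J. h (s, x) \<in> W}"
  have "{x \<in> topspace (nsphere (ds ! k)). wedge_pt (k, x) \<in> ?U}
     = {x \<in> topspace (nsphere (ds ! k)). \<forall>s\<in>J. h (s, wedge_pt (k, x)) \<in> W}" if "k < length ds" for k
    using that unfolding topspace_wedge_of_spheres by auto
  moreover have "openin (nsphere (ds ! k)) {x \<in> topspace (nsphere (ds ! k)). \<forall>s\<in>J. h (s, wedge_pt (k, x)) \<in> W}"
    if "k < length ds" for k
    using openin_tube[OF h[OF that] W J] by simp
  ultimately show "openin (wedge_of_spheres ds) ?U"
    unfolding openin_wedge_of_spheres by auto
next
  have "continuous_map T Z (\<lambda>s. h (s, wedge_pt (k, x)))" if "k < length ds" "x \<in> topspace (nsphere (ds ! k))" for k x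
    using continuous_map_compose[OF _ h[OF that(1)], of T "\<lambda>s. (s, x)"] that(2)
    by (simp add: o_def continuous_map_pairwise)
  then show "continuous_map T Z (\<lambda>s. h (s, x))" if "x \<in> topspace (wedge_of_spheres ds)" for x
    using that h0 unfolding topspace_wedge_of_spheres by auto
qed

section \<open>Spheres as suspensions\<close>

lemma in_topspace_nsphere_iff:
  "x \<in> topspace (nsphere d) \<longleftrightarrow> (\<Sum>i\<le>d. (x i)\<^sup>2) = 1 \<and> (\<forall>i>d. x i = 0)"
  by (auto simp: nsphere)

lemma continuous_map_into_nsphere:
  "continuous_map X (nsphere d) f \<longleftrightarrow>
     (\<forall>i. continuous_map X euclideanreal (\<lambda>x. f x i)) \<and> f ` topspace X \<subseteq> topspace (nsphere d)"
  unfolding nsphere continuous_map_in_subtopology continuous_map_componentwise_UNIV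
  by (auto simp: Pi_iff)

lemma Hausdorff_nsphere: "Hausdorff_space (nsphere d)"
  unfolding nsphere by (intro Hausdorff_space_subtopology) (simp add: Hausdorff_space_product_topology)

lemma abs_nsphere_le_1:
  assumes "x \<in> topspace (nsphere d)"
  shows "\<bar>x i\<bar> \<le> 1"
proof (cases "i \<le> d")
  case True
  have "(x i)\<^sup>2 \<le> (\<Sum>i\<le>d. (x i)\<^sup>2)"
    by (rule member_le_sum) (use True in auto)
  then have "(x i)\<^sup>2 \<le> 1" using assms by (simp add: in_topspace_nsphere_iff)
  then show ?thesis by (simp add: abs_square_le_1)
qed (use assms in \<open>auto simp: in_topspace_nsphere_iff\<close>)

lemma compact_nsphere: "compact_space (nsphere d)"
proof -
  let ?P = "powertop_real (UNIV :: nat set)" and ?K = "PiE UNIV (\<lambda>_ :: nat. {-1..1 :: real})"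
  have K: "compactin ?P ?K" by (simp add: compactin_PiE)
  have p: "continuous_map ?P euclideanreal (\<lambda>x. x i)" for i :: nat
    by (rule continuous_map_product_projection) simp
  have "closedin ?P {x \<in> topspace ?P. (\<Sum>i\<le>d. (x i)\<^sup>2) \<in> {1}}"
    by (rule closedin_continuous_map_preimage[where Y=euclideanreal]) (auto intro!: continuous_intros p)
  moreover have "closedin ?P {x \<in> topspace ?P. x i \<in> {0}}" for i
    by (rule closedin_continuous_map_preimage[where f="\<lambda>x. x i" and Y=euclideanreal]) (auto intro: p)
  ultimately have "closedin ?P ({x \<in> topspace ?P. (\<Sum>i\<le>d. (x i)\<^sup>2) \<in> {1}} \<inter>
      (\<Inter>i\<in>{d<..}. {x \<in> topspace ?P. x i \<in> {0}}))"
    by (intro closedin_Int closedin_INT) auto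
  also have "{x \<in> topspace ?P. (\<Sum>i\<le>d. (x i)\<^sup>2) \<in> {1}} \<inter>
      (\<Inter>i\<in>{d<..}. {x \<in> topspace ?P. x i \<in> {0}}) = topspace (nsphere d)"
    by (auto simp: nsphere)
  finally have "compactin ?P (topspace (nsphere d))"
    using abs_nsphere_le_1[of _ d] by (intro closed_compactin[OF K]) (auto simp: abs_le_iff PiE_iff)
  then show ?thesis
    unfolding compact_space_def by (simp add: nsphere compactin_subtopology)
qed

text \<open>\<open>pi * t\<close> is the polar angle measured from the axis of coordinate 0, and the
  suspended sphere occupies the coordinates shifted by one. The parameter 0, where a cone is glued
  to its base, lands in \<open>sphere_basepoint\<close>.\<close>

definition suspension_pt :: "real \<times> (nat \<Rightarrow> real) \<Rightarrow> nat \<Rightarrow> real" where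
  "suspension_pt z i = (case i of 0 \<Rightarrow> cos (pi * fst z) | Suc j \<Rightarrow> sin (pi * fst z) * snd z j)"

lemma suspension_pt_in_nsphere:
  assumes "x \<in> topspace (nsphere d)"
  shows "suspension_pt (t, x) \<in> topspace (nsphere (Suc d))"
proof -
  have "(\<Sum>i\<le>Suc d. (suspension_pt (t, x) i)\<^sup>2) = (cos (pi * t))\<^sup>2 + (\<Sum>j\<le>d. (sin (pi * t) * x j)\<^sup>2)"
    by (subst sum.atMost_Suc_shift) (simp add: suspension_pt_def)
  also have "(\<Sum>j\<le>d. (sin (pi * t) * x j)\<^sup>2) = (sin (pi * t))\<^sup>2 * (\<Sum>j\<le>d. (x j)\<^sup>2)"
    by (simp add: power_mult_distrib sum_distrib_left)
  finally show ?thesis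
    using assms by (auto simp: in_topspace_nsphere_iff suspension_pt_def split: nat.split)
qed

lemma continuous_map_suspension_pt:
  "continuous_map (prod_topology unit_interval (nsphere d)) (nsphere (Suc d)) suspension_pt"
  unfolding continuous_map_into_nsphere
proof (intro conjI allI)
  let ?P = "prod_topology unit_interval (nsphere d)"
  have t: "continuous_map ?P euclideanreal fst"
    using continuous_map_fst[of unit_interval "nsphere d"] by (simp add: continuous_map_in_subtopology)
  have x: "continuous_map ?P euclideanreal (\<lambda>z. snd z j)" for j
    using continuous_map_compose[OF continuous_map_snd continuous_map_nsphere_projection[of d j]] by (simp add: o_def)
  have c: "continuous_map ?P euclideanreal (\<lambda>z. cos (pi * fst z))"
    using continuous_map_compose[of ?P euclideanreal "\<lambda>z. pi * fst z" euclideanreal cos]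
    by (simp add: o_def continuous_map_iff_continuous2 t continuous_map_real_mult_left continuous_on_cos)
  have s: "continuous_map ?P euclideanreal (\<lambda>z. sin (pi * fst z))"
    using continuous_map_compose[of ?P euclideanreal "\<lambda>z. pi * fst z" euclideanreal sin]
    by (simp add: o_def continuous_map_iff_continuous2 t continuous_map_real_mult_left continuous_on_sin)
  show "continuous_map ?P euclideanreal (\<lambda>z. suspension_pt z i)" for i
    by (cases i) (auto simp: suspension_pt_def intro!: c s x continuous_intros)
  show "suspension_pt ` topspace ?P \<subseteq> topspace (nsphere (Suc d))"
    using suspension_pt_in_nsphere by auto
qed

lemma suspension_pt_surj:
  assumes y: "y \<in> topspace (nsphere (Suc d))"
  obtains t x where "0 \<le> t" "t \<le> 1" "x \<in> topspace (nsphere d)" "y = suspension_pt (t, x)"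
proof -
  have y0: "-1 \<le> y 0" "y 0 \<le> 1" using abs_nsphere_le_1[OF y, of 0] by auto
  define t where "t = arccos (y 0) / pi"
  have t: "0 \<le> t" "t \<le> 1" and c: "cos (pi * t) = y 0"
    using y0 arccos_lbound arccos_ubound by (auto simp: t_def cos_arccos)
  have sum: "(y 0)\<^sup>2 + (\<Sum>j\<le>d. (y (Suc j))\<^sup>2) = 1"
    using y unfolding in_topspace_nsphere_iff by (subst (asm) sum.atMost_Suc_shift) simp
  have s: "(sin (pi * t))\<^sup>2 = (\<Sum>j\<le>d. (y (Suc j))\<^sup>2)"
    using sin_cos_squared_add[of "pi * t"] sum unfolding c by simp
  show thesis
  \<comment> \<open>At the two poles the direction is arbitrary, and the base point is taken;
    elsewhere it is found by normalizing the remaining coordinates.\<close>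
  proof (cases "sin (pi * t) = 0")
    case True
    then have 0: "y (Suc j) = 0" for j
      using s y by (cases "j \<le> d") (auto simp: sum_nonneg_eq_0_iff in_topspace_nsphere_iff)
    have "y = suspension_pt (t, sphere_basepoint)"
      using True c 0 by (auto simp: suspension_pt_def fun_eq_iff split: nat.split)
    then show thesis using that[OF t sphere_basepoint_in_nsphere] by simp
  next
    case False
    let ?x = "\<lambda>j. y (Suc j) / sin (pi * t)"
    have "(\<Sum>j\<le>d. (?x j)\<^sup>2) = 1"
      using False s[symmetric] by (simp add: power_divide flip: sum_divide_distrib)
    then have "?x \<in> topspace (nsphere d)"
      using y by (auto simp: in_topspace_nsphere_iff)
    moreover have "y = suspension_pt (t, ?x)"
      using False c by (simp add: suspension_pt_def fun_eq_iff split: nat.split)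
    ultimately show thesis using that[OF t] by metis
  qed
qed

lemma suspension_pt_eqD:
  assumes "suspension_pt (t, x) = suspension_pt (t', x')" "0 \<le> t" "t \<le> 1" "0 \<le> t'" "t' \<le> 1"
  shows "t = t'" "t = 0 \<or> t = 1 \<or> x = x'"
proof -
  have c: "cos (pi * t) = cos (pi * t')"
    using fun_cong[OF assms(1), of 0] by (simp add: suspension_pt_def)
  have "pi * t = pi * t'"
    by (rule cos_inj_pi) (use assms(2-5) c in \<open>simp_all add: mult_left_le\<close>)
  then show tt: "t = t'" by simp
  show "t = 0 \<or> t = 1 \<or> x = x'"
  proof (rule ccontr)
    assume *: "\<not> ?thesis"
    then have "sin (pi * t) \<noteq> 0"
      using assms(2,3) sin_gt_zero[of "pi * t"] by (simp add: less_le)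
    then have "x j = x' j" for j
      using fun_cong[OF assms(1), of "Suc j"] tt by (simp add: suspension_pt_def)
    with * show False by auto
  qed
qed

lemma suspension_pt_0 [simp]: "suspension_pt (0, x) = sphere_basepoint"
  by (auto simp: suspension_pt_def sphere_basepoint_def fun_eq_iff split: nat.split)

lemma suspension_pt_1: "suspension_pt (1, x) = suspension_pt (1, x')"
  by (auto simp: suspension_pt_def fun_eq_iff split: nat.split)

lemma quotient_map_suspension_pt:
  "quotient_map (prod_topology unit_interval (nsphere d)) (nsphere (Suc d)) suspension_pt"
proof (rule continuous_imp_quotient_map[OF continuous_map_suspension_pt])
  show "compact_space (prod_topology unit_interval (nsphere d))"
    by (simp add: compact_space_prod_topology compact_nsphere compact_unit_interval)
  show "suspension_pt ` topspace (prod_topology unit_interval (nsphere d)) = topspace (nsphere (Suc d))"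
    using suspension_pt_in_nsphere by (auto elim!: suspension_pt_surj intro!: image_eqI)
qed (rule Hausdorff_nsphere)

text \<open>
  Rotation of the plane of the first two coordinates by \<open>(s - 1) arccos (y 0)\<close>. It is the identity
  for \<open>s = 1\<close>, and for \<open>s = 0\<close> it contracts the meridian through the base point of the
  suspended sphere to the base point.
\<close>

definition meridian_rotation :: "real \<times> (nat \<Rightarrow> real) \<Rightarrow> nat \<Rightarrow> real" where
  "meridian_rotation z i = (let y = snd z; a = (1 - fst z) * arccos (y 0) in
     if i = 0 then cos a * y 0 + sin a * y 1
     else if i = 1 then cos a * y 1 - sin a * y 0 else y i)"

lemma meridian_rotation_1 [simp]: "meridian_rotation (1, y) = y"
  by (auto simp: meridian_rotation_def fun_eq_iff Let_def)

lemma meridian_rotation_basepoint [simp]: "meridian_rotation (s, sphere_basepoint) = sphere_basepoint"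
  by (auto simp: meridian_rotation_def sphere_basepoint_def fun_eq_iff Let_def)

text \<open>A point of the meridian has polar angle \<open>pi * t\<close>, which
  \<open>arccos\<close> recovers from coordinate 0 for \<open>t\<close> between 0 and 1. The
  rotation subtracts \<open>(1 - s) * (pi * t)\<close> from it and leaves
  \<open>pi * (s * t)\<close>.\<close>

lemma meridian_rotation_suspension:
  assumes "0 \<le> t" "t \<le> 1"
  shows "meridian_rotation (s, suspension_pt (t, sphere_basepoint)) = suspension_pt (s * t, sphere_basepoint)"
proof -
  have a: "arccos (cos (pi * t)) = pi * t"
    using assms by (intro arccos_cos) auto
  have 1: "cos ((1 - s) * (pi * t)) * cos (pi * t) + sin ((1 - s) * (pi * t)) * sin (pi * t) = cos (pi * (s * t))"
    using cos_diff[of "(1 - s) * (pi * t)" "pi * t"] cos_minus[of "pi * (s * t)"] by (simp add: algebra_simps)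
  have 2: "cos ((1 - s) * (pi * t)) * sin (pi * t) - sin ((1 - s) * (pi * t)) * cos (pi * t) = sin (pi * (s * t))"
    using sin_diff[of "pi * t" "(1 - s) * (pi * t)"] by (simp add: algebra_simps)
  show ?thesis
  proof
    fix i
    show "meridian_rotation (s, suspension_pt (t, sphere_basepoint)) i = suspension_pt (s * t, sphere_basepoint) i"
      using a 1 2 by (cases "i = 0"; cases "i = 1")
        (auto simp: meridian_rotation_def suspension_pt_def sphere_basepoint_def Let_def split: nat.split)
  qed
qed

lemma meridian_rotation_in_nsphere:
  assumes "y \<in> topspace (nsphere (Suc d))"
  shows "meridian_rotation (s, y) \<in> topspace (nsphere (Suc d))"
proof -
  define a where "a = (1 - s) * arccos (y 0)"
  have split: "(\<Sum>i\<le>Suc d. f i) = f 0 + f 1 + (\<Sum>i\<in>{..Suc d} - {0, 1}. f i)" for f :: "nat \<Rightarrow> real"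
    by (subst sum.subset_diff[of "{0, 1}" "{..Suc d}"]) auto
  have "(cos a * y 0 + sin a * y 1)\<^sup>2 + (cos a * y 1 - sin a * y 0)\<^sup>2
      = ((sin a)\<^sup>2 + (cos a)\<^sup>2) * ((y 0)\<^sup>2 + (y 1)\<^sup>2)"
    by algebra
  then have "(\<Sum>i\<le>Suc d. (meridian_rotation (s, y) i)\<^sup>2) = (\<Sum>i\<le>Suc d. (y i)\<^sup>2)"
    unfolding split by (simp add: meridian_rotation_def Let_def a_def)
  then show ?thesis
    using assms by (auto simp: in_topspace_nsphere_iff meridian_rotation_def Let_def)
qed

lemma continuous_map_meridian_rotation:
  "continuous_map (prod_topology unit_interval (nsphere (Suc d))) (nsphere (Suc d)) meridian_rotation"
  unfolding continuous_map_into_nsphere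
proof (intro conjI allI)
  let ?P = "prod_topology unit_interval (nsphere (Suc d))"
  have t: "continuous_map ?P euclideanreal fst"
    using continuous_map_fst[of unit_interval "nsphere (Suc d)"] by (simp add: continuous_map_in_subtopology)
  have x: "continuous_map ?P euclideanreal (\<lambda>z. snd z j)" for j
    using continuous_map_compose[OF continuous_map_snd continuous_map_nsphere_projection[of "Suc d" j]] by (simp add: o_def)
  have "continuous_map ?P (top_of_set {-1..1}) (\<lambda>z. snd z 0)"
    using x[of 0] abs_nsphere_le_1[of _ "Suc d" 0] by (auto simp: continuous_map_in_subtopology abs_le_iff)
  moreover have "continuous_map (top_of_set {-1..1}) euclideanreal arccos"
    by (simp add: continuous_on_arccos')
  ultimately have "continuous_map ?P euclideanreal (arccos \<circ> (\<lambda>z. snd z 0))"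
    by (rule continuous_map_compose)
  then have ac: "continuous_map ?P euclideanreal (\<lambda>z. arccos (snd z 0))"
    by (simp add: o_def)
  have a: "continuous_map ?P euclideanreal (\<lambda>z. (1 - fst z) * arccos (snd z 0))"
    by (intro continuous_map_real_mult continuous_map_diff ac t) simp
  have c: "continuous_map ?P euclideanreal (\<lambda>z. cos ((1 - fst z) * arccos (snd z 0)))"
    using continuous_map_compose[OF a, of euclideanreal cos]
    by (simp add: o_def continuous_map_iff_continuous2 continuous_on_cos)
  have s: "continuous_map ?P euclideanreal (\<lambda>z. sin ((1 - fst z) * arccos (snd z 0)))"
    using continuous_map_compose[OF a, of euclideanreal sin]
    by (simp add: o_def continuous_map_iff_continuous2 continuous_on_sin)
  show "continuous_map ?P euclideanreal (\<lambda>z. meridian_rotation z i)" for i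
    using c s x by (cases "i = 0"; cases "i = 1") (auto simp: meridian_rotation_def Let_def intro!: continuous_intros)
  show "meridian_rotation ` topspace ?P \<subseteq> topspace (nsphere (Suc d))"
    using meridian_rotation_in_nsphere by auto
qed

section \<open>Cones over wedges of spheres\<close>

lemma homotopicI:
  assumes "continuous_map (prod_topology unit_interval X) Y h"
    and "\<And>x. x \<in> topspace X \<Longrightarrow> h (0, x) = f x" "\<And>x. x \<in> topspace X \<Longrightarrow> h (1, x) = g x"
  shows "homotopic X Y f g"
  using assms by (subst homotopic_with) auto

lemma lift_to_suspension:
  assumes h: "continuous_map (prod_topology unit_interval (nsphere d)) Z h"
    and h0: "\<And>x x'. h (0, x) = h (0, x')" and h1: "\<And>x x'. h (1, x) = h (1, x')"
  obtains g where "continuous_map (nsphere (Suc d)) Z g"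
    "\<And>t x. 0 \<le> t \<Longrightarrow> t \<le> 1 \<Longrightarrow> x \<in> topspace (nsphere d) \<Longrightarrow> g (suspension_pt (t, x)) = h (t, x)"
proof (rule quotient_map_lift_exists[OF quotient_map_suspension_pt[of d] h])
  fix z z' assume z: "z \<in> topspace (prod_topology unit_interval (nsphere d))"
    "z' \<in> topspace (prod_topology unit_interval (nsphere d))" "suspension_pt z = suspension_pt z'"
  obtain t x t' x' where zz: "z = (t, x)" "z' = (t', x')" by (cases z; cases z')
  show "h z = h z'"
    using suspension_pt_eqD[of t x t' x'] z h0[of x x'] h1[of x x'] unfolding zz by auto
qed (use that in auto)

text \<open>The cone is the wedge of \<open>ds\<close> with the unreduced suspension of the wedge of
  \<open>es\<close> attached at \<open>None\<close>. The suspended spheres share the arc over the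
  wedge point of \<open>es\<close>, which is a meridian of each of them, whereas in the target they
  share one point only. The equivalence collapses this arc by \<open>meridian_rotation\<close> at
  time 0, its inverse puts each sphere back unrotated, and both composites are undone by running the
  rotation to time 1.\<close>

proposition mapping_cone_wedge_of_spheres:
  "mapping_cone (wedge_of_spheres es) (wedge_of_spheres ds) (\<lambda>_. None)
     homotopy_equivalent_space wedge_of_spheres (ds @ map Suc es)"
proof -
  let ?n = "length ds" and ?m = "length es" and ?W = "wedge_of_spheres (ds @ map Suc es)"
  let ?M = "wedge_of_spheres es" and ?Z = "wedge_of_spheres ds"
  let ?C = "mapping_cone ?M ?Z (\<lambda>_. None)" and ?c = "cone_pt (\<lambda>_. None :: (nat \<times> (nat \<Rightarrow> real)) option)"
  have nth: "(ds @ map Suc es) ! k = ds ! k" if "k < ?n" for k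
    using that by (simp add: nth_append)
  have nth': "(ds @ map Suc es) ! k = Suc (es ! (k - ?n))" if "\<not> k < ?n" "k < length (ds @ map Suc es)" for k
    using that by (simp add: nth_append)
  have cW: "continuous_map (nsphere (Suc (es ! j))) ?W (\<lambda>x. wedge_pt (?n + j, x))" if "j < ?m" for j
    using continuous_map_wedge_pt[of "?n + j" "ds @ map Suc es"] that by (simp add: nth_append)
  have "\<exists>g. continuous_map (nsphere (Suc (es ! j))) ?C g \<and>
      (\<forall>t x. 0 \<le> t \<longrightarrow> t \<le> 1 \<longrightarrow> x \<in> topspace (nsphere (es ! j)) \<longrightarrow>
        g (suspension_pt (t, x)) = ?c (t, wedge_pt (j, x)))" if j: "j < ?m" for j
  proof -
    have "continuous_map (prod_topology unit_interval (nsphere (es ! j))) (prod_topology unit_interval ?M)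
        (\<lambda>z. (fst z, wedge_pt (j, snd z)))"
      using continuous_map_fst[of unit_interval "nsphere (es ! j)"]
        continuous_map_compose[OF continuous_map_snd[of unit_interval "nsphere (es ! j)"] continuous_map_wedge_pt[OF j]]
      by (simp add: continuous_map_pairwise o_def)
    from continuous_map_compose[OF this continuous_map_cone_pt]
    have h: "continuous_map (prod_topology unit_interval (nsphere (es ! j))) ?C (\<lambda>z. ?c (fst z, wedge_pt (j, snd z)))"
      by (simp add: o_def)
    show ?thesis by (rule lift_to_suspension[OF h]) auto
  qed
  \<comment> \<open>\<open>G j\<close> includes the \<open>j\<close>-th suspended sphere in the
    cone. It descends from the cylinder because the cone collapses both ends of the cylinder to
    points.\<close>
  then obtain G where G: "\<And>j. j < ?m \<Longrightarrow> continuous_map (nsphere (Suc (es ! j))) ?C (G j)"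
    and Gs: "\<And>j t x. j < ?m \<Longrightarrow> 0 \<le> t \<Longrightarrow> t \<le> 1 \<Longrightarrow> x \<in> topspace (nsphere (es ! j)) \<Longrightarrow>
        G j (suspension_pt (t, x)) = ?c (t, wedge_pt (j, x))"
    by metis
  have Gb: "G j sphere_basepoint = base_pt None" if "j < ?m" for j
    using Gs[OF that, of 0 sphere_basepoint] sphere_basepoint_in_nsphere by simp
  define g where "g z = (case z of None \<Rightarrow> base_pt None
      | Some (k, y) \<Rightarrow> if k < ?n then base_pt (Some (k, y)) else G (k - ?n) y)" for z
  have g1: "g (wedge_pt (k, y)) = base_pt (wedge_pt (k, y))" if "k < ?n" for k y
    using that by (simp add: g_def wedge_proj_def)
  have g2: "g (wedge_pt (k, y)) = G (k - ?n) y" if "\<not> k < ?n" "k < length (ds @ map Suc es)" for k y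
    using that Gb[of "k - ?n"] by (auto simp: g_def wedge_proj_def)
  have g: "continuous_map ?W ?C g"
  proof (rule continuous_map_from_wedge_of_spheres)
    fix k assume k: "k < length (ds @ map Suc es)"
    show "continuous_map (nsphere ((ds @ map Suc es) ! k)) ?C (\<lambda>x. g (wedge_pt (k, x)))"
    proof (cases "k < ?n")
      case True
      then show ?thesis
        using continuous_map_compose[OF continuous_map_wedge_pt[OF True] continuous_map_base_pt]
        by (simp add: g1 nth o_def)
    next
      case False
      moreover have "(\<lambda>x. g (wedge_pt (k, x))) = G (k - ?n)" using g2[OF False k] by auto
      ultimately show ?thesis using G[of "k - ?n"] k nth'[OF False k] by auto
    qed
  qed (simp add: g_def topspace_mapping_cone topspace_wedge_of_spheres)
  \<comment> \<open>The rotation at time 0 takes the whole shared meridian to the base point, so the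
    value at \<open>None\<close> agrees with the values of all the spheres.\<close>
  define B where "B z = (case snd z of None \<Rightarrow> None
      | Some (j, x) \<Rightarrow> wedge_pt (?n + j, meridian_rotation (0, suspension_pt (fst z, x))))"
    for z :: "real \<times> (nat \<times> (nat \<Rightarrow> real)) option"
  have Bw: "B (t, wedge_pt (j, x)) = wedge_pt (?n + j, meridian_rotation (0, suspension_pt (t, x)))"
    if "0 \<le> t" "t \<le> 1" for t j x
    using meridian_rotation_suspension[OF that, of 0] by (auto simp: B_def wedge_proj_def)
  have B0: "B (0, z) = None" for z by (auto simp: B_def split: option.split)
  have B1: "B (1, z) = None" for z
  proof -
    have "meridian_rotation (0, suspension_pt (1, x)) = sphere_basepoint" for x
      using meridian_rotation_suspension[of 1 0] suspension_pt_1[of x sphere_basepoint] by simp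
    then show ?thesis by (auto simp: B_def split: option.split)
  qed
  have B: "continuous_map (prod_topology unit_interval ?M) ?W B"
  proof (rule continuous_map_prod_wedge_of_spheres[OF compact_unit_interval Hausdorff_unit_interval])
    fix j assume j: "j < ?m"
    let ?P = "prod_topology unit_interval (nsphere (es ! j))"
    have "continuous_map ?P (prod_topology unit_interval (nsphere (Suc (es ! j)))) (\<lambda>z. (0, suspension_pt z))"
      by (simp add: continuous_map_pairwise o_def continuous_map_suspension_pt)
    from continuous_map_compose[OF continuous_map_compose[OF this continuous_map_meridian_rotation] cW[OF j]]
    show "continuous_map ?P ?W (\<lambda>z. B (fst z, wedge_pt (j, snd z)))"
      by (rule continuous_map_eq) (auto simp: Bw)
  qed (simp add: B_def topspace_wedge_of_spheres)
  define f where "f = cone_map (\<lambda>z. z) B None"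
  have f: "continuous_map ?C ?W f"
    unfolding f_def
  proof (rule continuous_map_cone_map[OF _ B])
    show "continuous_map ?Z ?W (\<lambda>z. z)"
    proof (rule continuous_map_from_wedge_of_spheres)
      show "continuous_map (nsphere (ds ! k)) ?W (\<lambda>x. wedge_pt (k, x))" if "k < ?n" for k
        using continuous_map_wedge_pt[of k "ds @ map Suc es"] that by (simp add: nth)
    qed (simp add: topspace_wedge_of_spheres)
  qed (auto simp: topspace_wedge_of_spheres B0 B1)
  have fc: "f (?c (t, z)) = B (t, z)" if "0 \<le> t" "t \<le> 1" for t z
    unfolding f_def using that by (intro cone_map_cone) (auto simp: B0 B1)
  have W_cases: "z = None \<or> (\<exists>k y. k < ?n \<and> z = wedge_pt (k, y)) \<or>
      (\<exists>j t x. j < ?m \<and> 0 \<le> t \<and> t \<le> 1 \<and> x \<in> topspace (nsphere (es ! j)) \<and> z = wedge_pt (?n + j, suspension_pt (t, x)))"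
    if zW: "z \<in> topspace ?W" for z
  proof (cases "z = None")
    case False
    then obtain k y where ky: "k < length (ds @ map Suc es)" "y \<in> topspace (nsphere ((ds @ map Suc es) ! k))" "z = wedge_pt (k, y)"
      using zW unfolding topspace_wedge_of_spheres by blast
    show ?thesis
    proof (cases "k < ?n")
      case False
      then obtain t x where "0 \<le> t" "t \<le> 1" "x \<in> topspace (nsphere (es ! (k - ?n)))" "y = suspension_pt (t, x)"
        using ky(2) suspension_pt_surj[of y "es ! (k - ?n)"] unfolding nth'[OF False ky(1)] by blast
      with ky False show ?thesis
        by (intro disjI2 exI[of _ "k - ?n"] exI[of _ t] exI[of _ x]) auto
    qed (use ky in blast)
  qed simp
  \<comment> \<open>On the new spheres \<open>f \<circ> g\<close> is the rotation at time 0, and on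
    the old ones it is the identity.\<close>
  define R where "R z = (case snd z of None \<Rightarrow> None
      | Some (k, y) \<Rightarrow> if k < ?n then Some (k, y) else wedge_pt (k, meridian_rotation (fst z, y)))"
    for z :: "real \<times> (nat \<times> (nat \<Rightarrow> real)) option"
  have Rw: "R (s, wedge_pt (k, y)) = (if k < ?n then wedge_pt (k, y) else wedge_pt (k, meridian_rotation (s, y)))" for s k y
    by (auto simp: R_def wedge_proj_def)
  have R: "continuous_map (prod_topology unit_interval ?W) ?W R"
  proof (rule continuous_map_prod_wedge_of_spheres[OF compact_unit_interval Hausdorff_unit_interval])
    fix k assume k: "k < length (ds @ map Suc es)"
    let ?S = "nsphere ((ds @ map Suc es) ! k)"
    note wk = continuous_map_wedge_pt[OF k]
    show "continuous_map (prod_topology unit_interval ?S) ?W (\<lambda>z. R (fst z, wedge_pt (k, snd z)))"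
    proof (cases "k < ?n")
      case True
      then show ?thesis
        using continuous_map_compose[OF continuous_map_snd wk] by (simp add: Rw o_def)
    next
      case False
      have "continuous_map (prod_topology unit_interval ?S) ?S meridian_rotation"
        unfolding nth'[OF False k] by (rule continuous_map_meridian_rotation)
      from continuous_map_compose[OF this wk] False show ?thesis by (simp add: Rw o_def)
    qed
  qed (simp add: R_def topspace_wedge_of_spheres)
  have fg: "homotopic ?W ?W (f \<circ> g) id"
  proof (rule homotopicI[OF R])
    fix z assume "z \<in> topspace ?W"
    then consider "z = None" | k y where "k < ?n" "z = wedge_pt (k, y)"
      | j t x where "j < ?m" "0 \<le> t" "t \<le> 1" "x \<in> topspace (nsphere (es ! j))" "z = wedge_pt (?n + j, suspension_pt (t, x))"
      using W_cases by blast
    then have "R (0, z) = (f \<circ> g) z \<and> R (1, z) = z"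
    proof cases
      case 1 then show ?thesis by (simp add: R_def g_def f_def)
    next
      case 2 then show ?thesis by (simp add: Rw g1 f_def)
    next
      case 3 then show ?thesis by (simp add: Rw g2 Gs fc Bw)
    qed
    then show "R (0, z) = (f \<circ> g) z" "R (1, z) = id z" by auto
  qed
  \<comment> \<open>The point at height \<open>t\<close> on the shared arc is moved to height
    \<open>s * t\<close>, as the rotation does on every sphere containing the arc. In particular the
    apex moves along the arc, from the base point at \<open>s = 0\<close> to its own place at
    \<open>s = 1\<close>.\<close>
  define Q where "Q z = (case snd (snd z) of None \<Rightarrow> ?c (fst z * fst (snd z), None)
      | Some (j, x) \<Rightarrow> G j (meridian_rotation (fst z, suspension_pt (fst (snd z), x))))"
    for z :: "real \<times> real \<times> (nat \<times> (nat \<Rightarrow> real)) option"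
  have Qw: "Q (s, t, wedge_pt (j, x)) = G j (meridian_rotation (s, suspension_pt (t, x)))"
    if "0 \<le> s" "s \<le> 1" "0 \<le> t" "t \<le> 1" "j < ?m" for s t j x
    using that Gs[OF that(5), of "s * t" sphere_basepoint] sphere_basepoint_in_nsphere
      meridian_rotation_suspension[OF that(3,4), of s]
    by (auto simp: Q_def wedge_proj_def mult_le_one)
  have M_cases: "z = None \<or> (\<exists>j x. j < ?m \<and> x \<in> topspace (nsphere (es ! j)) \<and> z = wedge_pt (j, x))"
    if "z \<in> topspace ?M" for z
    using that unfolding topspace_wedge_of_spheres by auto
  have Q0: "Q (s, 0, z) = base_pt None" if "z \<in> topspace ?M" "0 \<le> s" "s \<le> 1" for s z
    using M_cases[OF that(1)] that Gb by (auto simp: Qw) (simp add: Q_def)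
  have Q1: "Q (s, 1, z) = ?c (s, None)" if "z \<in> topspace ?M" "0 \<le> s" "s \<le> 1" for s z
    using M_cases[OF that(1)]
  proof (elim disjE exE conjE)
    fix j x assume j: "j < ?m" "x \<in> topspace (nsphere (es ! j))" "z = wedge_pt (j, x)"
    have "Q (s, 1, z) = G j (suspension_pt (s, sphere_basepoint))"
      using j that meridian_rotation_suspension[of 1 s] suspension_pt_1[of x sphere_basepoint] by (simp add: Qw)
    also have "\<dots> = ?c (s, None)"
      using Gs[OF j(1) that(2,3) sphere_basepoint_in_nsphere] by simp
    finally show ?thesis .
  qed (simp add: Q_def)
  have Q: "continuous_map (prod_topology unit_interval (prod_topology unit_interval ?M)) ?C Q"
  proof -
    \<comment> \<open>Both real parameters are gathered into one compact Hausdorff square, as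
      continuity on a product with a wedge is known for a single parameter space.\<close>
    let ?II = "prod_topology unit_interval unit_interval"
    let ?Q = "\<lambda>z. Q (fst (fst z), snd (fst z), snd z)"
    have "continuous_map (prod_topology ?II ?M) ?C ?Q"
    proof (rule continuous_map_prod_wedge_of_spheres)
      fix j assume j: "j < ?m"
      let ?P = "prod_topology ?II (nsphere (es ! j))"
      have s: "continuous_map ?P unit_interval (\<lambda>z. fst (fst z))" and t: "continuous_map ?P unit_interval (\<lambda>z. snd (fst z))"
        using continuous_map_compose[OF continuous_map_fst[of ?II "nsphere (es ! j)"] continuous_map_fst]
          continuous_map_compose[OF continuous_map_fst[of ?II "nsphere (es ! j)"] continuous_map_snd]
        by (auto simp: o_def)
      have "continuous_map ?P (prod_topology unit_interval (nsphere (es ! j))) (\<lambda>z. (snd (fst z), snd z))"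
        using t by (simp add: continuous_map_pairwise o_def continuous_map_snd)
      from continuous_map_compose[OF this continuous_map_suspension_pt] s
      have "continuous_map ?P (prod_topology unit_interval (nsphere (Suc (es ! j))))
          (\<lambda>z. (fst (fst z), suspension_pt (snd (fst z), snd z)))"
        by (simp add: continuous_map_pairwise o_def)
      from continuous_map_compose[OF continuous_map_compose[OF this continuous_map_meridian_rotation] G[OF j]]
      show "continuous_map ?P ?C (\<lambda>z. ?Q (fst z, wedge_pt (j, snd z)))"
        by (rule continuous_map_eq) (auto simp: Qw j)
    next
      have "continuous_map ?II euclideanreal (\<lambda>z. fst z * snd z)"
        using continuous_map_fst[of unit_interval unit_interval] continuous_map_snd[of unit_interval unit_interval]
        by (intro continuous_map_real_mult) (simp_all add: continuous_map_in_subtopology)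
      then have "continuous_map ?II (prod_topology unit_interval ?M) (\<lambda>z. (fst z * snd z, None))"
        by (auto simp: continuous_map_pairwise o_def continuous_map_in_subtopology mult_le_one topspace_wedge_of_spheres)
      from continuous_map_compose[OF this continuous_map_cone_pt]
      show "continuous_map ?II ?C (\<lambda>s. ?Q (s, None))" by (simp add: Q_def o_def)
    qed (auto simp: compact_space_subtopology compact_Times Hausdorff_space_subtopology)
    moreover have "continuous_map (prod_topology unit_interval (prod_topology unit_interval ?M)) (prod_topology ?II ?M)
        (\<lambda>z. ((fst z, fst (snd z)), snd (snd z)))"
      using continuous_map_fst[of unit_interval "prod_topology unit_interval ?M"]
        continuous_map_compose[OF continuous_map_snd[of unit_interval "prod_topology unit_interval ?M"] continuous_map_fst]
        continuous_map_compose[OF continuous_map_snd[of unit_interval "prod_topology unit_interval ?M"] continuous_map_snd]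
      by (simp only: continuous_map_pairwise o_def fst_conv snd_conv simp_thms)
    ultimately have "continuous_map (prod_topology unit_interval (prod_topology unit_interval ?M)) ?C
        (?Q \<circ> (\<lambda>z. ((fst z, fst (snd z)), snd (snd z))))"
      by (rule continuous_map_compose[rotated])
    then show ?thesis by (simp add: o_def)
  qed
  have "homotopic ?C ?C (cone_map (\<lambda>y. base_pt (snd (0 :: real, y))) (\<lambda>z. Q (0, z)) (?c (0, None)))
      (cone_map (\<lambda>y. base_pt (snd (1 :: real, y))) (\<lambda>z. Q (1, z)) (?c (1, None)))"
  proof (rule homotopic_cone_map[where A="\<lambda>z. base_pt (snd z)" and e="\<lambda>s. ?c (s, None)" and B=Q, OF _ Q])
    show "continuous_map (prod_topology unit_interval ?Z) ?C (\<lambda>z. base_pt (snd z))"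
      using continuous_map_compose[OF continuous_map_snd continuous_map_base_pt] by (simp add: o_def)
    have "continuous_map unit_interval (prod_topology unit_interval ?M) (\<lambda>s. (s, None))"
      by (simp add: continuous_map_pairwise o_def topspace_wedge_of_spheres continuous_map_id[unfolded id_def])
    from continuous_map_compose[OF this continuous_map_cone_pt]
    show "continuous_map unit_interval ?C (\<lambda>s. ?c (s, None))" by (simp add: o_def)
  qed (auto simp: Q0 Q1)
  then have gf: "homotopic ?C ?C (g \<circ> f) id"
  proof (rule homotopic_from_mapping_cone_eq)
    fix t :: real and z assume t: "0 \<le> t" "t \<le> 1" and z: "z \<in> topspace ?M"
    have "cone_map (\<lambda>y. base_pt (snd (0 :: real, y))) (\<lambda>z. Q (0, z)) (?c (0, None)) (?c (t, z)) = Q (0, t, z)"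
      using t z by (intro cone_map_cone) (auto simp: Q0 Q1)
    also have "\<dots> = g (B (t, z))"
      using M_cases[OF z]
    proof (elim disjE exE conjE)
      fix j x assume "j < ?m" "x \<in> topspace (nsphere (es ! j))" "z = wedge_pt (j, x)"
      then show ?thesis using t by (simp add: Qw Bw g2)
    qed (simp add: Q_def B_def g_def)
    finally show "(g \<circ> f) (?c (t, z)) = cone_map (\<lambda>y. base_pt (snd (0 :: real, y))) (\<lambda>z. Q (0, z)) (?c (0, None)) (?c (t, z))"
      using t by (simp add: fc)
    have "cone_map (\<lambda>y. base_pt (snd (1 :: real, y))) (\<lambda>z. Q (1, z)) (?c (1, None)) (?c (t, z)) = Q (1, t, z)"
      using t z by (intro cone_map_cone) (auto simp: Q0 Q1)
    also have "\<dots> = ?c (t, z)"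
      using M_cases[OF z]
    proof (elim disjE exE conjE)
      fix j x assume "j < ?m" "x \<in> topspace (nsphere (es ! j))" "z = wedge_pt (j, x)"
      then show ?thesis using t by (simp add: Qw Gs)
    qed (simp add: Q_def)
    finally show "id (?c (t, z)) = cone_map (\<lambda>y. base_pt (snd (1 :: real, y))) (\<lambda>z. Q (1, z)) (?c (1, None)) (?c (t, z))"
      by simp
  next
    fix y assume y: "y \<in> topspace ?Z"
    then have "y = None \<or> (\<exists>k x. k < ?n \<and> y = wedge_pt (k, x))"
      unfolding topspace_wedge_of_spheres by auto
    then have "g y = base_pt y" using g1 by (auto simp: g_def)
    then show "(g \<circ> f) (base_pt y) = cone_map (\<lambda>y. base_pt (snd (0 :: real, y))) (\<lambda>z. Q (0, z)) (?c (0, None)) (base_pt y)"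
      by (simp add: f_def)
  qed (auto simp: f_def g_def)
  show ?thesis
    unfolding homotopy_equivalent_space_def using f g fg gf by blast
qed

text \<open>The cone over the empty space is one isolated point, and adding it to a wedge amounts to
  wedging on a 0-sphere. Here the two spaces are even homeomorphic.\<close>

lemma mapping_cone_empty_wedge_of_spheres:
  fixes L :: "'l topology"
  assumes L: "topspace L = {}"
  shows "mapping_cone L (wedge_of_spheres ds) f homotopy_equivalent_space wedge_of_spheres (ds @ [0])"
proof -
  \<comment> \<open>\<open>?x\<close> is the point -1 of the 0-sphere, the one that is not the base
    point; it becomes the image of the apex.\<close>
  let ?n = "length ds" and ?W = "wedge_of_spheres (ds @ [0])" and ?Z = "wedge_of_spheres ds"
  let ?C = "mapping_cone L ?Z f" and ?x = "\<lambda>i :: nat. if i = 0 then -1 else 0 :: real"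
  have x: "?x \<in> topspace (nsphere 0)" by (auto simp: in_topspace_nsphere_iff)
  have S0: "y = ?x \<or> y = sphere_basepoint" if "y \<in> topspace (nsphere 0)" for y
    using that by (auto simp: in_topspace_nsphere_iff sphere_basepoint_def fun_eq_iff power2_eq_1_iff)
  have xb: "?x \<noteq> sphere_basepoint" by (auto simp: sphere_basepoint_def fun_eq_iff)
  define F where "F = cone_map (\<lambda>z. z) (\<lambda>_ :: real \<times> 'l. None) (wedge_pt (?n, ?x))"
  define g :: "(nat \<times> (nat \<Rightarrow> real)) option \<Rightarrow> ((nat \<times> (nat \<Rightarrow> real)) option + real \<times> 'l) option"
    where "g z = (case z of None \<Rightarrow> base_pt None
      | Some (k, y) \<Rightarrow> if k < ?n then base_pt (Some (k, y)) else if y 0 \<le> 0 then None else base_pt None)"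
    for z :: "(nat \<times> (nat \<Rightarrow> real)) option"
  have g1: "g (wedge_pt (k, y)) = base_pt (wedge_pt (k, y))" if "k < ?n" for k y
    using that by (simp add: g_def wedge_proj_def)
  have g2: "g (wedge_pt (?n, y)) = (if y 0 \<le> 0 then None else base_pt None)" for y
    by (auto simp: g_def wedge_proj_def sphere_basepoint_def)
  have "continuous_map ?C ?W F"
    unfolding F_def
  proof (rule continuous_map_cone_map)
    show "continuous_map ?Z ?W (\<lambda>z. z)"
    proof (rule continuous_map_from_wedge_of_spheres)
      show "continuous_map (nsphere (ds ! k)) ?W (\<lambda>x. wedge_pt (k, x))" if "k < ?n" for k
        using continuous_map_wedge_pt[of k "ds @ [0]"] that by (simp add: nth_append)
    qed (simp add: topspace_wedge_of_spheres)
    show "wedge_pt (?n, ?x) \<in> topspace ?W"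
      unfolding topspace_wedge_of_spheres using x by (intro insertI2 CollectI exI[of _ ?n] exI[of _ ?x]) simp
  qed (use L in \<open>auto simp: null_topspace_iff_trivial prod_topology_trivial_iff\<close>)
  moreover have "continuous_map ?W ?C g"
  proof (rule continuous_map_from_wedge_of_spheres)
    fix k assume k: "k < length (ds @ [0])"
    show "continuous_map (nsphere ((ds @ [0]) ! k)) ?C (\<lambda>x. g (wedge_pt (k, x)))"
    proof (cases "k < ?n")
      case True
      then show ?thesis
        using continuous_map_compose[OF continuous_map_wedge_pt[OF True] continuous_map_base_pt]
        by (simp add: g1 nth_append o_def)
    next
      case False
      with k have kn: "k = ?n" by simp
      \<comment> \<open>No point of the 0-sphere has coordinate 0 equal to 0, so the two constant
        pieces never have to agree.\<close>
      have "continuous_map (nsphere 0) ?C (\<lambda>y. if y 0 \<le> 0 then None else base_pt None)"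
        by (rule continuous_map_cases_le)
          (auto simp: continuous_map_nsphere_projection topspace_mapping_cone topspace_wedge_of_spheres in_topspace_nsphere_iff)
      then show ?thesis unfolding kn by (simp add: g2)
    qed
  qed (simp add: g_def topspace_mapping_cone topspace_wedge_of_spheres)
  moreover have "g (F z) = z" if "z \<in> topspace ?C" for z
  proof -
    have "z = None \<or> (\<exists>y. y \<in> topspace ?Z \<and> z = base_pt y)"
      using that L unfolding topspace_mapping_cone by auto
    then show ?thesis
      unfolding topspace_wedge_of_spheres
      by (auto simp: F_def g1 g2) (simp add: g_def)
  qed
  moreover have "F (g z) = z" if zW: "z \<in> topspace ?W" for z
  proof -
    have "z = None \<or> (\<exists>k y. k < ?n \<and> z = wedge_pt (k, y)) \<or> z = wedge_pt (?n, ?x) \<or> z = wedge_pt (?n, sphere_basepoint)"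
    proof (cases "z = None")
      case False
      then obtain k y where ky: "k < length (ds @ [0])" "y \<in> topspace (nsphere ((ds @ [0]) ! k))" "z = wedge_pt (k, y)"
        using zW unfolding topspace_wedge_of_spheres by blast
      show ?thesis
      proof (cases "k < ?n")
        case False
        with ky have "k = ?n" "y \<in> topspace (nsphere 0)" by (auto simp: nth_append)
        then show ?thesis using S0 ky by blast
      qed (use ky in blast)
    qed simp
    then show ?thesis
      using xb by (auto simp: g1 g2 F_def) (simp_all add: g_def)
  qed
  ultimately have "?C homeomorphic_space ?W"
    unfolding homeomorphic_space_def homeomorphic_maps_def by blast
  then show ?thesis by (rule homeomorphic_imp_homotopy_equivalent_space)
qed

section \<open>Realizations of independence complexes\<close>

text \<open>The relation is not restricted to \<open>V\<close>, so one relation serves all induced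
  subgraphs: deleting vertices or passing to links only changes \<open>V\<close>.\<close>

definition indep_space :: "('a \<Rightarrow> 'a \<Rightarrow> bool) \<Rightarrow> 'a set \<Rightarrow> ('a \<Rightarrow> real) topology" where
  "indep_space adj V = geometric_realization {S. S \<subseteq> V \<and> (\<forall>u\<in>S. \<forall>v\<in>S. \<not> adj u v)}"

lemma in_indep_space_iff:
  assumes "finite V"
  shows "x \<in> topspace (indep_space adj V) \<longleftrightarrow> (\<forall>v. 0 \<le> x v) \<and> (\<forall>v. v \<notin> V \<longrightarrow> x v = 0) \<and>
     (\<forall>u v. adj u v \<longrightarrow> x u = 0 \<or> x v = 0) \<and> (\<Sum>v\<in>V. x v) = 1"
proof (cases "\<forall>v. v \<notin> V \<longrightarrow> x v = 0")
  case True
  then have "(\<Sum>v | x v \<noteq> 0. x v) = (\<Sum>v\<in>V. x v)"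
    using assms by (intro sum.mono_neutral_left) auto
  moreover have "finite {v. x v \<noteq> 0}" "{v. x v \<noteq> 0} \<subseteq> V"
    using True by (auto intro!: finite_subset[OF _ assms])
  ultimately show ?thesis
    unfolding indep_space_def geometric_realization_def using True by auto
qed (auto simp: indep_space_def geometric_realization_def)

lemma continuous_map_indep_space_coordinate:
  "continuous_map (indep_space adj V) euclideanreal (\<lambda>x. x v)"
  unfolding indep_space_def geometric_realization_def
  by (rule continuous_map_from_subtopology) (rule continuous_map_product_projection, simp)

lemma continuous_map_into_indep_space:
  "continuous_map X (indep_space adj V) f \<longleftrightarrow>
     (\<forall>v. continuous_map X euclideanreal (\<lambda>x. f x v)) \<and> f ` topspace X \<subseteq> topspace (indep_space adj V)"
  unfolding indep_space_def geometric_realization_def continuous_map_in_subtopology continuous_map_componentwise_UNIV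
  by (auto simp: Pi_iff)

lemma Hausdorff_indep_space: "Hausdorff_space (indep_space adj V)"
  unfolding indep_space_def geometric_realization_def
  by (intro Hausdorff_space_subtopology) (simp add: Hausdorff_space_product_topology)

lemma indep_space_le_1:
  assumes "finite V" "x \<in> topspace (indep_space adj V)"
  shows "x v \<le> 1"
proof (cases "v \<in> V")
  case True
  have "x v \<le> (\<Sum>v\<in>V. x v)"
    by (rule member_le_sum) (use True assms in \<open>auto simp: in_indep_space_iff\<close>)
  then show ?thesis using assms by (simp add: in_indep_space_iff)
qed (use assms in \<open>auto simp: in_indep_space_iff\<close>)

lemma compact_indep_space:
  fixes V :: "'a set"
  assumes "finite V"
  shows "compact_space (indep_space adj V)"
proof -
  let ?P = "powertop_real (UNIV :: 'a set)" and ?K = "PiE UNIV (\<lambda>_ :: 'a. {0..1 :: real})"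
  have K: "compactin ?P ?K" by (simp add: compactin_PiE)
  have p: "continuous_map ?P euclideanreal (\<lambda>x. x v)" for v
    by (rule continuous_map_product_projection) simp
  have "closedin ?P {x \<in> topspace ?P. (\<Sum>v\<in>V. x v) \<in> {1}}"
    by (rule closedin_continuous_map_preimage[where Y=euclideanreal]) (auto intro!: continuous_intros p assms)
  moreover have "closedin ?P {x \<in> topspace ?P. x v \<in> {0}}" for v
    by (rule closedin_continuous_map_preimage[where f="\<lambda>x. x v" and Y=euclideanreal]) (auto intro: p)
  \<comment> \<open>A product that vanishes is a closed condition; it expresses that the support
    does not contain both ends of an edge.\<close>
  moreover have "closedin ?P {x \<in> topspace ?P. x u * x v \<in> {0}}" for u v
    by (rule closedin_continuous_map_preimage[where f="\<lambda>x. x u * x v" and Y=euclideanreal])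
       (auto intro: p continuous_map_real_mult)
  moreover have "closedin ?P {x \<in> topspace ?P. x v \<in> {0..}}" for v
    by (rule closedin_continuous_map_preimage[where f="\<lambda>x. x v" and Y=euclideanreal]) (auto intro: p)
  moreover have "closedin ?P UNIV"
    using closedin_topspace[of ?P] by simp
  ultimately have "closedin ?P ({x \<in> topspace ?P. (\<Sum>v\<in>V. x v) \<in> {1}} \<inter>
      ((\<Inter>v\<in>UNIV. {x \<in> topspace ?P. x v \<in> (if v \<in> V then {0..} else {0})}) \<inter>
       (\<Inter>(u, v)\<in>UNIV. {x \<in> topspace ?P. x u * x v \<in> (if adj u v then {0} else UNIV)})))"
    by (intro closedin_Int closedin_INT) auto
  also have "{x \<in> topspace ?P. (\<Sum>v\<in>V. x v) \<in> {1}} \<inter>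
      ((\<Inter>v\<in>UNIV. {x \<in> topspace ?P. x v \<in> (if v \<in> V then {0..} else {0})}) \<inter>
       (\<Inter>(u, v)\<in>UNIV. {x \<in> topspace ?P. x u * x v \<in> (if adj u v then {0} else UNIV)})) =
      topspace (indep_space adj V)"
    using assms by (auto simp: in_indep_space_iff split: if_splits) (metis atLeast_iff order_refl singletonD)+
  finally have "compactin ?P (topspace (indep_space adj V))"
    using indep_space_le_1[OF assms, of _ adj] assms
    by (intro closed_compactin[OF K]) (auto simp: PiE_iff in_indep_space_iff)
  then show ?thesis
    unfolding compact_space_def by (simp add: indep_space_def geometric_realization_def compactin_subtopology)
qed

section \<open>Simplicial maps and contiguity\<close>

text \<open>The affine extension of a vertex map to barycentric coordinates.\<close>

definition push :: "'a set \<Rightarrow> ('a \<Rightarrow> 'b) \<Rightarrow> ('a \<Rightarrow> real) \<Rightarrow> 'b \<Rightarrow> real" where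
  "push V f x w = (\<Sum>v\<in>V. if f v = w then x v else 0)"

text \<open>Contiguity of simplicial maps. Independence is a condition on pairs, so pairs of
  vertices suffice; the pair \<open>x = y\<close> makes \<open>f x\<close> and \<open>g x\<close>
  nonadjacent when \<open>x\<close> carries no loop. Taking \<open>f = g\<close> says that
  \<open>f\<close> is simplicial.\<close>

definition contiguous :: "('a \<Rightarrow> 'a \<Rightarrow> bool) \<Rightarrow> 'a set \<Rightarrow> ('b \<Rightarrow> 'b \<Rightarrow> bool) \<Rightarrow> 'b set \<Rightarrow>
    ('a \<Rightarrow> 'b) \<Rightarrow> ('a \<Rightarrow> 'b) \<Rightarrow> bool" where
  "contiguous adj V adj' V' f g \<longleftrightarrow>
     (\<forall>x\<in>V. f x \<in> V' \<and> g x \<in> V') \<and>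
     (\<forall>x\<in>V. \<forall>y\<in>V. \<not> adj x y \<longrightarrow> (\<forall>a\<in>{f x, g x}. \<forall>b\<in>{f y, g y}. \<not> adj' a b))"

lemma sum_push:
  assumes "finite V" "finite V'" "f ` V \<subseteq> V'"
  shows "(\<Sum>w\<in>V'. push V f x w) = (\<Sum>v\<in>V. x v)"
proof -
  have "(\<Sum>w\<in>V'. push V f x w) = (\<Sum>v\<in>V. \<Sum>w\<in>V'. if f v = w then x v else 0)"
    unfolding push_def by (rule sum.swap)
  also have "\<dots> = (\<Sum>v\<in>V. x v)"
    using assms by (intro sum.cong) (auto simp: sum.delta')
  finally show ?thesis .
qed

lemma push_nonneg:
  assumes "\<And>v. 0 \<le> x v"
  shows "0 \<le> push V f x w"
  unfolding push_def by (rule sum_nonneg) (simp add: assms)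

lemma push_nonzeroD:
  assumes "push V f x w \<noteq> 0"
  obtains v where "v \<in> V" "f v = w" "x v \<noteq> 0"
proof -
  obtain v where "v \<in> V" "(if f v = w then x v else 0) \<noteq> 0"
    using assms unfolding push_def by (rule sum.not_neutral_contains_not_neutral)
  then show thesis using that[of v] by (simp split: if_splits)
qed

text \<open>The straight-line homotopy stays in the complex: the support of an intermediate point
  lies in the union of the images of one simplex under \<open>f\<close> and \<open>g\<close>, and
  contiguity makes this union independent.\<close>

lemma homotopic_push:
  fixes f g :: "'a \<Rightarrow> 'b"
  assumes V: "finite V" and V': "finite V'" and fg: "contiguous adj V adj' V' f g"
  shows "homotopic (indep_space adj V) (indep_space adj' V') (push V f) (push V g)"
proof (rule homotopicI[where h="\<lambda>z w. (1 - fst z) * push V f (snd z) w + fst z * push V g (snd z) w"])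
  let ?P = "prod_topology unit_interval (indep_space adj V)"
  let ?h = "\<lambda>z w. (1 - fst z) * push V f (snd z) w + fst z * push V g (snd z) w"
  show "continuous_map ?P (indep_space adj' V') ?h"
    unfolding continuous_map_into_indep_space
  proof (intro conjI allI)
    fix w :: 'b
    have t: "continuous_map ?P euclideanreal fst"
      using continuous_map_fst[of unit_interval "indep_space adj V"] by (simp add: continuous_map_in_subtopology)
    have "continuous_map ?P euclideanreal (\<lambda>z. snd z v)" for v
      using continuous_map_compose[OF continuous_map_snd continuous_map_indep_space_coordinate] by (simp add: o_def)
    then have "continuous_map ?P euclideanreal (\<lambda>z. push V f (snd z) w)" for f :: "'a \<Rightarrow> 'b"
      unfolding push_def by (intro continuous_map_sum[OF V]) simp
    then show "continuous_map ?P euclideanreal (\<lambda>z. ?h z w)"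
      by (intro continuous_map_add continuous_map_real_mult continuous_map_diff t) simp_all
  next
    show "?h ` topspace ?P \<subseteq> topspace (indep_space adj' V')"
    proof (rule image_subsetI)
      fix z assume "z \<in> topspace ?P"
      then obtain t x where z: "z = (t, x)" and t: "0 \<le> t" "t \<le> 1" and x: "x \<in> topspace (indep_space adj V)"
        by (cases z) auto
      note x' = x[unfolded in_indep_space_iff[OF V]]
      have fgV: "f ` V \<subseteq> V'" "g ` V \<subseteq> V'" using fg by (auto simp: contiguous_def)
      have supp: "\<exists>v\<in>V. x v \<noteq> 0 \<and> w \<in> {f v, g v}" if "?h z w \<noteq> 0" for w
      proof -
        from that have "push V f x w \<noteq> 0 \<or> push V g x w \<noteq> 0" by (auto simp: z)
        then show ?thesis by (auto elim!: push_nonzeroD)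
      qed
      have "(\<Sum>w\<in>V'. ?h z w) = (1 - t) * (\<Sum>w\<in>V'. push V f x w) + t * (\<Sum>w\<in>V'. push V g x w)"
        by (simp add: z sum.distrib sum_distrib_left)
      then have "(\<Sum>w\<in>V'. ?h z w) = 1"
        using x' sum_push[OF V V'] fgV by simp
      moreover have "?h z u = 0 \<or> ?h z w = 0" if "adj' u w" for u w
      proof (rule ccontr)
        assume "\<not> ?thesis"
        then obtain a b where ab: "a \<in> V" "x a \<noteq> 0" "u \<in> {f a, g a}" "b \<in> V" "x b \<noteq> 0" "w \<in> {f b, g b}"
          using supp by metis
        then have "\<not> adj a b" using x' by auto
        then show False using ab fg that unfolding contiguous_def by blast
      qed
      moreover have "?h z w = 0" if "w \<notin> V'" for w
        using supp[of w] that fgV by auto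
      moreover have "0 \<le> ?h z w" for w
        using t x' by (auto simp: z intro!: add_nonneg_nonneg mult_nonneg_nonneg push_nonneg)
      ultimately show "?h z \<in> topspace (indep_space adj' V')"
        unfolding in_indep_space_iff[OF V'] by blast
    qed
  qed
qed auto

lemma push_id:
  assumes "finite V" "x \<in> topspace (indep_space adj V)" "\<And>v. v \<in> V \<Longrightarrow> f v = v"
  shows "push V f x = x"
proof
  fix w
  have "push V f x w = (\<Sum>v\<in>V. if v = w then x v else 0)"
    unfolding push_def using assms(3) by (intro sum.cong) auto
  then show "push V f x w = x w" using assms(1,2) by (auto simp: in_indep_space_iff)
qed

lemma push_push:
  assumes "finite V" "finite V'" "f ` V \<subseteq> V'"
  shows "push V' g (push V f x) = push V (g \<circ> f) x"
proof
  fix w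
  have "push V' g (push V f x) w = (\<Sum>u\<in>V'. \<Sum>v\<in>V. if g u = w \<and> f v = u then x v else 0)"
    unfolding push_def by (intro sum.cong) auto
  also have "\<dots> = (\<Sum>v\<in>V. \<Sum>u\<in>V'. if f v = u then (if g u = w then x v else 0) else 0)"
    by (subst sum.swap) (intro sum.cong; auto)
  also have "\<dots> = push V (g \<circ> f) x w"
    unfolding push_def using assms by (intro sum.cong) (auto simp: sum.delta')
  finally show "push V' g (push V f x) w = push V (g \<circ> f) x w" .
qed

lemma indep_space_homotopy_equivalent:
  assumes V: "finite V" and V': "finite V'"
    and f: "contiguous adj V adj' V' f f" and g: "contiguous adj' V' adj V g g"
    and gf: "contiguous adj V adj V (g \<circ> f) id" and fg: "contiguous adj' V' adj' V' (f \<circ> g) id"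
  shows "indep_space adj V homotopy_equivalent_space indep_space adj' V'"
proof -
  have *: "homotopic (indep_space adj V) (indep_space adj V) (push V' g \<circ> push V f) id"
    if "finite V" "finite V'" "contiguous adj V adj' V' f f" "contiguous adj V adj V (g \<circ> f) id"
    for V :: "'c set" and V' :: "'d set" and adj adj' f g
  proof (rule homotopic_with_eq[OF homotopic_push[OF that(1,1,4)]])
    show "(push V' g \<circ> push V f) x = push V (g \<circ> f) x" for x
      using that by (simp add: push_push contiguous_def image_subset_iff)
    show "id x = push V id x" if "x \<in> topspace (indep_space adj V)" for x
      using push_id[OF \<open>finite V\<close> that, of id] by simp
  qed auto
  show ?thesis
    unfolding homotopy_equivalent_space_def
    using *[OF V V' f gf] *[OF V' V g fg]
      homotopic_with_imp_continuous_maps[OF homotopic_push[OF V V' f]]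
      homotopic_with_imp_continuous_maps[OF homotopic_push[OF V' V g]]
    by blast
qed

text \<open>Sending \<open>v\<close> to \<open>u\<close> is contiguous to the identity because every
  neighbour of \<open>u\<close> is a neighbour of \<open>v\<close>; it retracts the complex onto
  that of the graph without \<open>v\<close>.\<close>

lemma indep_space_fold:
  assumes V: "finite V" and irr: "\<And>x. \<not> adj x x" and sym: "\<And>x y. adj x y \<Longrightarrow> adj y x"
    and uv: "u \<in> V" "u \<noteq> v" "\<not> adj u v"
    and N: "\<And>x. x \<in> V \<Longrightarrow> adj u x \<Longrightarrow> adj v x"
  shows "indep_space adj (insert v V) homotopy_equivalent_space indep_space adj (V - {v})"
proof (rule indep_space_homotopy_equivalent)
  let ?r = "\<lambda>x. if x = v then u else x"
  have 1: "\<not> adj v x \<Longrightarrow> x \<in> insert v V \<Longrightarrow> \<not> adj u x" "\<not> adj x v \<Longrightarrow> x \<in> insert v V \<Longrightarrow> \<not> adj x u" for x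
    using N uv sym by blast+
  show "contiguous adj (insert v V) adj (V - {v}) ?r ?r"
    using uv 1 irr unfolding contiguous_def by auto
  show "contiguous adj (V - {v}) adj (insert v V) id id"
    unfolding contiguous_def by auto
  show "contiguous adj (insert v V) adj (insert v V) (id \<circ> ?r) id"
    using uv 1 irr unfolding contiguous_def by auto
  show "contiguous adj (V - {v}) adj (V - {v}) (?r \<circ> id) id"
    unfolding contiguous_def by auto
qed (use V in auto)

lemma indep_space_isomorphic:
  assumes V: "finite V" and f: "inj_on f V"
    and adj: "\<And>x y. x \<in> V \<Longrightarrow> y \<in> V \<Longrightarrow> adj' (f x) (f y) \<longleftrightarrow> adj x y"
  shows "indep_space adj V homotopy_equivalent_space indep_space adj' (f ` V)"
  using assms
  by (intro indep_space_homotopy_equivalent[where f=f and g="inv_into V f"]) (auto simp: contiguous_def)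

text \<open>The complex is a cone with apex \<open>u\<close>: the identity is contiguous to the
  constant map at \<open>u\<close>.\<close>

lemma contractible_indep_space:
  assumes V: "finite V" and irr: "\<And>x. \<not> adj x x"
    and u: "u \<in> V" "\<And>x. x \<in> V \<Longrightarrow> \<not> adj u x \<and> \<not> adj x u"
  shows "contractible_space (indep_space adj V)" "topspace (indep_space adj V) \<noteq> {}"
proof -
  have "contiguous adj V adj V id (\<lambda>_. u)"
    using u irr unfolding contiguous_def by auto
  then have "homotopic (indep_space adj V) (indep_space adj V) (push V id) (push V (\<lambda>_. u))"
    by (rule homotopic_push[OF V V])
  then have "homotopic (indep_space adj V) (indep_space adj V) id (\<lambda>_ w. if u = w then 1 else 0)"
  proof (rule homotopic_with_eq)
    fix x assume x: "x \<in> topspace (indep_space adj V)"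
    show "id x = push V id x" using push_id[OF V x, of id] by simp
    show "(\<lambda>w. if u = w then 1 else 0) = push V (\<lambda>_. u) x"
      using x V by (auto simp: push_def in_indep_space_iff)
  qed auto
  then show "contractible_space (indep_space adj V)"
    unfolding contractible_space_def by blast
  have "(\<lambda>w. if w = u then 1 else 0) \<in> topspace (indep_space adj V)"
    using u irr V by (auto simp: in_indep_space_iff)
  then show "topspace (indep_space adj V) \<noteq> {}" by blast
qed

section \<open>Vertex deletion\<close>

lemma compact_mapping_cone:
  assumes "compact_space L" "compact_space Y"
  shows "compact_space (mapping_cone L Y f)"
proof -
  let ?C = "mapping_cone L Y f"
  have "compactin ?C (base_pt ` topspace Y)"
    using assms(2) by (intro image_compactin[OF _ continuous_map_base_pt]) (simp add: compact_space_def)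
  moreover have "compactin ?C (cone_pt f ` topspace (prod_topology unit_interval L))"
    using compact_space_prod_topology[of unit_interval L] assms(1) compact_unit_interval
    by (intro image_compactin[OF _ continuous_map_cone_pt]) (simp add: compact_space_def)
  moreover have "compactin ?C {None}"
    by (simp add: topspace_mapping_cone)
  ultimately have "compactin ?C ({None} \<union> (base_pt ` topspace Y \<union> cone_pt f ` topspace (prod_topology unit_interval L)))"
    by (intro compactin_Un)
  then show ?thesis
    by (simp add: compact_space_def topspace_mapping_cone)
qed

text \<open>The star of \<open>v\<close> is the cone with apex \<open>v\<close> over the link, and
  it meets the complex of the graph without \<open>v\<close> in the link. The coordinate at
  \<open>v\<close> serves as cone parameter. This gives a continuous bijection from a compact space
  to a Hausdorff space.\<close>

lemma indep_space_mapping_cone: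
  fixes V :: "'a set"
  assumes V: "finite V" and v: "v \<in> V" and irr: "\<And>x. \<not> adj x x" and sym: "\<And>x y. adj x y \<Longrightarrow> adj y x"
  shows "mapping_cone (indep_space adj {x \<in> V. x \<noteq> v \<and> \<not> adj v x}) (indep_space adj (V - {v})) (\<lambda>x. x)
    homeomorphic_space indep_space adj V"
proof -
  let ?L = "{x \<in> V. x \<noteq> v \<and> \<not> adj v x}" and ?Y = "V - {v}"
  let ?X = "indep_space adj V" and ?C = "mapping_cone (indep_space adj ?L) (indep_space adj ?Y) (\<lambda>x. x)"
  define B where "B = (\<lambda>z w. if w = v then fst z else (1 - fst z) * snd z w :: real)"
  define k where "k = cone_map (\<lambda>x :: 'a \<Rightarrow> real. x) B (\<lambda>w. if w = v then 1 else 0)"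
  have fL: "finite ?L" and fY: "finite ?Y" using V by auto
  have L: "x v = 0" "\<And>w. adj v w \<Longrightarrow> x w = 0" "\<And>w. 0 \<le> x w" "\<And>w. w \<notin> V \<Longrightarrow> x w = 0" "(\<Sum>w\<in>?Y. x w) = 1"
      "\<And>u w. adj u w \<Longrightarrow> x u = 0 \<or> x w = 0"
    if "x \<in> topspace (indep_space adj ?L)" for x
  proof -
    have "(\<Sum>w\<in>?Y. x w) = (\<Sum>w\<in>?L. x w)"
      using that fL fY by (intro sum.mono_neutral_right) (auto simp: in_indep_space_iff)
    then show "(\<Sum>w\<in>?Y. x w) = 1" using that fL by (simp add: in_indep_space_iff)
  qed (use that fL in \<open>auto simp: in_indep_space_iff\<close>)
  have sumV: "(\<Sum>w\<in>V. x w) = x v + (\<Sum>w\<in>?Y. x w)" for x :: "'a \<Rightarrow> real"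
    using V v by (rule sum.remove)
  have Y: "x \<in> topspace (indep_space adj ?Y) \<longleftrightarrow> x \<in> topspace ?X \<and> x v = 0" for x
    using fY V v unfolding in_indep_space_iff[OF fY] in_indep_space_iff[OF V] sumV by auto
  have BX: "B (t, x) \<in> topspace ?X" if "0 \<le> t" "t \<le> 1" "x \<in> topspace (indep_space adj ?L)" for t x
    unfolding in_indep_space_iff[OF V]
  proof (intro conjI allI impI)
    show "(\<Sum>w\<in>V. B (t, x) w) = 1"
      using L(5)[OF that(3)] unfolding sumV B_def by (simp flip: sum_distrib_left)
    show "0 \<le> B (t, x) w" for w using that L(3)[OF that(3)] by (simp add: B_def)
    show "B (t, x) w = 0" if "w \<notin> V" for w using that v L(4)[OF \<open>x \<in> _\<close>] by (auto simp: B_def)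
    show "B (t, x) u = 0 \<or> B (t, x) w = 0" if "adj u w" for u w
      using that L(2,6)[OF \<open>x \<in> _\<close>] sym irr by (auto simp: B_def)
  qed
  have k: "continuous_map ?C ?X k"
    unfolding k_def
  proof (rule continuous_map_cone_map)
    show "continuous_map (indep_space adj ?Y) ?X (\<lambda>x. x)"
      unfolding continuous_map_into_indep_space using Y by (auto simp: continuous_map_indep_space_coordinate)
    let ?P = "prod_topology unit_interval (indep_space adj ?L)"
    have t: "continuous_map ?P euclideanreal fst"
      using continuous_map_fst[of unit_interval "indep_space adj ?L"] by (simp add: continuous_map_in_subtopology)
    have "continuous_map ?P euclideanreal (\<lambda>z. snd z w)" for w
      using continuous_map_compose[OF continuous_map_snd continuous_map_indep_space_coordinate] by (simp add: o_def)
    then have "continuous_map ?P euclideanreal (\<lambda>z. B z w)" for w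
      using t by (cases "w = v") (auto simp: B_def intro!: continuous_map_real_mult continuous_map_diff)
    then show "continuous_map ?P ?X B"
      unfolding continuous_map_into_indep_space using BX by auto
    show "(\<lambda>w. if w = v then 1 else 0) \<in> topspace ?X"
      using V v irr by (auto simp: in_indep_space_iff)
  qed (use L(1) in \<open>auto simp: B_def fun_eq_iff\<close>)
  have kc: "k (cone_pt (\<lambda>x. x) (t, x)) = B (t, x)" if "0 \<le> t" "t \<le> 1" "x \<in> topspace (indep_space adj ?L)" for t x
    unfolding k_def by (rule cone_map_cone) (use that L(1) in \<open>auto simp: B_def fun_eq_iff\<close>)
  have C_cases: "c = None \<or> (\<exists>y. y \<in> topspace (indep_space adj ?Y) \<and> c = base_pt y) \<or>
      (\<exists>t x. 0 < t \<and> t < 1 \<and> x \<in> topspace (indep_space adj ?L) \<and> c = cone_pt (\<lambda>x. x) (t, x))"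
    if cC: "c \<in> topspace ?C" for c
    using cC unfolding topspace_mapping_cone
  proof (elim insertE UnE imageE)
    fix z assume c: "c = cone_pt (\<lambda>x. x) z" and z: "z \<in> {0..1} \<times> topspace (indep_space adj ?L)"
    obtain t x where tx: "z = (t, x)" by (cases z)
    consider "t = 0" | "t = 1" | "0 < t" "t < 1" using z tx by force
    then show ?thesis
    proof cases
      case 1
      then have "c = base_pt x" by (simp add: c tx)
      moreover have "x \<in> topspace (indep_space adj ?Y)"
        using L[of x] z tx unfolding in_indep_space_iff[OF fY] by auto
      ultimately show ?thesis by blast
    next
      case 2 then show ?thesis by (simp add: c tx)
    next
      case 3 then show ?thesis using z c tx by blast
    qed
  qed auto
  have "inj_on k (topspace ?C)"
  proof (rule inj_onI)
    fix c c' assume c: "c \<in> topspace ?C" "c' \<in> topspace ?C" "k c = k c'"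
    \<comment> \<open>The coordinate at \<open>v\<close> tells the kinds of points apart: 1 at the
      apex, 0 on the base, and \<open>t\<close> at height \<open>t\<close>.\<close>
    have kN: "k None v = 1" by (simp add: k_def)
    have kb: "k (base_pt y) = y" for y by (simp add: k_def)
    have kv: "k (cone_pt (\<lambda>x. x) (t, x)) v = t" if "0 < t" "t < 1" "x \<in> topspace (indep_space adj ?L)" for t x
      using that by (simp add: kc B_def)
    have B_inj: "x = x'" if "B (t, x) = B (t, x')" "t < 1" "x v = x' v" for t x x'
    proof
      show "x w = x' w" for w
        using fun_cong[OF that(1), of w] that(2,3) by (cases "w = v") (auto simp: B_def)
    qed
    have kb0: "k (base_pt y) v = 0" if "y \<in> topspace (indep_space adj ?Y)" for y
      using that Y kb by simp
    show "c = c'"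
      using C_cases[OF c(1)]
    proof (elim disjE exE conjE)
      assume *: "c = None"
      then have 1: "k c' v = 1" using c(3)[symmetric] kN by simp
      show ?thesis
        using C_cases[OF c(2)]
      proof (elim disjE exE conjE)
        fix y assume "y \<in> topspace (indep_space adj ?Y)" "c' = base_pt y"
        then show ?thesis using 1 kb0[of y] by simp
      next
        fix t x assume "0 < t" "t < 1" "x \<in> topspace (indep_space adj ?L)" "c' = cone_pt (\<lambda>x. x) (t, x)"
        then show ?thesis using 1 kv[of t x] by simp
      qed (use * in simp)
    next
      fix y assume *: "y \<in> topspace (indep_space adj ?Y)" "c = base_pt y"
      then have 0: "k c' v = 0" using c(3)[symmetric] kb0 by simp
      show ?thesis
        using C_cases[OF c(2)]
      proof (elim disjE exE conjE)
        fix y' assume "c' = base_pt y'"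
        then show ?thesis using * c(3) kb by simp
      next
        fix t x assume "0 < t" "t < 1" "x \<in> topspace (indep_space adj ?L)" "c' = cone_pt (\<lambda>x. x) (t, x)"
        then show ?thesis using 0 kv[of t x] by simp
      qed (use 0 kN in simp)
    next
      fix t x assume *: "0 < t" "t < 1" "x \<in> topspace (indep_space adj ?L)" "c = cone_pt (\<lambda>x. x) (t, x)"
      then have t: "k c' v = t" using c(3)[symmetric] kv by simp
      have "c' \<noteq> None"
      proof
        assume "c' = None" then show False using t kN * by simp
      qed
      moreover have "c' \<noteq> base_pt y" if "y \<in> topspace (indep_space adj ?Y)" for y
      proof
        assume "c' = base_pt y" then show False using t kb0[OF that] * by simp
      qed
      ultimately obtain t' x' where **: "0 < t'" "t' < 1" "x' \<in> topspace (indep_space adj ?L)" "c' = cone_pt (\<lambda>x. x) (t', x')"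
        using C_cases[OF c(2)] by blast
      then have "t' = t" using kv t by simp
      then have "B (t, x) = B (t, x')" using * ** c(3) kc[of t] by simp
      from B_inj[OF this *(2)] have "x = x'" using L(1)[OF *(3)] L(1)[OF **(3)] by simp
      then show ?thesis using * ** \<open>t' = t\<close> by simp
    qed
  qed
  moreover have "k ` topspace ?C = topspace ?X"
  proof (intro equalityI subsetI)
    show "x \<in> topspace ?X" if "x \<in> k ` topspace ?C" for x
      using that continuous_map_image_subset_topspace[OF k] by blast
    fix x assume x: "x \<in> topspace ?X"
    note x' = x[unfolded in_indep_space_iff[OF V]]
    have xv: "0 \<le> x v" "x v \<le> 1" using x' indep_space_le_1[OF V x] by auto
    consider "x v = 0" | "x v = 1" | "0 < x v" "x v < 1" using xv by linarith
    then show "x \<in> k ` topspace ?C"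
    proof cases
      case 1
      then have "base_pt x \<in> topspace ?C" using x Y by (simp add: topspace_mapping_cone)
      then show ?thesis by (rule rev_image_eqI) (simp add: k_def)
    next
      case 2
      then have "(\<Sum>w\<in>?Y. x w) = 0" using x' sumV[of x] by simp
      then have "\<forall>w\<in>?Y. x w = 0" using fY x' by (simp add: sum_nonneg_eq_0_iff)
      then have "x = k None" using 2 x' by (auto simp: k_def fun_eq_iff)
      then show ?thesis by (auto simp: topspace_mapping_cone)
    next
      case 3
      \<comment> \<open>The foot in the link of the generator through \<open>x\<close>: the other
        coordinates, rescaled to have sum 1.\<close>
      let ?l = "\<lambda>w. if w = v then 0 else x w / (1 - x v)"
      have nb: "x i = 0" if "adj v i" for i
        using x' 3 that by (metis less_irrefl)
      have "(\<Sum>w\<in>?L. ?l w) = (\<Sum>w\<in>?L. x w) / (1 - x v)"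
        by (simp add: sum_divide_distrib)
      also have "(\<Sum>w\<in>?L. x w) = (\<Sum>w\<in>?Y. x w)"
        using fL fY nb by (intro sum.mono_neutral_left) auto
      also have "\<dots> = 1 - x v" using x' sumV[of x] by simp
      finally have "?l \<in> topspace (indep_space adj ?L)"
        using 3 x' nb unfolding in_indep_space_iff[OF fL] by auto
      moreover from this have "x = k (cone_pt (\<lambda>x. x) (x v, ?l))"
        using 3 by (subst kc) (auto simp: B_def)
      ultimately show ?thesis
        using 3 by (intro image_eqI[of _ k "cone_pt (\<lambda>x. x) (x v, ?l)"]) (auto simp: topspace_mapping_cone)
    qed
  qed
  ultimately have "homeomorphic_map ?C ?X k"
    by (intro continuous_imp_homeomorphic_map[OF k] compact_mapping_cone compact_indep_space fL fY Hausdorff_indep_space)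
  then show ?thesis by (rule homeomorphic_map_imp_homeomorphic_space)
qed

section \<open>Wedges of spheres with a lower bound on the dimensions\<close>

text \<open>
  Level 0 admits the empty space, the sphere of dimension \<open>-1\<close>; level 1 is a wedge of spheres,
  level 2 a path-connected one, and level 3 (or more) a contractible space. Suspension
  raises the level.
\<close>

definition sphere_level :: "nat \<Rightarrow> 'a topology \<Rightarrow> bool" where
  "sphere_level k X \<longleftrightarrow> (k = 0 \<and> topspace X = {}) \<or>
     ((\<exists>ds. X homotopy_equivalent_space wedge_of_spheres ds \<and> (3 \<le> k \<longrightarrow> ds = [])) \<and>
      (2 \<le> k \<longrightarrow> path_connected_space X))"

lemma homotopy_equivalent_path_connected:
  assumes "X homotopy_equivalent_space Y" "path_connected_space X"
  shows "path_connected_space Y"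
proof -
  obtain f g where fg: "continuous_map X Y f" "continuous_map Y X g" "homotopic Y Y (f \<circ> g) id"
    using assms(1) unfolding homotopy_equivalent_space_def by blast
  obtain h where h: "continuous_map (prod_topology unit_interval Y) Y h" "\<And>y. h (0, y) = f (g y)" "\<And>y. h (1, y) = y"
    using fg(3) unfolding homotopic_with_def by auto
  have 1: "path_component_of Y (f (g y)) y" if "y \<in> topspace Y" for y
  proof -
    have "continuous_map unit_interval (prod_topology unit_interval Y) (\<lambda>s. (s, y))"
      using that by (simp add: continuous_map_pairwise o_def continuous_map_id[unfolded id_def])
    from continuous_map_compose[OF this h(1)]
    have "pathin Y (\<lambda>s. h (s, y))" unfolding pathin_def by (simp add: o_def)
    then show ?thesis unfolding path_component_of_def using h by (intro exI[of _ "\<lambda>s. h (s, y)"]) simp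
  qed
  have 2: "path_component_of Y (f x) (f x')" if xx: "x \<in> topspace X" "x' \<in> topspace X" for x x'
  proof -
    obtain p where p: "pathin X p" "p 0 = x" "p 1 = x'"
      using assms(2) xx unfolding path_connected_space_def by blast
    have "pathin Y (f \<circ> p)"
      using p(1) fg(1) unfolding pathin_def by (rule continuous_map_compose)
    then show ?thesis unfolding path_component_of_def using p by (intro exI[of _ "f \<circ> p"]) simp
  qed
  have "path_component_of Y y y'" if "y \<in> topspace Y" "y' \<in> topspace Y" for y y'
  proof -
    have "g y \<in> topspace X" "g y' \<in> topspace X"
      using continuous_map_image_subset_topspace[OF fg(2)] that by blast+
    then show ?thesis
      using 1[OF that(1)] 1[OF that(2)] 2 path_component_of_sym path_component_of_trans by metis
  qed
  then show ?thesis unfolding path_connected_space_iff_path_component by blast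
qed

lemma homotopy_equivalent_topspace_empty:
  assumes "X homotopy_equivalent_space Y"
  shows "topspace X = {} \<longleftrightarrow> topspace Y = {}"
  using assms unfolding homotopy_equivalent_space_def
  by (metis continuous_map_image_subset_topspace image_is_empty subset_empty)

lemma sphere_level_homotopy_equivalent:
  assumes "X homotopy_equivalent_space Y" "sphere_level k X"
  shows "sphere_level k Y"
proof -
  have "Y homotopy_equivalent_space X" using assms(1) homotopy_equivalent_space_sym by blast
  then show ?thesis
    using assms homotopy_equivalent_path_connected[OF assms(1)] homotopy_equivalent_topspace_empty[OF assms(1)]
      homotopy_eqv_trans
    unfolding sphere_level_def by metis
qed

lemma sphere_level_mono:
  assumes "sphere_level k X" "j \<le> k"
  shows "sphere_level j X"
proof -
  have "k = 0 \<Longrightarrow> j = 0" "3 \<le> j \<Longrightarrow> 3 \<le> k" "2 \<le> j \<Longrightarrow> 2 \<le> k" using assms(2) by auto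
  then show ?thesis using assms(1) unfolding sphere_level_def by blast
qed

lemma sphere_level_3:
  assumes "contractible_space X" "topspace X \<noteq> {}"
  shows "sphere_level 3 X"
proof -
  have "X homotopy_equivalent_space wedge_of_spheres []"
    using assms homotopy_equivalent_empty_wedge_iff by blast
  then show ?thesis
    unfolding sphere_level_def using contractible_imp_path_connected_space[OF assms(1)] by blast
qed

lemma sphere_level_3_contractible:
  assumes "sphere_level k X" "3 \<le> k"
  shows "contractible_space X" "topspace X \<noteq> {}"
  using assms homotopy_equivalent_empty_wedge_iff[of X] unfolding sphere_level_def by auto

lemma sphere_level_imp_wedge:
  assumes "sphere_level k X" "1 \<le> k"
  shows "homotopy_equivalent_to_wedge_of_spheres X"
  using assms unfolding sphere_level_def homotopy_equivalent_to_wedge_of_spheres_def by auto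

text \<open>The isolated apex contributes a 0-sphere. As \<open>Y\<close> is nonempty the result is
  disconnected, so level 1 is the most that can be claimed.\<close>

lemma sphere_level_mapping_cone_empty:
  assumes Y: "sphere_level k Y" "1 \<le> k" and L: "topspace L = {}"
  shows "sphere_level 1 (mapping_cone L Y f)"
proof -
  obtain ds where ds: "Y homotopy_equivalent_space wedge_of_spheres ds"
    using Y by (auto simp: sphere_level_def)
  then obtain u v where uv: "continuous_map Y (wedge_of_spheres ds) u" "continuous_map (wedge_of_spheres ds) Y v"
    "homotopic Y Y (v \<circ> u) id" "homotopic (wedge_of_spheres ds) (wedge_of_spheres ds) (u \<circ> v) id"
    unfolding homotopy_equivalent_space_def by blast
  have f: "continuous_map L Y f" using L by (simp add: null_topspace_iff_trivial)
  have "mapping_cone L Y f homotopy_equivalent_space wedge_of_spheres (ds @ [0])"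
    using mapping_cone_base_homotopy_equivalence[OF uv f] mapping_cone_empty_wedge_of_spheres[OF L]
    by (rule homotopy_eqv_trans)
  then show ?thesis unfolding sphere_level_def by auto
qed

text \<open>The cone is the wedge of \<open>Y\<close> with the suspension of \<open>L\<close>. A
  contractible \<open>L\<close> contributes no spheres, and the level of \<open>Y\<close> survives.
  Otherwise suspension raises \<open>j\<close> by one, cut off at 2, since level 3 would mean
  contractible.\<close>

proposition sphere_level_mapping_cone:
  assumes f: "homotopic L Y f (\<lambda>_. c)" and Y: "sphere_level k Y" "2 \<le> k" and L: "sphere_level j L"
  shows "sphere_level (if 3 \<le> j then k else min 2 (Suc j)) (mapping_cone L Y f)"
proof (cases "topspace L = {}")
  case True
  have "\<not> 3 \<le> j" using L True sphere_level_3_contractible(2) by blast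
  moreover have "j = 0"
  proof (rule ccontr)
    assume "j \<noteq> 0"
    then obtain es where "L homotopy_equivalent_space wedge_of_spheres es"
      using L by (auto simp: sphere_level_def)
    from homotopy_equivalent_topspace_empty[OF this] True show False
      unfolding topspace_wedge_of_spheres by blast
  qed
  ultimately show ?thesis
    using sphere_level_mapping_cone_empty[OF Y(1) _ True] Y(2) by simp
next
  case False
  have fc: "continuous_map L Y f" "continuous_map L Y (\<lambda>_. c)"
    using homotopic_with_imp_continuous_maps[OF f] by auto
  then have c: "c \<in> topspace Y" using False by (auto simp: continuous_map_def)
  obtain ds where ds: "Y homotopy_equivalent_space wedge_of_spheres ds" "3 \<le> k \<Longrightarrow> ds = []" "path_connected_space Y"
    using Y by (auto simp: sphere_level_def)
  obtain es where es: "L homotopy_equivalent_space wedge_of_spheres es" "3 \<le> j \<Longrightarrow> es = []"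
    using L False by (auto simp: sphere_level_def)
  have "mapping_cone L Y f homotopy_equivalent_space mapping_cone (wedge_of_spheres es) (wedge_of_spheres ds) (\<lambda>_. None)"
    by (rule mapping_cone_nullhomotopic[OF f c ds(3,1) es(1)]) (simp add: topspace_wedge_of_spheres)
  also have "\<dots> homotopy_equivalent_space wedge_of_spheres (ds @ map Suc es)"
    by (rule mapping_cone_wedge_of_spheres)
  finally show ?thesis
    unfolding sphere_level_def using path_connected_mapping_cone[OF fc(1) ds(3) False] ds(2) es(2)
    by (intro disjI2 conjI exI[of _ "ds @ map Suc es"]) auto
qed

section \<open>Graphs\<close>

locale graph_relation =
  fixes adj :: "'a \<Rightarrow> 'a \<Rightarrow> bool"
  assumes irrefl: "\<not> adj x x" and sym: "adj x y \<Longrightarrow> adj y x"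
begin

definition graph_level :: "nat \<Rightarrow> 'a set \<Rightarrow> bool" where
  "graph_level k V \<longleftrightarrow> finite V \<and> sphere_level k (indep_space adj V)"

definition link_verts :: "'a \<Rightarrow> 'a set \<Rightarrow> 'a set" where
  "link_verts v V = {x \<in> V. x \<noteq> v \<and> \<not> adj v x}"

lemma graph_level_mono: "graph_level k V \<Longrightarrow> j \<le> k \<Longrightarrow> graph_level j V"
  unfolding graph_level_def using sphere_level_mono by blast

lemma graph_level_fold:
  assumes "graph_level k (V - {v})" "u \<in> V" "u \<noteq> v" "\<not> adj u v" "\<And>x. x \<in> V \<Longrightarrow> adj u x \<Longrightarrow> adj v x"
  shows "graph_level k (insert v V)"
proof -
  have V: "finite V" using assms(1) by (simp add: graph_level_def)
  have "indep_space adj (V - {v}) homotopy_equivalent_space indep_space adj (insert v V)"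
    using indep_space_fold[of V adj, OF V irrefl sym assms(2-5)] homotopy_equivalent_space_sym by blast
  from sphere_level_homotopy_equivalent[OF this] show ?thesis
    using assms(1) V by (simp add: graph_level_def)
qed

lemma graph_level_unfold:
  assumes "graph_level k (insert v V)" "u \<in> V" "u \<noteq> v" "\<not> adj u v" "\<And>x. x \<in> V \<Longrightarrow> adj u x \<Longrightarrow> adj v x"
  shows "graph_level k (V - {v})"
proof -
  have V: "finite V" using assms(1) by (simp add: graph_level_def)
  from sphere_level_homotopy_equivalent[OF indep_space_fold[of V adj, OF V irrefl sym assms(2-5)]]
  show ?thesis using assms(1) V by (simp add: graph_level_def)
qed

lemma graph_level_isolated:
  assumes "finite V" "u \<in> V" "\<And>x. x \<in> V \<Longrightarrow> \<not> adj u x"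
  shows "graph_level 3 V"
  using sphere_level_3[OF contractible_indep_space[of V adj u]] assms irrefl sym
  unfolding graph_level_def by blast

lemma topspace_indep_space_empty: "topspace (indep_space adj {}) = {}"
  by (rule equals0I) (simp add: in_indep_space_iff)

lemma graph_level_empty: "graph_level 0 {}"
  unfolding graph_level_def sphere_level_def using topspace_indep_space_empty by blast

lemma graph_level_mapping_cone:
  assumes v: "v \<in> V" and V: "finite V"
    and "sphere_level k (mapping_cone (indep_space adj (link_verts v V)) (indep_space adj (V - {v})) (\<lambda>x. x))"
  shows "graph_level k V"
proof -
  have "mapping_cone (indep_space adj (link_verts v V)) (indep_space adj (V - {v})) (\<lambda>x. x) homeomorphic_space indep_space adj V"
    unfolding link_verts_def by (rule indep_space_mapping_cone[OF V v irrefl sym])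
  from sphere_level_homotopy_equivalent[OF homeomorphic_imp_homotopy_equivalent_space[OF this] assms(3)]
  show ?thesis using V by (simp add: graph_level_def)
qed

text \<open>A vertex adjacent to all others is an isolated point of the complex.\<close>

lemma graph_level_dominating:
  assumes "graph_level k (V - {v})" "1 \<le> k" "v \<in> V" "link_verts v V = {}"
  shows "graph_level 1 V"
proof (rule graph_level_mapping_cone[OF assms(3)])
  show "finite V" using assms(1) by (simp add: graph_level_def)
  show "sphere_level 1 (mapping_cone (indep_space adj (link_verts v V)) (indep_space adj (V - {v})) (\<lambda>x. x))"
    unfolding assms(4) using assms(1,2) topspace_indep_space_empty
    by (intro sphere_level_mapping_cone_empty) (auto simp: graph_level_def)
qed

lemma graph_level_split_general:
  assumes v: "v \<in> V" and Y: "graph_level k (V - {v})" "2 \<le> k" and L: "graph_level j (link_verts v V)"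
    and null: "homotopic (indep_space adj (link_verts v V)) (indep_space adj (V - {v})) (\<lambda>x. x) (\<lambda>_. c)"
  shows "graph_level (if 3 \<le> j then k else min 2 (Suc j)) V"
proof (rule graph_level_mapping_cone[OF v])
  show "finite V" using Y by (simp add: graph_level_def)
  show "sphere_level (if 3 \<le> j then k else min 2 (Suc j))
      (mapping_cone (indep_space adj (link_verts v V)) (indep_space adj (V - {v})) (\<lambda>x. x))"
    using Y L by (intro sphere_level_mapping_cone[OF null]) (auto simp: graph_level_def)
qed

lemma contiguous_inclusion: "U \<subseteq> V \<Longrightarrow> contiguous adj U adj V (\<lambda>x. x) (\<lambda>x. x)"
  unfolding contiguous_def by auto

lemma homotopic_inclusion:
  assumes "finite V" "U \<subseteq> V"
  shows "homotopic (indep_space adj U) (indep_space adj V) (push U (\<lambda>x. x)) (\<lambda>x. x)"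
proof (rule homotopic_with_eq[OF homotopic_push[OF _ assms(1) contiguous_inclusion[OF assms(2)]]])
  show U: "finite U" using assms finite_subset by blast
  show "x = push U (\<lambda>x. x) x" if "x \<in> topspace (indep_space adj U)" for x
    using push_id[OF U that] by simp
qed auto

lemma graph_level_split_contractible_link:
  assumes v: "v \<in> V" and Y: "graph_level k (V - {v})" "2 \<le> k" and L: "graph_level j (link_verts v V)" "3 \<le> j"
  shows "graph_level k V"
proof -
  have "continuous_map (indep_space adj (link_verts v V)) (indep_space adj (V - {v})) (\<lambda>x. x)"
    using homotopic_with_imp_continuous_maps[OF homotopic_inclusion[of "V - {v}" "link_verts v V"]] Y
    by (auto simp: graph_level_def link_verts_def)
  moreover have "contractible_space (indep_space adj (link_verts v V))"
    using L sphere_level_3_contractible unfolding graph_level_def by blast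
  ultimately obtain c where "homotopic (indep_space adj (link_verts v V)) (indep_space adj (V - {v})) (\<lambda>x. x) (\<lambda>_. c)"
    by (rule nullhomotopic_from_contractible_space)
  from graph_level_split_general[OF v Y L(1) this] L(2) show ?thesis by simp
qed

text \<open>Without \<open>w\<close> the vertex \<open>v\<close> is isolated, so the base of the
  cone is contractible and the complex is the suspension of the link of \<open>w\<close>.\<close>

lemma graph_level_leaf:
  assumes vw: "v \<in> V" "w \<in> V" "v \<noteq> w" and leaf: "\<And>x. x \<in> V \<Longrightarrow> adj v x \<Longrightarrow> x = w"
    and L: "graph_level j (link_verts w V)" and V: "finite V"
  shows "graph_level (if 3 \<le> j then 3 else min 2 (Suc j)) V"
proof -
  have Y: "graph_level 3 (V - {w})"
    by (rule graph_level_isolated[of _ v]) (use V vw leaf in auto)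
  have "continuous_map (indep_space adj (link_verts w V)) (indep_space adj (V - {w})) (\<lambda>x. x)"
    using homotopic_with_imp_continuous_maps[OF homotopic_inclusion[of "V - {w}" "link_verts w V"]] V
    by (auto simp: link_verts_def)
  moreover have "contractible_space (indep_space adj (V - {w}))"
    using Y sphere_level_3_contractible unfolding graph_level_def by blast
  ultimately obtain c where "homotopic (indep_space adj (link_verts w V)) (indep_space adj (V - {w})) (\<lambda>x. x) (\<lambda>_. c)"
    by (rule nullhomotopic_into_contractible_space)
  from graph_level_split_general[OF vw(2) Y _ L this] show ?thesis by simp
qed

text \<open>
  The last hypothesis says that the inclusion of the link is homotopic, through pairwise
  contiguous simplicial maps, to a map into the star of \<open>c\<close>.
\<close>

lemma graph_level_split:
  assumes v: "v \<in> V" and Y: "graph_level k (V - {v})" "2 \<le> k" and L: "graph_level j (link_verts v V)"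
    and chain: "(contiguous adj (link_verts v V) adj (V - {v}))\<^sup>*\<^sup>* (\<lambda>x. x) f"
    and c: "contiguous adj (link_verts v V) adj (V - {v}) f (\<lambda>_. c)"
  shows "graph_level (if 3 \<le> j then k else min 2 (Suc j)) V"
proof -
  let ?L = "link_verts v V" and ?Y = "V - {v}"
  have fin: "finite ?L" "finite ?Y" using Y L by (auto simp: graph_level_def)
  have incl: "homotopic (indep_space adj ?L) (indep_space adj ?Y) (\<lambda>x. x) (push ?L (\<lambda>x. x))"
    using homotopic_inclusion[of ?Y ?L] fin homotopic_with_symD by (fastforce simp: link_verts_def)
  from chain have "homotopic (indep_space adj ?L) (indep_space adj ?Y) (\<lambda>x. x) (push ?L f)"
  proof (induction rule: rtranclp_induct)
    case (step g h)
    show ?case using step.IH homotopic_push[OF fin step.hyps(2)] by (rule homotopic_with_trans)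
  qed (rule incl)
  then have "homotopic (indep_space adj ?L) (indep_space adj ?Y) (\<lambda>x. x) (push ?L (\<lambda>_. c))"
    using homotopic_push[OF fin c] by (rule homotopic_with_trans)
  then have "homotopic (indep_space adj ?L) (indep_space adj ?Y) (\<lambda>x. x) (\<lambda>_ w. if c = w then 1 else 0)"
  proof (rule homotopic_with_eq)
    fix x assume x: "x \<in> topspace (indep_space adj ?L)"
    show "(\<lambda>w. if c = w then 1 else 0) = push ?L (\<lambda>_. c) x"
      using x fin by (auto simp: push_def in_indep_space_iff)
  qed auto
  from graph_level_split_general[OF v Y L this] show ?thesis .
qed

end

lemma graph_level_isomorphic:
  assumes adj: "graph_relation adj" and adj': "graph_relation adj'"
    and f: "inj_on f V" "f ` V = V'" "\<And>x y. x \<in> V \<Longrightarrow> y \<in> V \<Longrightarrow> adj' (f x) (f y) \<longleftrightarrow> adj x y"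
    and "graph_relation.graph_level adj k V"
  shows "graph_relation.graph_level adj' k V'"
proof -
  have V: "finite V" and lev: "sphere_level k (indep_space adj V)"
    using assms(6) unfolding graph_relation.graph_level_def[OF adj] by auto
  have "sphere_level k (indep_space adj' (f ` V))"
    by (rule sphere_level_homotopy_equivalent[OF indep_space_isomorphic lev]) (use V f in auto)
  then show ?thesis
    using V f(2) unfolding graph_relation.graph_level_def[OF adj'] by auto
qed

section \<open>Gadgets attached to a graph\<close>

text \<open>
  A gadget is a finite graph on integers, some of whose vertices are joined to all of a vertex
  set \<open>P\<close>, or to all of a vertex set \<open>Q\<close>, of an otherwise unspecified graph.
\<close>

type_synonym edge_list = "(int \<times> int) list"

section \<open>Attaching a gadget\<close>

definition gadget_edge :: "edge_list \<Rightarrow> int \<Rightarrow> int \<Rightarrow> bool" where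
  "gadget_edge es a b \<longleftrightarrow> a \<noteq> b \<and> ((a, b) \<in> set es \<or> (b, a) \<in> set es)"

fun attach :: "('h \<Rightarrow> 'h \<Rightarrow> bool) \<Rightarrow> 'h set \<Rightarrow> 'h set \<Rightarrow> edge_list \<Rightarrow> int list \<Rightarrow> int list \<Rightarrow>
    int + 'h \<Rightarrow> int + 'h \<Rightarrow> bool" where
  "attach adj P Q es ps qs (Inl a) (Inl b) = gadget_edge es a b"
| "attach adj P Q es ps qs (Inl a) (Inr h) = (a \<in> set ps \<and> h \<in> P \<or> a \<in> set qs \<and> h \<in> Q)"
| "attach adj P Q es ps qs (Inr h) (Inl a) = (a \<in> set ps \<and> h \<in> P \<or> a \<in> set qs \<and> h \<in> Q)"
| "attach adj P Q es ps qs (Inr h) (Inr h') = adj h h'"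

lemma gadget_edge_sym: "gadget_edge es a b \<longleftrightarrow> gadget_edge es b a"
  by (auto simp: gadget_edge_def)

lemma gadget_edge_irrefl [simp]: "\<not> gadget_edge es a a"
  by (simp add: gadget_edge_def)

lemma graph_relation_attach:
  assumes "graph_relation adj"
  shows "graph_relation (attach adj P Q es ps qs)"
proof
  show "\<not> attach adj P Q es ps qs x x" for x
    using graph_relation.irrefl[OF assms] by (cases x) auto
  show "attach adj P Q es ps qs y x" if "attach adj P Q es ps qs x y" for x y
    using that graph_relation.sym[OF assms] by (cases x; cases y) (auto simp: gadget_edge_sym)
qed

text \<open>Passing to the link of a gadget vertex deletes \<open>P\<close> or \<open>Q\<close> as a
  whole or not at all, so one flag for each of them records the state of the host graph.\<close>

definition attach_verts :: "'h set \<Rightarrow> 'h set \<Rightarrow> 'h set \<Rightarrow> int list \<Rightarrow> bool \<Rightarrow> bool \<Rightarrow> (int + 'h) set" where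
  "attach_verts H P Q vs p q =
     Inl ` set vs \<union> Inr ` (H - (if p then P else {}) - (if q then Q else {}))"

datatype gadget_name = Gam | Lam | GA | GB | GC | GD | GE | GF | GX | GK | GY

text \<open>
  Instructions for computing a level by deleting and adding vertices. In \<open>Split v ms c\<close> the
  list \<open>ms\<close> moves the vertices of the link of \<open>v\<close> one at a time, through contiguous maps,
  into the star of \<open>c\<close>; \<open>Rest\<close> is reached when only the vertices outside \<open>P \<union> Q\<close> are left.
  Below, the flags \<open>p\<close> and \<open>q\<close> record that \<open>P\<close> and \<open>Q\<close> have been deleted, and \<open>e\<close> that there are
  no vertices outside \<open>P \<union> Q\<close>; only then can a gadget vertex dominate the whole graph.
\<close>

datatype plan =
    Point int
  | Fold int int plan
  | Unfold int int plan
  | Leaf int int plan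
  | Split int "(int \<times> int) list" int plan plan
  | Contract int plan plan
  | Dominate int plan
  | Known gadget_name bool "(int \<times> int) list"
  | Rest

type_synonym gadget = "int list \<times> edge_list \<times> int list \<times> int list"

section \<open>The checker for plans\<close>

definition gadget_link :: "edge_list \<Rightarrow> int \<Rightarrow> int list \<Rightarrow> int list" where
  "gadget_link es v vs = filter (\<lambda>x. x \<noteq> v \<and> \<not> gadget_edge es v x) vs"

text \<open>Every host vertex still present that is joined to \<open>y\<close> is joined to
  \<open>x\<close>. Once \<open>P\<close> or \<open>Q\<close> has been deleted, being joined to it
  imposes nothing, hence the disjuncts \<open>p\<close> and \<open>q\<close>.\<close>

definition types_le :: "int list \<Rightarrow> int list \<Rightarrow> bool \<Rightarrow> bool \<Rightarrow> int \<Rightarrow> int \<Rightarrow> bool" where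
  "types_le ps qs p q x y \<longleftrightarrow>
     (p \<or> x \<in> set ps \<or> y \<notin> set ps) \<and> (q \<or> x \<in> set qs \<or> y \<notin> set qs)"

definition untyped :: "int list \<Rightarrow> int list \<Rightarrow> bool \<Rightarrow> bool \<Rightarrow> int \<Rightarrow> bool" where
  "untyped ps qs p q x \<longleftrightarrow> (p \<or> x \<notin> set ps) \<and> (q \<or> x \<notin> set qs)"

definition folds :: "edge_list \<Rightarrow> int list \<Rightarrow> int list \<Rightarrow> int list \<Rightarrow> bool \<Rightarrow> bool \<Rightarrow> int \<Rightarrow> int \<Rightarrow> bool" where
  "folds es ps qs vs p q u v \<longleftrightarrow> u \<in> set vs \<and> u \<noteq> v \<and> \<not> gadget_edge es u v \<and>
     list_all (\<lambda>x. gadget_edge es u x \<longrightarrow> gadget_edge es v x) vs \<and> types_le ps qs p q v u"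

text \<open>\<open>f\<close> records where each vertex of the link \<open>ls\<close> currently sits.
  A move of \<open>v\<close> to \<open>w\<close> is contiguous if \<open>w\<close> is nonadjacent to
  the present place of \<open>v\<close> and of every vertex that can share a simplex with
  \<open>v\<close>. Host vertices never move, so for them \<open>types_le\<close> suffices. At the
  end all places, and all host vertices left, must be nonadjacent to \<open>c\<close>.\<close>

fun moves_to_cone :: "edge_list \<Rightarrow> int list \<Rightarrow> int list \<Rightarrow> bool \<Rightarrow> bool \<Rightarrow> int list \<Rightarrow> int list \<Rightarrow>
    (int \<Rightarrow> int) \<Rightarrow> (int \<times> int) list \<Rightarrow> int \<Rightarrow> bool" where
  "moves_to_cone es ps qs p q ls ys f [] c \<longleftrightarrow> c \<in> set ys \<and> untyped ps qs p q c \<and>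
     list_all (\<lambda>x. \<not> gadget_edge es (f x) c) ls"
| "moves_to_cone es ps qs p q ls ys f ((v, w) # ms) c \<longleftrightarrow>
     w \<in> set ys \<and> \<not> gadget_edge es (f v) w \<and> types_le ps qs p q v w \<and>
     list_all (\<lambda>x. x = v \<or> gadget_edge es x v \<or> \<not> gadget_edge es (f x) w) ls \<and>
     moves_to_cone es ps qs p q ls ys (f(v := w)) ms c"

text \<open>\<open>m\<close> lists an isomorphism as pairs. With \<open>r\<close> the known gadget
  is read with \<open>P\<close> and \<open>Q\<close> exchanged, which the reflection of the grid
  justifies.\<close>

definition is_copy :: "edge_list \<Rightarrow> int list \<Rightarrow> int list \<Rightarrow> int list \<Rightarrow> gadget \<Rightarrow> bool \<Rightarrow> (int \<times> int) list \<Rightarrow> bool" where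
  "is_copy es ps qs vs g r m \<longleftrightarrow> (case g of (vs', es', ps', qs') \<Rightarrow>
     distinct (map fst m) \<and> distinct (map snd m) \<and>
     list_all (\<lambda>x. x \<in> set (map fst m)) vs \<and> list_all (\<lambda>x. x \<in> set vs) (map fst m) \<and>
     list_all (\<lambda>x. x \<in> set (map snd m)) vs' \<and> list_all (\<lambda>x. x \<in> set vs') (map snd m) \<and>
     list_all (\<lambda>(a, a'). list_all (\<lambda>(b, b'). gadget_edge es a b = gadget_edge es' a' b') m \<and>
       (a \<in> set ps) = (a' \<in> set (if r then qs' else ps')) \<and>
       (a \<in> set qs) = (a' \<in> set (if r then ps' else qs'))) m)"

text \<open>\<open>None\<close> means that some side condition fails. \<open>Known\<close> yields 2,
  the level that the induction hypothesis offers, and \<open>Rest\<close> yields 0, since what is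
  left of the host may be empty.\<close>

primrec level_of :: "(gadget_name \<Rightarrow> gadget) \<Rightarrow> edge_list \<Rightarrow> int list \<Rightarrow> int list \<Rightarrow> bool \<Rightarrow> plan \<Rightarrow>
    int list \<Rightarrow> bool \<Rightarrow> bool \<Rightarrow> nat option" where
  "level_of gad es ps qs e (Point u) vs p q =
     (if u \<in> set vs \<and> list_all (\<lambda>x. \<not> gadget_edge es u x) vs \<and> untyped ps qs p q u then Some 3 else None)"
| "level_of gad es ps qs e (Fold u v pl) vs p q =
     (if v \<in> set vs \<and> folds es ps qs (removeAll v vs) p q u v
      then level_of gad es ps qs e pl (removeAll v vs) p q else None)"
| "level_of gad es ps qs e (Unfold u v pl) vs p q =
     (if v \<notin> set vs \<and> folds es ps qs vs p q u v
      then level_of gad es ps qs e pl (v # vs) p q else None)"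
| "level_of gad es ps qs e (Leaf v w pl) vs p q =
     (if v \<in> set vs \<and> w \<in> set vs \<and> v \<noteq> w \<and> untyped ps qs p q v \<and>
        list_all (\<lambda>x. gadget_edge es v x \<longrightarrow> x = w) vs
      then map_option (\<lambda>j. if 3 \<le> j then 3 else min 2 (Suc j))
        (level_of gad es ps qs e pl (gadget_link es w vs) (p \<or> w \<in> set ps) (q \<or> w \<in> set qs))
      else None)"
| "level_of gad es ps qs e (Split v ms c plL plY) vs p q =
     (let p' = p \<or> v \<in> set ps; q' = q \<or> v \<in> set qs; ls = gadget_link es v vs; ys = removeAll v vs in
      if v \<in> set vs \<and> moves_to_cone es ps qs p' q' ls ys id ms c
      then (case level_of gad es ps qs e plY ys p q of None \<Rightarrow> None
        | Some k \<Rightarrow> if 2 \<le> k then map_option (\<lambda>j. if 3 \<le> j then k else min 2 (Suc j))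
            (level_of gad es ps qs e plL ls p' q') else None)
      else None)"
| "level_of gad es ps qs e (Contract v plL plY) vs p q =
     (let p' = p \<or> v \<in> set ps; q' = q \<or> v \<in> set qs in
      if v \<in> set vs
      then (case level_of gad es ps qs e plY (removeAll v vs) p q of None \<Rightarrow> None
        | Some k \<Rightarrow> (case level_of gad es ps qs e plL (gadget_link es v vs) p' q' of None \<Rightarrow> None
          | Some j \<Rightarrow> if 2 \<le> k \<and> 3 \<le> j then Some k else None))
      else None)"
| "level_of gad es ps qs e (Dominate v pl) vs p q =
     (if e \<and> v \<in> set vs \<and> gadget_link es v vs = [] \<and> (p \<or> v \<in> set ps) \<and> (q \<or> v \<in> set qs)
      then (case level_of gad es ps qs e pl (removeAll v vs) p q of None \<Rightarrow> None
        | Some k \<Rightarrow> if 1 \<le> k then Some 1 else None)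
      else None)"
| "level_of gad es ps qs e (Known t r m) vs p q =
     (if \<not> p \<and> \<not> q \<and> is_copy es ps qs vs (gad t) r m then Some 2 else None)"
| "level_of gad es ps qs e Rest vs p q = (if vs = [] \<and> p \<and> q then Some 0 else None)"

primrec plan_names :: "plan \<Rightarrow> gadget_name set" where
  "plan_names (Point u) = {}"
| "plan_names (Fold u v pl) = plan_names pl"
| "plan_names (Unfold u v pl) = plan_names pl"
| "plan_names (Leaf v w pl) = plan_names pl"
| "plan_names (Split v ms c plL plY) = plan_names plL \<union> plan_names plY"
| "plan_names (Contract v plL plY) = plan_names plL \<union> plan_names plY"
| "plan_names (Dominate v pl) = plan_names pl"
| "plan_names (Known t r m) = {t}"
| "plan_names Rest = {}"

section \<open>Soundness of the checker\<close>

text \<open>The host graph is arbitrary: what the induction knows about it enters through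
  \<open>rest\<close> and \<open>known\<close>, the latter for both readings \<open>r\<close> of a
  gadget.\<close>

locale attachment = graph_relation adj for adj :: "'h \<Rightarrow> 'h \<Rightarrow> bool" +
  fixes H P Q :: "'h set" and gad :: "gadget_name \<Rightarrow> gadget" and known :: "gadget_name set"
    and es :: edge_list and ps qs :: "int list" and e :: bool
  assumes finite_H: "finite H"
    and rest: "graph_level 0 (H - P - Q)"
    and e: "e \<Longrightarrow> H \<subseteq> P \<union> Q"
    and known: "t \<in> known \<Longrightarrow> gad t = (vs', es', ps', qs') \<Longrightarrow>
      graph_relation.graph_level (attach adj P Q es' (if r then qs' else ps') (if r then ps' else qs')) 2
        (attach_verts H P Q vs' False False)"
begin

abbreviation "gadj \<equiv> attach adj P Q es ps qs"
abbreviation "gverts \<equiv> attach_verts H P Q"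

sublocale G: graph_relation gadj
  by (rule graph_relation_attach) unfold_locales

lemma finite_gverts: "finite (gverts vs p q)"
  using finite_H by (auto simp: attach_verts_def)

lemma link_verts_gverts:
  "G.link_verts (Inl v) (gverts vs p q) = gverts (gadget_link es v vs) (p \<or> v \<in> set ps) (q \<or> v \<in> set qs)"
  unfolding G.link_verts_def attach_verts_def gadget_link_def
  by (auto simp: split: if_splits)

lemma gverts_removeAll: "gverts (removeAll v vs) p q = gverts vs p q - {Inl v}"
  by (auto simp: attach_verts_def)

lemma gverts_Cons: "gverts (v # vs) p q = insert (Inl v) (gverts vs p q)"
  by (auto simp: attach_verts_def)

lemma Inl_in_gverts: "Inl v \<in> gverts vs p q \<longleftrightarrow> v \<in> set vs"
  by (auto simp: attach_verts_def)

lemma foldsD: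
  assumes "folds es ps qs vs p q u v"
  shows "Inl u \<in> gverts vs p q" "Inl u \<noteq> (Inl v :: int + 'h)" "\<not> gadj (Inl u) (Inl v)"
    "x \<in> gverts vs p q \<Longrightarrow> gadj (Inl u) x \<Longrightarrow> gadj (Inl v) x"
proof -
  show "x \<in> gverts vs p q \<Longrightarrow> gadj (Inl u) x \<Longrightarrow> gadj (Inl v) x"
    using assms by (cases x) (auto simp: attach_verts_def folds_def types_le_def list_all_iff split: if_splits)
qed (use assms in \<open>auto simp: Inl_in_gverts folds_def\<close>)

definition lift :: "(int \<Rightarrow> int) \<Rightarrow> int + 'h \<Rightarrow> int + 'h" where
  "lift f = case_sum (Inl \<circ> f) Inr"

lemma lift_simps [simp]: "lift f (Inl a) = Inl (f a)" "lift f (Inr h) = Inr h"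
  by (simp_all add: lift_def)

text \<open>Each move changes the map at a single vertex, so only the pairs that involve this vertex
  have to be examined. The flags may differ because the link can have lost \<open>P\<close> or
  \<open>Q\<close> while the target still has it.\<close>

lemma moves_to_cone_contiguous:
  assumes "moves_to_cone es ps qs p q ls ys f ms c" "set ls \<subseteq> set ys" "p' \<Longrightarrow> p" "q' \<Longrightarrow> q"
    and "contiguous gadj (gverts ls p q) gadj (gverts ys p' q') (lift f) (lift f)"
  shows "\<exists>g. (contiguous gadj (gverts ls p q) gadj (gverts ys p' q'))\<^sup>*\<^sup>* (lift f) g \<and>
     contiguous gadj (gverts ls p q) gadj (gverts ys p' q') g (\<lambda>_. Inl c)"
  using assms(1,5)
proof (induction ms arbitrary: f)
  case Nil
  note f = Nil.prems(2)[unfolded contiguous_def]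
  have c: "c \<in> set ys" "untyped ps qs p q c" "\<And>x. x \<in> set ls \<Longrightarrow> \<not> gadget_edge es (f x) c"
    using Nil.prems(1) by (auto simp: list_all_iff)
  have 1: "\<not> gadj (lift f x) (Inl c)" "\<not> gadj (Inl c) (lift f x)" if "x \<in> gverts ls p q" for x
    using that c(2,3) by (cases x; auto simp: attach_verts_def untyped_def gadget_edge_sym split: if_splits)+
  have "contiguous gadj (gverts ls p q) gadj (gverts ys p' q') (lift f) (\<lambda>_. Inl c)"
    unfolding contiguous_def using f c(1) 1 by (auto simp: Inl_in_gverts)
  then show ?case by blast
next
  case (Cons vw ms)
  obtain v w where vw: "vw = (v, w)" by (cases vw)
  let ?g = "f(v := w)"
  note f = Cons.prems(2)[unfolded contiguous_def]
  have w: "w \<in> set ys" "\<not> gadget_edge es (f v) w" "types_le ps qs p q v w"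
      "\<And>x. x \<in> set ls \<Longrightarrow> x = v \<or> gadget_edge es x v \<or> \<not> gadget_edge es (f x) w"
    and rec: "moves_to_cone es ps qs p q ls ys ?g ms c"
    using Cons.prems(1) unfolding vw by (auto simp: list_all_iff)
  \<comment> \<open>The new place \<open>w\<close> is compared with the places of \<open>v\<close>
    itself and of all vertices that span a simplex with \<open>v\<close>, gadget and host vertices
    alike.\<close>
  have 1: "\<not> gadj (Inl w) (lift f x) \<and> \<not> gadj (lift f x) (Inl w)"
    if "x \<in> gverts ls p q" "\<not> gadj (Inl v) x \<or> x = Inl v" for x
    using that w(2-4)
    by (cases x) (auto simp: attach_verts_def types_le_def gadget_edge_sym split: if_splits)
  have 2: "lift ?g x = (if x = Inl v then Inl w else lift f x)" for x
    by (cases x) auto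
  have 3: "Inl w \<in> gverts ys p' q'" using w(1) by (simp add: Inl_in_gverts)
  have sym: "\<not> gadj x y \<Longrightarrow> \<not> gadj y x" for x y using G.sym by blast
  have pair: "\<not> gadj a b"
    if xy: "x \<in> gverts ls p q" "y \<in> gverts ls p q" "\<not> gadj x y"
      and ab: "a \<in> {lift f x, lift ?g x}" "b \<in> {lift f y, lift ?g y}" for x y a b
  proof -
    have a: "a = lift f x \<or> a = Inl w \<and> x = Inl v" and b: "b = lift f y \<or> b = Inl w \<and> y = Inl v"
      using ab unfolding 2 by (auto split: if_splits)
    show ?thesis
      using a b
    proof (elim disjE conjE)
      assume "a = lift f x" "b = lift f y" then show ?thesis using f xy by blast
    next
      assume "a = lift f x" "b = Inl w" "y = Inl v"
      then show ?thesis using 1[OF xy(1)] xy(3) sym by blast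
    next
      assume "a = Inl w" "x = Inl v" "b = lift f y"
      then show ?thesis using 1[OF xy(2)] xy(3) by blast
    next
      assume "a = Inl w" "b = Inl w" then show ?thesis using G.irrefl by simp
    qed
  qed
  have cg: "contiguous gadj (gverts ls p q) gadj (gverts ys p' q') (lift f) (lift ?g)"
    unfolding contiguous_def
  proof (intro conjI ballI impI)
    fix x assume x: "x \<in> gverts ls p q"
    show "lift f x \<in> gverts ys p' q'" using f x by blast
    then show "lift ?g x \<in> gverts ys p' q'" using 3 by (simp add: 2)
  next
    fix x y a b assume "x \<in> gverts ls p q" "y \<in> gverts ls p q" "\<not> gadj x y"
      "a \<in> {lift f x, lift ?g x}" "b \<in> {lift f y, lift ?g y}"
    then show "\<not> gadj a b" by (rule pair)
  qed
  moreover have "contiguous gadj (gverts ls p q) gadj (gverts ys p' q') (lift ?g) (lift ?g)"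
    using cg unfolding contiguous_def by blast
  from Cons.IH[OF rec this] obtain g
    where "(contiguous gadj (gverts ls p q) gadj (gverts ys p' q'))\<^sup>*\<^sup>* (lift ?g) g"
      "contiguous gadj (gverts ls p q) gadj (gverts ys p' q') g (\<lambda>_. Inl c)" by blast
  ultimately show ?case by (blast intro: converse_rtranclp_into_rtranclp)
qed

lemma is_copy_level:
  assumes copy: "is_copy es ps qs vs (gad t) r m" and t: "t \<in> known"
  shows "G.graph_level 2 (gverts vs False False)"
proof -
  obtain vs' es' ps' qs' where g: "gad t = (vs', es', ps', qs')" by (cases "gad t")
  let ?adj' = "attach adj P Q es' (if r then qs' else ps') (if r then ps' else qs')"
  note c = copy[unfolded is_copy_def g prod.case list_all_iff]
  \<comment> \<open>The pairs of \<open>m\<close> lead from the current gadget to the known one.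
    Levels are transported the other way, hence the swap.\<close>
  define f where "f x = (case x of Inl b \<Rightarrow> Inl (the (map_of (map prod.swap m) b)) | Inr h \<Rightarrow> Inr h)" for x :: "int + 'h"
  have m: "f (Inl b) = Inl a" if "(a, b) \<in> set m" for a b
  proof -
    have "distinct (map fst (map prod.swap m))" using c by (simp add: o_def)
    moreover have "(b, a) \<in> set (map prod.swap m)" using that by force
    ultimately show ?thesis by (simp add: f_def)
  qed
  have m2: "\<exists>a. (a, b) \<in> set m" if "b \<in> set vs'" for b
    using c that by force
  have m1: "\<exists>b. (a, b) \<in> set m \<and> b \<in> set vs'" if "a \<in> set vs" for a
    using c that by force
  have mv: "a \<in> set vs" if "(a, b) \<in> set m" for a b
    using c that by force
  have inj: "b = b'" if "(a, b) \<in> set m" "(a, b') \<in> set m" for a b b'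
    using c that by (metis eq_key_imp_eq_value)
  note M = bspec[OF c[THEN conjunct2, THEN conjunct2, THEN conjunct2, THEN conjunct2, THEN conjunct2, THEN conjunct2]]
  have E: "gadget_edge es a b = gadget_edge es' a' b'" if "(a, a') \<in> set m" "(b, b') \<in> set m" for a a' b b'
    using bspec[OF M[OF that(1), unfolded prod.case, THEN conjunct1] that(2)] by simp
  have PQ: "(a \<in> set ps) = (a' \<in> set (if r then qs' else ps'))" "(a \<in> set qs) = (a' \<in> set (if r then ps' else qs'))"
    if "(a, a') \<in> set m" for a a'
    using M[OF that, unfolded prod.case, THEN conjunct2] by blast+
  have "graph_relation.graph_level ?adj' 2 (gverts vs' False False)"
    by (rule known[OF t g])
  then show ?thesis
  proof (rule graph_level_isomorphic[rotated -1])
    show "graph_relation ?adj'" by (rule graph_relation_attach) unfold_locales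
    show "graph_relation gadj" by (rule graph_relation_attach) unfold_locales
    show "inj_on f (gverts vs' False False)"
    proof (rule inj_onI)
      fix x y assume xy: "x \<in> gverts vs' False False" "y \<in> gverts vs' False False" "f x = f y"
      show "x = y"
      proof (cases x; cases y)
        fix b b' assume b: "x = Inl b" "y = Inl b'"
        then have "b \<in> set vs'" "b' \<in> set vs'" using xy(1,2) by (simp_all add: Inl_in_gverts)
        then obtain a a' where "(a, b) \<in> set m" "(a', b') \<in> set m"
          using m2 by blast
        then show ?thesis using xy(3) b m inj by auto
      qed (use xy in \<open>auto simp: f_def\<close>)
    qed
    show "f ` gverts vs' False False = gverts vs False False"
    proof (intro equalityI subsetI)
      fix y assume "y \<in> f ` gverts vs' False False"
      then obtain x where x: "x \<in> gverts vs' False False" "y = f x" by blast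
      show "y \<in> gverts vs False False"
      proof (cases x)
        case (Inl b)
        then obtain a where "(a, b) \<in> set m" using x(1) m2 by (auto simp: Inl_in_gverts)
        then show ?thesis using m mv Inl x(2) by (simp add: Inl_in_gverts)
      qed (use x in \<open>auto simp: attach_verts_def f_def\<close>)
    next
      fix y assume y: "y \<in> gverts vs False False"
      show "y \<in> f ` gverts vs' False False"
      proof (cases y)
        case (Inl a)
        then obtain b where "(a, b) \<in> set m" "b \<in> set vs'" using y m1 by (auto simp: Inl_in_gverts)
        then show ?thesis using Inl m by (intro image_eqI[of _ _ "Inl b"]) (auto simp: attach_verts_def)
      next
        case (Inr h)
        then show ?thesis using y by (intro image_eqI[of _ _ "Inr h"]) (auto simp: attach_verts_def f_def)
      qed
    qed
    fix x y assume xy: "x \<in> gverts vs' False False" "y \<in> gverts vs' False False"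
    have *: "\<exists>a. (a, b) \<in> set m \<and> f (Inl b) = Inl a" if bb: "Inl b \<in> gverts vs' False False" for b
    proof -
      obtain a where "(a, b) \<in> set m" using bb m2 unfolding Inl_in_gverts by blast
      then show ?thesis using m by blast
    qed
    show "gadj (f x) (f y) \<longleftrightarrow> ?adj' x y"
    proof (cases x; cases y)
      fix b b' assume b: "x = Inl b" "y = Inl b'"
      obtain a a' where "(a, b) \<in> set m" "f (Inl b) = Inl a" "(a', b') \<in> set m" "f (Inl b') = Inl a'"
        using *[of b] *[of b'] xy b by blast
      then show ?thesis using b E by simp
    next
      fix b h assume b: "x = Inl b" "y = Inr h"
      obtain a where "(a, b) \<in> set m" "f (Inl b) = Inl a" using * xy(1) b by blast
      then show ?thesis using b PQ by (simp add: f_def)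
    next
      fix b h assume b: "x = Inr h" "y = Inl b"
      obtain a where "(a, b) \<in> set m" "f (Inl b) = Inl a" using * xy(2) b by blast
      then show ?thesis using b PQ by (simp add: f_def)
    qed (simp add: f_def)
  qed
qed

lemma rest_level: "G.graph_level 0 (gverts [] True True)"
proof (rule graph_level_isomorphic[OF _ _ _ _ _ rest])
  show "inj_on Inr (H - P - Q)" by simp
  show "Inr ` (H - P - Q) = gverts [] True True" by (auto simp: attach_verts_def)
qed (unfold_locales, auto)

text \<open>Each instruction is one of the deletion or folding results for graphs, with
  \<open>link_verts_gverts\<close> translating links into lists and flags. The plan is the only
  structure on which the argument recurses.\<close>

theorem level_of_sound:
  "level_of gad es ps qs e pl vs p q = Some k \<Longrightarrow> plan_names pl \<subseteq> known \<Longrightarrow> G.graph_level k (gverts vs p q)"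
proof (induction pl arbitrary: vs p q k)
  case (Point u)
  then have k: "k = 3" and u: "u \<in> set vs" "\<And>x. x \<in> set vs \<Longrightarrow> \<not> gadget_edge es u x" "untyped ps qs p q u"
    by (auto simp: list_all_iff split: if_splits)
  have "\<not> gadj (Inl u) x" if "x \<in> gverts vs p q" for x
    using that u by (cases x) (auto simp: attach_verts_def untyped_def split: if_splits)
  then show ?case
    unfolding k using u(1) finite_gverts by (intro G.graph_level_isolated[of _ "Inl u"]) (auto simp: Inl_in_gverts)
next
  case (Fold u v pl)
  then have f: "v \<in> set vs" "folds es ps qs (removeAll v vs) p q u v"
    and l: "level_of gad es ps qs e pl (removeAll v vs) p q = Some k" by (auto split: if_splits)
  have "G.graph_level k (insert (Inl v) (gverts (removeAll v vs) p q))"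
  proof (rule G.graph_level_fold[of _ _ "Inl v" "Inl u"])
    show "G.graph_level k (gverts (removeAll v vs) p q - {Inl v})"
      using Fold.IH[OF l] Fold.prems(2) by (simp add: gverts_removeAll)
  qed (use foldsD[OF f(2)] in auto)
  moreover have "insert (Inl v) (gverts (removeAll v vs) p q) = gverts vs p q"
    using f(1) by (auto simp: gverts_removeAll Inl_in_gverts)
  ultimately show ?case by simp
next
  case (Unfold u v pl)
  then have f: "v \<notin> set vs" "folds es ps qs vs p q u v"
    and l: "level_of gad es ps qs e pl (v # vs) p q = Some k" by (auto split: if_splits)
  have "G.graph_level k (gverts vs p q - {Inl v})"
  proof (rule G.graph_level_unfold[of _ _ _ "Inl u"])
    show "G.graph_level k (insert (Inl v) (gverts vs p q))"
      using Unfold.IH[OF l] Unfold.prems(2) by (simp add: gverts_Cons)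
  qed (use foldsD[OF f(2)] in auto)
  moreover have "gverts vs p q - {Inl v} = gverts vs p q"
    using f(1) by (auto simp: Inl_in_gverts)
  ultimately show ?case by simp
next
  case (Leaf v w pl)
  then obtain j where f: "v \<in> set vs" "w \<in> set vs" "v \<noteq> w" "untyped ps qs p q v"
      "\<And>x. x \<in> set vs \<Longrightarrow> gadget_edge es v x \<Longrightarrow> x = w"
    and l: "level_of gad es ps qs e pl (gadget_link es w vs) (p \<or> w \<in> set ps) (q \<or> w \<in> set qs) = Some j"
    and k: "k = (if 3 \<le> j then 3 else min 2 (Suc j))"
    by (auto simp: list_all_iff split: if_splits)
  show ?case
    unfolding k
  proof (rule G.graph_level_leaf[of "Inl v" _ "Inl w"])
    show "x = Inl w" if "x \<in> gverts vs p q" "gadj (Inl v) x" for x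
      using that f by (cases x) (auto simp: attach_verts_def untyped_def split: if_splits)
    show "G.graph_level j (G.link_verts (Inl w) (gverts vs p q))"
      unfolding link_verts_gverts using Leaf.IH[OF l] Leaf.prems(2) by simp
  qed (use f finite_gverts in \<open>auto simp: Inl_in_gverts\<close>)
next
  case (Split v ms c plL plY)
  let ?p = "p \<or> v \<in> set ps" and ?q = "q \<or> v \<in> set qs"
  let ?ls = "gadget_link es v vs" and ?ys = "removeAll v vs"
  have "v \<in> set vs \<and> moves_to_cone es ps qs ?p ?q ?ls ?ys id ms c \<and>
      (\<exists>i j. level_of gad es ps qs e plY ?ys p q = Some i \<and> 2 \<le> i \<and>
        level_of gad es ps qs e plL ?ls ?p ?q = Some j \<and> k = (if 3 \<le> j then i else min 2 (Suc j)))"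
    using Split.prems(1) unfolding level_of.simps Let_def
    by (cases "level_of gad es ps qs e plY ?ys p q"; cases "level_of gad es ps qs e plL ?ls ?p ?q")
       (simp_all only: option.case option.map option.inject split: if_split_asm, simp_all)
  then obtain i j where v: "v \<in> set vs" and m: "moves_to_cone es ps qs ?p ?q ?ls ?ys id ms c"
    and lY: "level_of gad es ps qs e plY ?ys p q = Some i" "2 \<le> i"
    and lL: "level_of gad es ps qs e plL ?ls ?p ?q = Some j"
    and k: "k = (if 3 \<le> j then i else min 2 (Suc j))" by blast
  have sub: "set ?ls \<subseteq> set ?ys" by (auto simp: gadget_link_def)
  have id: "lift id = (\<lambda>x. x)" by (auto simp: lift_def fun_eq_iff split: sum.split)
  have "gverts ?ls ?p ?q \<subseteq> gverts ?ys p q"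
    using sub by (auto simp: attach_verts_def split: if_splits)
  then have "contiguous gadj (gverts ?ls ?p ?q) gadj (gverts ?ys p q) (lift id) (lift id)"
    unfolding id by (rule G.contiguous_inclusion)
  from moves_to_cone_contiguous[OF m sub _ _ this] obtain g where
    g: "(contiguous gadj (gverts ?ls ?p ?q) gadj (gverts ?ys p q))\<^sup>*\<^sup>* (\<lambda>x. x) g"
      "contiguous gadj (gverts ?ls ?p ?q) gadj (gverts ?ys p q) g (\<lambda>_. Inl c)" unfolding id by blast
  show ?case
    unfolding k
  proof (rule G.graph_level_split[OF _ _ lY(2)])
    show "Inl v \<in> gverts vs p q" using v by (simp add: Inl_in_gverts)
    show "G.graph_level i (gverts vs p q - {Inl v})"
      using Split.IH(2)[OF lY(1)] Split.prems(2) by (simp add: gverts_removeAll)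
    show "G.graph_level j (G.link_verts (Inl v) (gverts vs p q))"
      unfolding link_verts_gverts using Split.IH(1)[OF lL] Split.prems(2) by simp
    show "(contiguous gadj (G.link_verts (Inl v) (gverts vs p q)) gadj (gverts vs p q - {Inl v}))\<^sup>*\<^sup>* (\<lambda>x. x) g"
      "contiguous gadj (G.link_verts (Inl v) (gverts vs p q)) gadj (gverts vs p q - {Inl v}) g (\<lambda>_. Inl c)"
      using g unfolding link_verts_gverts gverts_removeAll by auto
  qed
next
  case (Contract v plL plY)
  let ?p = "p \<or> v \<in> set ps" and ?q = "q \<or> v \<in> set qs"
  from Contract.prems(1) obtain j where v: "v \<in> set vs"
    and lY: "level_of gad es ps qs e plY (removeAll v vs) p q = Some k" "2 \<le> k"
    and lL: "level_of gad es ps qs e plL (gadget_link es v vs) ?p ?q = Some j" "3 \<le> j"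
    by (auto simp: Let_def split: if_splits option.splits)
  show ?case
  proof (rule G.graph_level_split_contractible_link[OF _ _ lY(2) _ lL(2)])
    show "Inl v \<in> gverts vs p q" using v by (simp add: Inl_in_gverts)
    show "G.graph_level k (gverts vs p q - {Inl v})"
      using Contract.IH(2)[OF lY(1)] Contract.prems(2) by (simp add: gverts_removeAll)
    show "G.graph_level j (G.link_verts (Inl v) (gverts vs p q))"
      unfolding link_verts_gverts using Contract.IH(1)[OF lL(1)] Contract.prems(2) by simp
  qed
next
  case (Dominate v pl)
  from Dominate.prems(1) obtain j where e': e and v: "v \<in> set vs" and lk: "gadget_link es v vs = []"
      "p \<or> v \<in> set ps" "q \<or> v \<in> set qs"
    and l: "level_of gad es ps qs e pl (removeAll v vs) p q = Some j" "1 \<le> j" and k: "k = 1"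
    by (auto simp: split: if_splits option.splits)
  show ?case
    unfolding k
  proof (rule G.graph_level_dominating[OF _ l(2)])
    show "G.graph_level j (gverts vs p q - {Inl v})"
      using Dominate.IH[OF l(1)] Dominate.prems(2) by (simp add: gverts_removeAll)
    show "G.link_verts (Inl v) (gverts vs p q) = {}"
      unfolding link_verts_gverts lk(1) using lk(2,3) e[OF e'] by (auto simp: attach_verts_def)
  qed (use v in \<open>simp add: Inl_in_gverts\<close>)
next
  case (Known t r m)
  then have "k = 2" "\<not> p" "\<not> q" "is_copy es ps qs vs (gad t) r m" by (auto split: if_splits)
  then show ?case using is_copy_level Known.prems(2) by auto
next
  case Rest
  then show ?case using rest_level by (auto split: if_splits)
qed

end

section \<open>The gadgets and their plans\<close>

text \<open>\<open>GK\<close> and \<open>GY\<close> continue \<open>GD\<close> as paths from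
  \<open>P\<close> to \<open>Q\<close>, and \<open>GX\<close> is \<open>GA\<close> with the leaf 3
  at the vertex 2. They are needed as targets of reductions: for instance \<open>Gam\<close> leads
  to \<open>GY\<close>, and \<open>GC\<close> to \<open>GX\<close> and \<open>GK\<close>.\<close>

primrec gadget_of :: "gadget_name \<Rightarrow> gadget" where
  "gadget_of Gam = ([], [], [], [])"
| "gadget_of Lam = ([1, 2, 3, 4], [(1, 2), (2, 3), (3, 4)], [1, 2], [3, 4])"
| "gadget_of GA = ([1, 2], [], [1], [2])"
| "gadget_of GB = ([1, 2, 3, 4, 5, 6], [(1, 2), (1, 4), (1, 5), (2, 6), (3, 4), (4, 5), (5, 6)], [3, 4], [5, 6])"
| "gadget_of GC = ([1], [], [], [1])"
| "gadget_of GD = ([1, 2], [(1, 2)], [1], [2])"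
| "gadget_of GE = ([1], [], [1], [1])"
| "gadget_of GF = ([1, 2, 3], [(1, 2), (2, 3)], [1], [2, 3])"
| "gadget_of GX = ([1, 2, 3], [(2, 3)], [1], [2])"
| "gadget_of GK = ([1, 2, 3, 4], [(1, 2), (2, 3), (3, 4)], [1], [4])"
| "gadget_of GY = ([1, 2, 3, 4, 5, 6], [(1, 2), (2, 3), (3, 4), (4, 5), (5, 6)], [1], [6])"

text \<open>
  The plans were found by computer search. The gadget vertices are \<open>1, ..., 6\<close>; \<open>11, ..., 14\<close> and
  \<open>21, ..., 24\<close> are the first two columns, so that \<open>P\<close> and \<open>Q\<close> lie in the third column. Vertex \<open>30\<close>
  is not in the graph: it is added by \<open>Unfold\<close>, and \<open>21\<close> is then deleted by \<open>Contract\<close>, which amounts to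
  changing the edges at \<open>21\<close>. In the base plans there is only the first column.
\<close>

primrec step_plan :: "gadget_name \<Rightarrow> plan" where
  "step_plan Gam =
    Fold 11 22 (Fold 14 23 (Known GY False [(13, 4), (12, 3), (14, 5), (11, 2), (24, 6), (21, 1)]))"
| "step_plan Lam =
    Split 2 [] 1 (Split 13 [] 4 (Known GA False [(24, 2), (21, 1)]) (Fold 4 24 (Leaf 4 14 (Known GF
      True [(21, 3), (22, 2), (23, 1)])))) (Split 14 [] 3 (Split 11 [] 1 (Known GD False [(23, 2),
      (22, 1)]) (Fold 1 22 (Fold 1 23 (Leaf 1 12 (Known GC True [(21, 1)]))))) (Split 3 [] 4 (Split
      11 [] 1 (Known GF False [(24, 3), (23, 2), (22, 1)]) (Fold 1 22 (Fold 1 23 (Leaf 1 12 (Known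
      GA False [(24, 2), (21, 1)]))))) (Fold 4 12 (Fold 1 21 (Fold 4 22 (Fold 4 23 (Leaf 1 11 (Leaf
      4 13 (Known GC False [(24, 1)])))))))))"
| "step_plan GA =
    Split 11 [] 1 (Split 13 [] 2 (Known GC False [(24, 1)]) (Fold 2 24 (Leaf 2 14 (Known GD False
      [(23, 2), (22, 1)])))) (Fold 1 22 (Fold 1 13 (Fold 1 23 (Fold 2 24 (Leaf 1 12 (Leaf 2 14
      (Known GC True [(21, 1)])))))))"
| "step_plan GB =
    Fold 2 5 (Split 4 [] 3 (Fold 2 13 (Fold 2 14 (Leaf 2 6 (Known Lam False [(24, 4), (23, 3), (22,
      2), (21, 1)])))) (Fold 1 6 (Fold 14 23 (Leaf 1 2 (Split 11 [] 3 (Known GK False [(14, 3), (13,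
      2), (24, 4), (22, 1)]) (Fold 3 22 (Fold 3 13 (Leaf 3 12 (Known GX False [(14, 3), (24, 2),
      (21, 1)])))))))))"
| "step_plan GC =
    Fold 11 22 (Split 13 [] 1 (Known GX True [(11, 3), (21, 2), (24, 1)]) (Fold 1 24 (Leaf 1 14
      (Known GK False [(12, 3), (11, 2), (23, 4), (21, 1)]))))"
| "step_plan GD =
    Unfold 21 30 (Contract 21 (Fold 1 13 (Point 30)) (Split 1 [(22, 11), (13, 11), (24, 2), (24,
      23)] 14 (Fold 14 23 (Split 22 [] 30 (Leaf 14 24 (Rest)) (Known GK False [(14, 3), (13, 2),
      (24, 4), (30, 1)]))) (Fold 11 22 (Fold 11 13 (Fold 2 24 (Leaf 2 14 (Known GK False [(12, 3),
      (11, 2), (23, 4), (30, 1)])))))))"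
| "step_plan GE =
    Split 1 [(22, 11), (22, 13), (22, 21), (23, 14)] 12 (Known Lam False [(24, 4), (23, 3), (22, 2),
      (21, 1)]) (Fold 11 22 (Fold 14 23 (Known GY False [(13, 4), (12, 3), (14, 5), (11, 2), (24,
      6), (21, 1)])))"
| "step_plan GF =
    Split 14 [] 3 (Split 11 [] 1 (Known GD False [(23, 2), (22, 1)]) (Fold 1 22 (Fold 1 23 (Leaf 1
      12 (Known GC True [(21, 1)]))))) (Split 2 [] 3 (Known GB True [(12, 1), (11, 2), (23, 4), (24,
      3), (22, 5), (21, 6)]) (Fold 3 12 (Fold 1 21 (Fold 3 22 (Fold 3 23 (Leaf 1 11 (Leaf 3 13
      (Known GC False [(24, 1)]))))))))"
| "step_plan GX =
    Fold 3 13 (Fold 3 14 (Leaf 2 3 (Split 11 [] 1 (Known GF False [(24, 3), (23, 2), (22, 1)]) (Fold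
      1 22 (Fold 1 23 (Leaf 1 12 (Known GA False [(24, 2), (21, 1)])))))))"
| "step_plan GK =
    Split 1 [(4, 2), (22, 11), (23, 14), (23, 12), (14, 3), (23, 24)] 13 (Fold 3 13 (Fold 3 14 (Leaf
      3 4 (Known Lam False [(24, 4), (23, 3), (22, 2), (21, 1)])))) (Fold 2 4 (Fold 11 22 (Fold 14
      23 (Leaf 2 3 (Known GY False [(13, 4), (12, 3), (14, 5), (11, 2), (24, 6), (21, 1)])))))"
| "step_plan GY =
    Split 12 [(3, 1), (4, 2), (6, 4), (6, 13)] 5 (Fold 2 4 (Fold 5 14 (Leaf 2 3 (Leaf 5 6 (Known GA
      False [(24, 2), (21, 1)]))))) (Unfold 21 30 (Contract 21 (Fold 1 3 (Fold 4 6 (Fold 13 24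
      (Point 30)))) (Split 13 [(30, 14), (2, 11), (5, 3), (30, 22)] 6 (Fold 5 3 (Fold 2 11 (Leaf 1 2
      (Leaf 4 5 (Known GD False [(24, 2), (30, 1)]))))) (Contract 30 (Fold 1 3 (Fold 4 6 (Point
      14))) (Contract 24 (Fold 6 4 (Fold 3 1 (Point 11))) (Fold 11 2 (Fold 3 5 (Leaf 1 11 (Leaf 3 4
      (Leaf 6 14 (Known GD False [(23, 2), (22, 1)])))))))))))"

primrec base_plan :: "gadget_name \<Rightarrow> plan" where
  "base_plan Gam =
    Fold 11 13 (Point 14)"
| "base_plan Lam =
    Split 1 [] 11 (Dominate 3 (Dominate 4 (Leaf 13 14 (Rest)))) (Split 2 [] 11 (Dominate 4 (Leaf 13
      14 (Rest))) (Fold 11 13 (Leaf 11 12 (Dominate 3 (Leaf 4 14 (Rest))))))"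
| "base_plan GA =
    Split 1 [] 11 (Dominate 2 (Leaf 13 14 (Rest))) (Fold 11 13 (Leaf 2 14 (Leaf 11 12 (Rest))))"
| "base_plan GB =
    Fold 2 5 (Split 4 [] 3 (Fold 2 13 (Fold 2 14 (Leaf 2 6 (Rest)))) (Fold 1 6 (Fold 14 12 (Leaf 1 2
      (Leaf 3 11 (Leaf 13 14 (Rest)))))))"
| "base_plan GC =
    Fold 11 13 (Leaf 1 14 (Leaf 11 12 (Rest)))"
| "base_plan GD =
    Split 1 [] 11 (Leaf 13 14 (Rest)) (Fold 11 13 (Leaf 2 14 (Leaf 11 12 (Rest))))"
| "base_plan GE =
    Fold 11 13 (Fold 14 11 (Fold 12 14 (Leaf 1 12 (Rest))))"
| "base_plan GF =
    Split 1 [] 11 (Dominate 3 (Leaf 13 14 (Rest))) (Fold 11 13 (Leaf 11 12 (Dominate 2 (Leaf 3 14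
      (Rest)))))"
| "base_plan GX =
    Fold 3 13 (Fold 3 14 (Leaf 2 3 (Dominate 1 (Leaf 11 12 (Rest)))))"
| "base_plan GK =
    Split 1 [] 11 (Fold 3 13 (Fold 3 14 (Leaf 3 4 (Rest)))) (Fold 2 4 (Fold 11 13 (Point 14)))"
| "base_plan GY =
    Split 1 [] 11 (Fold 3 5 (Leaf 3 4 (Dominate 6 (Leaf 13 14 (Rest))))) (Fold 2 4 (Fold 5 13 (Fold
      5 14 (Leaf 2 3 (Leaf 5 6 (Leaf 11 12 (Rest)))))))"

text \<open>Row \<open>i\<close> of column \<open>j\<close> is coded as \<open>10 * j + i\<close>.
  Between the first two columns the parity condition leaves only the crossing of rows 2 and 3, the
  edges \<open>(12, 23)\<close> and \<open>(13, 22)\<close>. Between the second and the third it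
  leaves the crossings of rows 1, 2 and of rows 3, 4; with the horizontal edges they join 21, 22 to
  all of \<open>P\<close> and 23, 24 to all of \<open>Q\<close>.\<close>

definition column_edges :: edge_list where
  "column_edges = [(11, 12), (12, 13), (13, 14), (21, 22), (22, 23), (23, 24),
     (11, 21), (12, 22), (13, 23), (14, 24), (12, 23), (13, 22)]"

text \<open>30 copies 21 and receives one further neighbour, 13 or 24. In the link of 21 that
  neighbour folds away and 30 becomes isolated, which is why 21 can then be deleted.\<close>

definition extra_edges :: "gadget_name \<Rightarrow> edge_list" where
  "extra_edges t = (if t = GD then [(30, 11), (30, 22), (30, 13)]
     else if t = GY then [(30, 11), (30, 22), (30, 24)] else [])"

fun peeled_edges :: "gadget_name \<Rightarrow> gadget \<Rightarrow> edge_list" where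
  "peeled_edges t (vs, es, ps, qs) = es @ concat (map (\<lambda>a. [(a, 11), (a, 12)]) ps) @
     concat (map (\<lambda>a. [(a, 13), (a, 14)]) qs) @ column_edges @ extra_edges t"

text \<open>\<open>GE\<close> only gets 1 because its complex is a 0-sphere when there is a single
  column.\<close>

definition gadget_level :: "gadget_name \<Rightarrow> nat" where
  "gadget_level t = (if t = GE then 1 else 2)"

text \<open>The single column is coded by the gadget vertices 11 to 14, and the host is removed by
  setting both flags. Its remainder is empty, so \<open>Rest\<close> stands for the empty complex
  and \<open>Dominate\<close> is allowed.\<close>

lemma level_of_base_plan:
  "case level_of gadget_of (peeled_edges t (gadget_of t)) [21, 22, 30] [23, 24] True (base_plan t)
     (fst (gadget_of t) @ [11, 12, 13, 14]) True True of None \<Rightarrow> False | Some k \<Rightarrow> gadget_level t \<le> k"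
  by (cases t; hypsubst; code_simp)

lemma level_of_step_plan:
  "case level_of gadget_of (peeled_edges t (gadget_of t)) [21, 22, 30] [23, 24] False (step_plan t)
     (fst (gadget_of t) @ [11, 12, 13, 14, 21, 22, 23, 24]) False False of None \<Rightarrow> False
     | Some k \<Rightarrow> gadget_level t \<le> k"
  by (cases t; hypsubst; code_simp)

lemma plan_names_base_plan: "plan_names (base_plan t) = {}"
  by (cases t) auto

text \<open>\<open>Known\<close> claims level 2, which the induction does not provide for
  \<open>GE\<close>; no step plan may therefore end there.\<close>

lemma plan_names_step_plan: "plan_names (step_plan t) \<subseteq> - {GE}"
  by (cases t) auto

section \<open>The graphs of the theorem\<close>

text \<open>A relation on an unbounded grid; the bounds are left to the vertex sets, so it does not
  depend on \<open>n\<close>. Both diagonals of a square are governed by its lower row and lower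
  column, hence \<open>min j j'\<close>.\<close>

fun grid_adj :: "nat \<times> nat \<Rightarrow> nat \<times> nat \<Rightarrow> bool" where
  "grid_adj (i, j) (i', j') \<longleftrightarrow>
     (j = j' \<and> (i' = Suc i \<or> i = Suc i')) \<or> (i = i' \<and> (j' = Suc j \<or> j = Suc j')) \<or>
     ((j' = Suc j \<or> j = Suc j') \<and> ((i' = Suc i \<and> odd (i + min j j')) \<or> (i = Suc i' \<and> odd (i' + min j j'))))"

interpretation grid: graph_relation grid_adj
  by unfold_locales auto

definition grid_verts :: "nat \<Rightarrow> (nat \<times> nat) set" where
  "grid_verts n = {1..4} \<times> {1..2 * n + 1}"

definition grid_P :: "(nat \<times> nat) set" where "grid_P = {(1, 1), (2, 1)}"
definition grid_Q :: "(nat \<times> nat) set" where "grid_Q = {(3, 1), (4, 1)}"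

abbreviation grid_attach :: "edge_list \<Rightarrow> int list \<Rightarrow> int list \<Rightarrow> int + nat \<times> nat \<Rightarrow> int + nat \<times> nat \<Rightarrow> bool" where
  "grid_attach \<equiv> attach grid_adj grid_P grid_Q"

abbreviation grid_attach_verts :: "nat \<Rightarrow> int list \<Rightarrow> bool \<Rightarrow> bool \<Rightarrow> (int + nat \<times> nat) set" where
  "grid_attach_verts n \<equiv> attach_verts (grid_verts n) grid_P grid_Q"

lemma graph_relation_grid_attach: "graph_relation (grid_attach es ps qs)"
  by (rule graph_relation_attach) unfold_locales

definition attach_level :: "nat \<Rightarrow> gadget \<Rightarrow> nat \<Rightarrow> bool" where
  "attach_level k g n = (case g of (vs, es, ps, qs) \<Rightarrow>
     graph_relation.graph_level (grid_attach es ps qs) k (grid_attach_verts n vs False False))"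

lemma Inl_in_grid_attach_verts: "Inl a \<in> grid_attach_verts n vs p q \<longleftrightarrow> a \<in> set vs"
  by (auto simp: attach_verts_def)

lemma Inr_in_grid_attach_verts:
  "Inr (i, j) \<in> grid_attach_verts n vs False False \<longleftrightarrow> 1 \<le> i \<and> i \<le> 4 \<and> 1 \<le> j \<and> j \<le> 2 * n + 1"
  by (auto simp: attach_verts_def grid_verts_def)

lemmas in_grid_attach_verts = Inl_in_grid_attach_verts Inr_in_grid_attach_verts

lemma row_cases:
  assumes "i \<in> {1..4 :: nat}"
  obtains "i = 1" | "i = 2" | "i = 3" | "i = 4"
  using assms by fastforce

text \<open>The reflection \<open>i \<mapsto> 5 - i\<close> exchanges \<open>P\<close> and
  \<open>Q\<close> and preserves diagonals: a square with lower row \<open>i\<close> goes to one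
  with lower row \<open>4 - i\<close>, which has the same parity.\<close>

lemma attach_level_reflect:
  assumes "attach_level k (vs, es, ps, qs) n"
  shows "attach_level k (vs, es, qs, ps) n"
proof -
  define f :: "int + nat \<times> nat \<Rightarrow> int + nat \<times> nat" where "f = map_sum id (\<lambda>(i, j). (5 - i, j))"
  have adj: "grid_adj (5 - i, j) (5 - i', j') = grid_adj (i, j) (i', j')"
    if "i \<in> {1..4}" "i' \<in> {1..4}" for i j i' j'
    using that by (elim row_cases) auto
  have PQ: "(5 - i, j) \<in> grid_P \<longleftrightarrow> (i, j) \<in> grid_Q" "(5 - i, j) \<in> grid_Q \<longleftrightarrow> (i, j) \<in> grid_P"
    if "i \<in> {1..4}" for i j
    using that by (elim row_cases; auto simp: grid_P_def grid_Q_def)+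
  have "graph_relation.graph_level (grid_attach es qs ps) k (grid_attach_verts n vs False False)"
  proof (rule graph_level_isomorphic[OF graph_relation_grid_attach graph_relation_grid_attach])
    show "graph_relation.graph_level (grid_attach es ps qs) k (grid_attach_verts n vs False False)"
      using assms by (simp add: attach_level_def)
    show "inj_on f (grid_attach_verts n vs False False)"
      by (rule inj_onI) (auto simp: attach_verts_def grid_verts_def f_def)
    have "f (f x) = x \<and> f x \<in> grid_attach_verts n vs False False"
      if "x \<in> grid_attach_verts n vs False False" for x
      using that by (cases x) (auto simp: in_grid_attach_verts f_def)
    then show "f ` grid_attach_verts n vs False False = grid_attach_verts n vs False False"
      by (metis (no_types, lifting) image_eqI image_subsetI subsetI subset_antisym)
    fix x y assume "x \<in> grid_attach_verts n vs False False" "y \<in> grid_attach_verts n vs False False"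
    then show "grid_attach es qs ps (f x) (f y) = grid_attach es ps qs x y"
      by (cases x; cases y) (auto simp: in_grid_attach_verts f_def adj PQ simp del: grid_adj.simps)
  qed
  then show ?thesis by (simp add: attach_level_def)
qed

section \<open>Peeling off two columns\<close>

text \<open>The upper bound keeps gadget vertices apart from the codes 11 to 24 of the columns and
  from 30; the lower bound makes \<open>nat\<close> injective on them when they are turned into
  indices.\<close>

fun well_formed :: "gadget \<Rightarrow> bool" where
  "well_formed (vs, es, ps, qs) \<longleftrightarrow>
     (\<forall>x \<in> set vs \<union> fst ` set es \<union> snd ` set es \<union> set ps \<union> set qs. 1 \<le> x \<and> x \<le> 6)"

definition columns :: "int list" where "columns = [11, 12, 13, 14, 21, 22, 23, 24]"

lemma well_formedD:
  assumes "well_formed (vs, es, ps, qs)"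
  shows "x \<in> set vs \<Longrightarrow> x \<le> 6" "x \<in> set ps \<Longrightarrow> x \<le> 6" "x \<in> set qs \<Longrightarrow> x \<le> 6"
    "(x, y) \<in> set es \<Longrightarrow> x \<le> 6" "(x, y) \<in> set es \<Longrightarrow> y \<le> 6"
proof -
  have *: "\<And>x. x \<in> set vs \<union> fst ` set es \<union> snd ` set es \<union> set ps \<union> set qs \<Longrightarrow> x \<le> 6"
    using assms by simp
  show "x \<in> set vs \<Longrightarrow> x \<le> 6" "x \<in> set ps \<Longrightarrow> x \<le> 6" "x \<in> set qs \<Longrightarrow> x \<le> 6"
    using * by blast+
  show "(x, y) \<in> set es \<Longrightarrow> x \<le> 6" "(x, y) \<in> set es \<Longrightarrow> y \<le> 6"
    using *[of x] *[of y] image_eqI[of x fst "(x, y)" "set es"] image_eqI[of y snd "(x, y)" "set es"] by simp_all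
qed

lemma columns_bounds:
  assumes "a \<in> set columns"
  shows "11 \<le> a" "a \<le> 24"
  using assms by (auto simp: columns_def)

lemma well_formed_gadget_of: "well_formed (gadget_of t)"
  by (cases t) auto

definition column_position :: "int \<Rightarrow> nat \<times> nat" where
  "column_position k = (if k \<le> 14 then (nat (k - 10), 1) else (nat (k - 20), 2))"

text \<open>Puts the peeled columns back in front of the grid. The rest is shifted by two columns,
  an even number, so that the parity governing the diagonals is unchanged.\<close>

definition unpeel :: "int + nat \<times> nat \<Rightarrow> int + nat \<times> nat" where
  "unpeel x = (case x of
     Inl k \<Rightarrow> if k \<le> 6 then Inl k else Inr (column_position k)
   | Inr (i, j) \<Rightarrow> Inr (i, j + 2))"

lemma in_peeled_edges:
  "(a, b) \<in> set (peeled_edges t (vs, es, ps, qs)) \<longleftrightarrow> (a, b) \<in> set es \<or> a \<in> set ps \<and> b \<in> {11, 12} \<or>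
     a \<in> set qs \<and> b \<in> {13, 14} \<or> (a, b) \<in> set column_edges \<or> (a, b) \<in> set (extra_edges t)"
  by auto

declare peeled_edges.simps [simp del]

lemma extra_edgesD: "(a, b) \<in> set (extra_edges t) \<Longrightarrow> a = 30"
  by (auto simp: extra_edges_def split: if_splits)

lemma column_edgesD:
  assumes "(a, b) \<in> set column_edges"
  shows "11 \<le> a" "a \<le> 24" "11 \<le> b" "b \<le> 24"
  using assms by (auto simp: column_edges_def)

lemma gadget_edge_peeled_columns:
  assumes "well_formed (vs, es, ps, qs)" "a \<in> set columns" "b \<in> set columns"
  shows "gadget_edge (peeled_edges t (vs, es, ps, qs)) a b = gadget_edge column_edges a b"
proof -
  have 1: "(a, b) \<notin> set es" "(b, a) \<notin> set es" "a \<notin> set ps" "b \<notin> set ps" "a \<notin> set qs" "b \<notin> set qs" "a \<noteq> 30" "b \<noteq> 30"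
    using columns_bounds[OF assms(2)] columns_bounds[OF assms(3)]
      well_formedD(2-3)[OF assms(1), of a] well_formedD(2-3)[OF assms(1), of b]
      well_formedD(4)[OF assms(1), of a b] well_formedD(4)[OF assms(1), of b a] by auto
  then show ?thesis
    unfolding gadget_edge_def in_peeled_edges using extra_edgesD[of a b t] extra_edgesD[of b a t] by blast
qed

lemma gadget_edge_peeled_small:
  assumes "a \<le> 6" "b \<le> 6"
  shows "gadget_edge (peeled_edges t (vs, es, ps, qs)) a b = gadget_edge es a b"
proof -
  have "(a, b) \<notin> set column_edges" "(b, a) \<notin> set column_edges"
    using column_edgesD[of a b] column_edgesD[of b a] assms by auto
  moreover have "(a, b) \<notin> set (extra_edges t)" "(b, a) \<notin> set (extra_edges t)"
    using extra_edgesD[of a b t] extra_edgesD[of b a t] assms by auto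
  moreover have "a \<notin> {11, 12}" "a \<notin> {13, 14}" "b \<notin> {11, 12}" "b \<notin> {13, 14}" using assms by auto
  ultimately show ?thesis unfolding gadget_edge_def in_peeled_edges by blast
qed

lemma gadget_edge_peeled_mixed:
  assumes "well_formed (vs, es, ps, qs)" "a \<le> 6" "b \<in> set columns"
  shows "gadget_edge (peeled_edges t (vs, es, ps, qs)) a b \<longleftrightarrow>
     a \<in> set ps \<and> b \<in> {11, 12} \<or> a \<in> set qs \<and> b \<in> {13, 14}"
proof -
  have 1: "(a, b) \<notin> set es" "(b, a) \<notin> set es" "b \<notin> set ps" "b \<notin> set qs" "b \<noteq> 30" "a \<noteq> b"
    using columns_bounds[OF assms(3)] assms(2) well_formedD(2-3)[OF assms(1), of b]
      well_formedD(5)[OF assms(1), of a b] well_formedD(4)[OF assms(1), of b a] by auto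
  moreover have "(a, b) \<notin> set column_edges" "(b, a) \<notin> set column_edges"
    using column_edgesD[of a b] column_edgesD[of b a] assms(2) by auto
  moreover have "(a, b) \<notin> set (extra_edges t)" "(b, a) \<notin> set (extra_edges t)"
    using extra_edgesD[of a b t] extra_edgesD[of b a t] assms(2) 1 by auto
  ultimately show ?thesis unfolding gadget_edge_def in_peeled_edges by simp
qed

lemma unpeel_columns: "a \<in> set columns \<Longrightarrow> unpeel (Inl a) = Inr (column_position a)"
  using columns_bounds[of a] by (simp add: unpeel_def)

lemma grid_adj_columns:
  "\<forall>a\<in>set columns. \<forall>b\<in>set columns. grid_adj (column_position a) (column_position b) = gadget_edge column_edges a b"
  by code_simp

lemma column_position_types:
  "\<forall>b\<in>set columns. (column_position b \<in> grid_P \<longleftrightarrow> b \<in> {11, 12}) \<and> (column_position b \<in> grid_Q \<longleftrightarrow> b \<in> {13, 14})"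
  by (simp add: columns_def column_position_def grid_P_def grid_Q_def)

text \<open>Of the shifted grid only the third column can touch the first two. The case
  \<open>j = 1\<close> is a finite evaluation; for larger \<open>j\<close> the columns are too far
  apart.\<close>

lemma grid_adj_column_grid:
  assumes "b \<in> set columns" "i \<in> {1..4}" "1 \<le> j"
  shows "grid_adj (column_position b) (i, j + 2) \<longleftrightarrow>
     b \<in> {21, 22} \<and> (i, j) \<in> grid_P \<or> b \<in> {23, 24} \<and> (i, j) \<in> grid_Q"
proof (cases "j = 1")
  case True
  have "\<forall>b\<in>set columns. \<forall>i\<in>set [1, 2, 3, 4]. grid_adj (column_position b) (i, 1 + 2) \<longleftrightarrow>
     b \<in> {21, 22} \<and> (i, 1) \<in> grid_P \<or> b \<in> {23, 24} \<and> (i, 1) \<in> grid_Q"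
    unfolding grid_P_def grid_Q_def by code_simp
  moreover have "i \<in> set [1, 2, 3, 4]" using assms(2) by (elim row_cases) auto
  ultimately show ?thesis using assms(1) unfolding True by blast
next
  case False
  then have "2 \<le> j" using assms(3) by simp
  moreover have "snd (column_position b) \<le> 2" by (simp add: column_position_def)
  ultimately show ?thesis
    by (cases "column_position b") (auto simp: grid_P_def grid_Q_def)
qed

lemma unpeel_adj:
  assumes wf: "well_formed (vs, es, ps, qs)"
    and x: "x \<in> Inl ` (set vs \<union> set columns) \<union> Inr ` ({1..4} \<times> {1..})"
    and y: "y \<in> Inl ` (set vs \<union> set columns) \<union> Inr ` ({1..4} \<times> {1..})"
  shows "grid_attach es ps qs (unpeel x) (unpeel y) =
     grid_attach (peeled_edges t (vs, es, ps, qs)) [21, 22, 30] [23, 24] x y"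
proof -
  let ?es = "peeled_edges t (vs, es, ps, qs)"
  note small = well_formedD(1)[OF wf]
  have nc: "a \<notin> set columns" if "a \<le> 6" for a using that by (auto simp: columns_def)
  have sym: "grid_attach es ps qs u v = grid_attach es ps qs v u" for es ps qs u v
    using graph_relation.sym[OF graph_relation_grid_attach] by blast
  have ll: ?thesis if ab: "x = Inl a" "y = Inl b" for a b
  proof -
    consider "a \<le> 6" "b \<le> 6" | "a \<le> 6" "b \<in> set columns" | "b \<le> 6" "a \<in> set columns" | "a \<in> set columns" "b \<in> set columns"
      using x y ab small by auto
    then show ?thesis
    proof cases
      case 1 then show ?thesis using ab by (simp add: gadget_edge_peeled_small unpeel_def)
    next
      case 2
      then have "unpeel x = Inl a" by (simp add: ab unpeel_def)
      then show ?thesis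
        using ab 2 gadget_edge_peeled_mixed[OF wf 2, of t] column_position_types unpeel_columns[of b] by simp
    next
      case 3
      then have "unpeel y = Inl b" by (simp add: ab unpeel_def)
      then show ?thesis
        using ab 3 gadget_edge_peeled_mixed[OF wf 3, of t] column_position_types unpeel_columns[of a]
        unfolding ab attach.simps gadget_edge_sym[of _ a] by simp
    next
      case 4 then show ?thesis
        using ab 4 gadget_edge_peeled_columns[OF wf 4] grid_adj_columns unpeel_columns by simp
    qed
  qed
  have lr: "grid_attach es ps qs (unpeel (Inl a)) (unpeel (Inr h)) =
      grid_attach ?es [21, 22, 30] [23, 24] (Inl a) (Inr h)"
    if a: "a \<in> set vs \<union> set columns" and h: "h \<in> {1..4} \<times> {1..}" for a h
  proof (cases "a \<le> 6")
    case True
    then show ?thesis using h by (auto simp: unpeel_def grid_P_def grid_Q_def)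
  next
    case False
    then have ac: "a \<in> set columns" using a small by auto
    then have "a \<noteq> 30" by (auto simp: columns_def)
    obtain i j where ij: "h = (i, j)" by (cases h)
    show ?thesis
      using grid_adj_column_grid[OF ac, of i j] h \<open>a \<noteq> 30\<close>
      unfolding ij unpeel_columns[OF ac] by (simp add: unpeel_def)
  qed
  show ?thesis
  proof (cases x; cases y)
    fix a b assume "x = Inl a" "y = Inl b" then show ?thesis by (rule ll)
  next
    fix a h assume *: "x = Inl a" "y = Inr h" then show ?thesis using lr[of a h] x y by auto
  next
    fix a h assume *: "x = Inr h" "y = Inl a"
    then show ?thesis using lr[of a h] x y sym by auto
  next
    fix h h' assume *: "x = Inr h" "y = Inr h'"
    then show ?thesis by (cases h; cases h') (auto simp: unpeel_def)
  qed
qed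

lemma inj_on_unpeel:
  "inj_on unpeel (Inl ` ({..6} \<union> set columns) \<union> Inr ` ({1..4} \<times> {1..}))"
  by (rule inj_onI) (auto simp: unpeel_def columns_def column_position_def split: if_splits)

lemma attach_level_unpeel:
  assumes wf: "well_formed (vs, es, ps, qs)"
    and V: "V \<subseteq> Inl ` (set vs \<union> set columns) \<union> Inr ` ({1..4} \<times> {1..})"
    and level: "graph_relation.graph_level (grid_attach (peeled_edges t (vs, es, ps, qs)) [21, 22, 30] [23, 24]) k V"
    and img: "unpeel ` V = grid_attach_verts n vs False False"
  shows "attach_level k (vs, es, ps, qs) n"
  unfolding attach_level_def prod.case
proof (rule graph_level_isomorphic[OF graph_relation_grid_attach graph_relation_grid_attach _ img _ level])
  show "inj_on unpeel V"
    by (rule inj_on_subset[OF inj_on_unpeel]) (use V wf in force)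
  show "grid_attach es ps qs (unpeel x) (unpeel y) =
      grid_attach (peeled_edges t (vs, es, ps, qs)) [21, 22, 30] [23, 24] x y" if "x \<in> V" "y \<in> V" for x y
    by (rule unpeel_adj[OF wf]) (use that V in auto)
qed

lemma grid_verts_0_rest: "grid_verts 0 - grid_P - grid_Q = {}"
  by (auto simp: grid_verts_def grid_P_def grid_Q_def elim!: row_cases)

lemma rest_level_0: "grid.graph_level 0 (grid_verts 0 - grid_P - grid_Q)"
  unfolding grid_verts_0_rest by (rule grid.graph_level_empty)

lemma unpeel_image_base:
  assumes "\<forall>x\<in>set vs. x \<le> 6"
  shows "unpeel ` grid_attach_verts 0 (vs @ [11, 12, 13, 14]) True True = grid_attach_verts 0 vs False False"
proof -
  have V: "grid_verts 0 = {(1, 1), (2, 1), (3, 1), (4, 1)}"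
    by (auto simp: grid_verts_def elim!: row_cases)
  have vs: "unpeel ` Inl ` set vs = Inl ` set vs"
    using assms by (force simp: unpeel_def image_iff)
  have "unpeel ` Inl ` {11, 12, 13, 14} = Inr ` grid_verts 0"
    unfolding V by (simp add: unpeel_def column_position_def)
  then show ?thesis
    unfolding attach_verts_def by (simp only: if_True if_False grid_verts_0_rest image_empty Un_empty_right set_append
        list.set image_Un vs Diff_empty)
qed

lemma unpeel_image_step:
  assumes "\<forall>x\<in>set vs. x \<le> 6"
  shows "unpeel ` grid_attach_verts n (vs @ [11, 12, 13, 14, 21, 22, 23, 24]) False False =
     grid_attach_verts (Suc n) vs False False"
proof -
  have 1: "unpeel ` Inl ` set vs = Inl ` set vs"
    using assms by (force simp: unpeel_def image_iff)
  have 2: "grid_verts (Suc n) = {1, 2, 3, 4} \<times> {1, 2} \<union> (\<lambda>(i, j). (i, j + 2)) ` grid_verts n"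
  proof (intro equalityI subsetI)
    fix z assume z: "z \<in> grid_verts (Suc n)"
    obtain i j where ij: "z = (i, j)" by (cases z)
    show "z \<in> {1, 2, 3, 4} \<times> {1, 2} \<union> (\<lambda>(i, j). (i, j + 2)) ` grid_verts n"
    proof (cases "j \<le> 2")
      case True
      then have "j = 1 \<or> j = 2" "i \<in> {1..4}" using z ij by (auto simp: grid_verts_def)
      then show ?thesis unfolding ij by (elim row_cases) auto
    next
      case False then show ?thesis
        using z ij by (intro UnI2 image_eqI[of _ _ "(i, j - 2)"]) (auto simp: grid_verts_def)
    qed
  qed (auto simp: grid_verts_def)
  have 3: "unpeel ` Inr ` A = Inr ` (\<lambda>(i, j). (i, j + 2)) ` A" for A
    by (auto simp: unpeel_def image_image case_prod_unfold)
  show ?thesis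
  proof -
    have "unpeel ` Inl ` {11, 12, 13, 14, 21, 22, 23, 24} = Inr ` ({1, 2, 3, 4} \<times> {1, 2})"
      by (auto simp: unpeel_def column_position_def)
    then show ?thesis
      unfolding attach_verts_def 2 by (simp only: if_False Diff_empty image_Un set_append list.set 1 3 Un_assoc)
  qed
qed

lemma grid_attach_verts_subset:
  assumes "set us \<subseteq> set vs \<union> set columns"
  shows "grid_attach_verts n us p q \<subseteq> Inl ` (set vs \<union> set columns) \<union> Inr ` ({1..4} \<times> {1..})"
proof -
  have "grid_verts n \<subseteq> {1..4} \<times> {1..}" by (auto simp: grid_verts_def)
  then show ?thesis unfolding attach_verts_def using assms by blast
qed

lemma attach_level_mono: "attach_level k g n \<Longrightarrow> j \<le> k \<Longrightarrow> attach_level j g n"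
  unfolding attach_level_def using graph_relation.graph_level_mono[OF graph_relation_grid_attach]
  by (auto split: prod.splits)

section \<open>The induction over the number of columns\<close>

lemma attachment_grid:
  assumes rest: "grid.graph_level 0 (grid_verts n - grid_P - grid_Q)"
    and e: "e \<Longrightarrow> n = 0"
    and known: "\<And>t. t \<in> known \<Longrightarrow> attach_level 2 (gadget_of t) n"
  shows "attachment grid_adj (grid_verts n) grid_P grid_Q gadget_of known e"
proof
  show "finite (grid_verts n)" by (simp add: grid_verts_def)
  show "grid.graph_level 0 (grid_verts n - grid_P - grid_Q)" by (rule rest)
  show "grid_verts n \<subseteq> grid_P \<union> grid_Q" if e
    using assms(2)[OF that] by (auto simp: grid_verts_def grid_P_def grid_Q_def elim!: row_cases)
  fix t vs es ps qs r assume t: "t \<in> known" "gadget_of t = (vs, es, ps, qs)"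
  show "graph_relation.graph_level (grid_attach es (if r then qs else ps) (if r then ps else qs)) 2
      (grid_attach_verts n vs False False)"
    using known[OF t(1)] attach_level_reflect[of 2 vs es ps qs n] unfolding t(2) attach_level_def by auto
qed

lemma attach_level_base: "attach_level (gadget_level t) (gadget_of t) 0"
proof -
  obtain vs es ps qs where g: "gadget_of t = (vs, es, ps, qs)" by (cases "gadget_of t")
  have wf: "well_formed (vs, es, ps, qs)" using well_formed_gadget_of[of t] g by simp
  interpret attachment grid_adj "grid_verts 0" grid_P grid_Q gadget_of "{}"
      "peeled_edges t (gadget_of t)" "[21, 22, 30]" "[23, 24]" True
    by (rule attachment_grid[OF rest_level_0]) auto
  obtain k where k: "level_of gadget_of (peeled_edges t (gadget_of t)) [21, 22, 30] [23, 24] True (base_plan t)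
     (fst (gadget_of t) @ [11, 12, 13, 14]) True True = Some k" "gadget_level t \<le> k"
    using level_of_base_plan[of t] by (auto split: option.splits)
  have "attach_level k (vs, es, ps, qs) 0"
  proof (rule attach_level_unpeel[OF wf])
    show "graph_relation.graph_level (grid_attach (peeled_edges t (vs, es, ps, qs)) [21, 22, 30] [23, 24]) k
        (grid_attach_verts 0 (vs @ [11, 12, 13, 14]) True True)"
      using level_of_sound[OF k(1)] plan_names_base_plan[of t] unfolding g by simp
    show "grid_attach_verts 0 (vs @ [11, 12, 13, 14]) True True \<subseteq> Inl ` (set vs \<union> set columns) \<union> Inr ` ({1..4} \<times> {1..})"
      by (rule grid_attach_verts_subset) (auto simp: columns_def)
    show "unpeel ` grid_attach_verts 0 (vs @ [11, 12, 13, 14]) True True = grid_attach_verts 0 vs False False"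
      using wf by (intro unpeel_image_base) auto
  qed
  then show ?thesis unfolding g using k(2) attach_level_mono by blast
qed

lemma attach_level_step:
  assumes rest: "grid.graph_level 0 (grid_verts n - grid_P - grid_Q)"
    and known: "\<And>t. attach_level (gadget_level t) (gadget_of t) n"
  shows "attach_level (gadget_level t) (gadget_of t) (Suc n)"
proof -
  obtain vs es ps qs where g: "gadget_of t = (vs, es, ps, qs)" by (cases "gadget_of t")
  have wf: "well_formed (vs, es, ps, qs)" using well_formed_gadget_of[of t] g by simp
  interpret attachment grid_adj "grid_verts n" grid_P grid_Q gadget_of "- {GE}"
      "peeled_edges t (gadget_of t)" "[21, 22, 30]" "[23, 24]" False
  proof (rule attachment_grid[OF rest])
    show "attach_level 2 (gadget_of t) n" if "t \<in> - {GE}" for t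
      using known[of t] that by (simp add: gadget_level_def)
  qed simp
  obtain k where k: "level_of gadget_of (peeled_edges t (gadget_of t)) [21, 22, 30] [23, 24] False (step_plan t)
     (fst (gadget_of t) @ [11, 12, 13, 14, 21, 22, 23, 24]) False False = Some k" "gadget_level t \<le> k"
    using level_of_step_plan[of t] by (auto split: option.splits)
  have "attach_level k (vs, es, ps, qs) (Suc n)"
  proof (rule attach_level_unpeel[OF wf])
    show "graph_relation.graph_level (grid_attach (peeled_edges t (vs, es, ps, qs)) [21, 22, 30] [23, 24]) k
        (grid_attach_verts n (vs @ [11, 12, 13, 14, 21, 22, 23, 24]) False False)"
      using level_of_sound[OF k(1) plan_names_step_plan] unfolding g by simp
    show "grid_attach_verts n (vs @ [11, 12, 13, 14, 21, 22, 23, 24]) False False \<subseteq> Inl ` (set vs \<union> set columns) \<union> Inr ` ({1..4} \<times> {1..})"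
      by (rule grid_attach_verts_subset) (auto simp: columns_def)
    show "unpeel ` grid_attach_verts n (vs @ [11, 12, 13, 14, 21, 22, 23, 24]) False False = grid_attach_verts (Suc n) vs False False"
      using wf by (intro unpeel_image_step) auto
  qed
  then show ?thesis unfolding g using k(2) attach_level_mono by blast
qed

text \<open>Without its first column Gamma_{n+1} is Lambda_n: the second column is the path on the
  four gadget vertices, and it is joined to the third exactly as \<open>Lam\<close> prescribes,
  because all diagonals between these columns run within rows 1, 2 or within rows 3, 4.\<close>

lemma rest_level_step:
  assumes "attach_level 2 (gadget_of Lam) n"
  shows "grid.graph_level 0 (grid_verts (Suc n) - grid_P - grid_Q)"
proof -
  obtain vs es ps qs where g: "gadget_of Lam = (vs, es, ps, qs)" and
      g': "vs = [1, 2, 3, 4]" "es = [(1, 2), (2, 3), (3, 4)]" "ps = [1, 2]" "qs = [3, 4]" by simp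
  define f :: "int + nat \<times> nat \<Rightarrow> nat \<times> nat" where
    "f x = (case x of Inl k \<Rightarrow> (nat k, 2) | Inr (i, j) \<Rightarrow> (i, j + 2))" for x
  have img: "f ` grid_attach_verts n vs False False = grid_verts (Suc n) - grid_P - grid_Q"
  proof (intro equalityI subsetI)
    fix z assume z: "z \<in> grid_verts (Suc n) - grid_P - grid_Q"
    obtain i j where ij: "z = (i, j)" by (cases z)
    have i: "i \<in> {1..4}" and j: "2 \<le> j" "j \<le> 2 * n + 3"
    proof -
      show i: "i \<in> {1..4}" using z ij by (auto simp: grid_verts_def)
      have "j \<noteq> 1" using z i ij by (auto simp: grid_P_def grid_Q_def elim!: row_cases)
      then show "2 \<le> j" "j \<le> 2 * n + 3" using z ij by (auto simp: grid_verts_def)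
    qed
    show "z \<in> f ` grid_attach_verts n vs False False"
    proof (cases "j = 2")
      case True
      have "Inl (int i) \<in> grid_attach_verts n vs False False"
        using i by (elim row_cases) (auto simp: attach_verts_def g')
      then show ?thesis using True ij by (intro image_eqI[of _ _ "Inl (int i)"]) (auto simp: f_def)
    next
      case False
      then show ?thesis
        using i j ij by (intro image_eqI[of _ _ "Inr (i, j - 2)"]) (auto simp: f_def in_grid_attach_verts)
    qed
  qed (auto simp: f_def attach_verts_def grid_verts_def g' grid_P_def grid_Q_def)
  have "grid.graph_level 2 (grid_verts (Suc n) - grid_P - grid_Q)"
  proof (rule graph_level_isomorphic[OF graph_relation_grid_attach _ _ img])
    show "graph_relation.graph_level (grid_attach es ps qs) 2 (grid_attach_verts n vs False False)"
      using assms unfolding g attach_level_def by simp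
    show "graph_relation grid_adj" by unfold_locales
    show "inj_on f (grid_attach_verts n vs False False)"
      by (rule inj_onI) (auto simp: f_def attach_verts_def grid_verts_def g')
    fix x y assume xy: "x \<in> grid_attach_verts n vs False False" "y \<in> grid_attach_verts n vs False False"
    have lr: "grid_adj (f (Inl a)) (f (Inr (i, j))) = grid_attach es ps qs (Inl a) (Inr (i, j))"
      if "a \<in> set vs" "i \<in> {1..4}" "1 \<le> j" for a i j
      using that(2) by (elim row_cases) (use that(1,3) in \<open>auto simp: f_def g' grid_P_def grid_Q_def\<close>)
    have sym: "grid_adj u v = grid_adj v u" for u v using grid.sym by blast
    show "grid_adj (f x) (f y) = grid_attach es ps qs x y"
    proof (cases x; cases y)
      fix a b assume "x = Inl a" "y = Inl b"
      then show ?thesis using xy by (auto simp: f_def attach_verts_def g' gadget_edge_def)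
    next
      fix a h assume "x = Inl a" "y = Inr h"
      then show ?thesis using xy lr[of a "fst h" "snd h"] by (auto simp: attach_verts_def grid_verts_def)
    next
      fix a h assume "x = Inr h" "y = Inl a"
      then show ?thesis using xy lr[of a "fst h" "snd h"] sym[of "f x"] by (auto simp: attach_verts_def grid_verts_def)
    next
      fix h h' assume "x = Inr h" "y = Inr h'"
      then show ?thesis by (cases h; cases h') (auto simp: f_def)
    qed
  qed
  then show ?thesis by (rule grid.graph_level_mono) simp
qed

text \<open>The statement about the grid without its first column is carried along: the step for the
  gadgets uses it at \<open>n\<close>, and its own step uses the gadget \<open>Lam\<close> at
  \<open>n\<close>.\<close>

theorem attach_level_gadgets: "attach_level (gadget_level t) (gadget_of t) n"
proof -
  have "(\<forall>t. attach_level (gadget_level t) (gadget_of t) n) \<and> grid.graph_level 0 (grid_verts n - grid_P - grid_Q)"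
  proof (induction n)
    case 0
    show ?case using attach_level_base rest_level_0 by blast
  next
    case (Suc n)
    then have known: "\<And>t. attach_level (gadget_level t) (gadget_of t) n"
      and rest: "grid.graph_level 0 (grid_verts n - grid_P - grid_Q)" by blast+
    have "attach_level 2 (gadget_of Lam) n"
      using known[of Lam] by (simp add: gadget_level_def del: gadget_of.simps)
    from rest_level_step[OF this] attach_level_step[OF rest known] show ?case by blast
  qed
  then show ?thesis by blast
qed

section \<open>Transfer to the graphs of the theorem\<close>

lemma geometric_realization_Ind:
  "geometric_realization (Ind G) = indep_space (\<lambda>u v. {u, v} \<in> edges G) (verts G)"
  unfolding Ind_def independent_set_def indep_space_def ..

lemma graph_relation_edges:
  assumes "simple_graph G"
  shows "graph_relation (\<lambda>u v. {u, v} \<in> edges G)"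
proof
  show "{x, x} \<notin> edges G" for x using assms by (auto simp: simple_graph_def)
qed (simp add: insert_commute)

lemma verts_Gamma5: "verts (Gamma5 n) = (\<lambda>(i, j). Vg i j) ` grid_verts n"
  by (auto simp: Gamma5_def grid_verts_def)

lemma edges_Gamma5_Vg:
  "e \<in> edges (Gamma5 n) \<Longrightarrow> \<exists>i j i' j'. e = {Vg i j, Vg i' j'}"
  by (auto simp: Gamma5_def)

lemma doubleton_in_collect:
  "{u, v} \<in> {{f i j, g i j} | i j. R i j} \<longleftrightarrow>
     (\<exists>i j. R i j \<and> u = f i j \<and> v = g i j) \<or> (\<exists>i j. R i j \<and> u = g i j \<and> v = f i j)"
  by (auto simp: doubleton_eq_iff)

lemma edges_Gamma5:
  assumes "(i, j) \<in> grid_verts n" "(i', j') \<in> grid_verts n"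
  shows "{Vg i j, Vg i' j'} \<in> edges (Gamma5 n) \<longleftrightarrow> grid_adj (i, j) (i', j')"
proof -
  have mod: "k mod 2 = 1 \<longleftrightarrow> odd k" for k :: nat by presburger
  have 1: "{Vg i j, Vg i' j'} \<in> {{Vg i j, Vg (i+1) j} | i j. i \<in> {1..3} \<and> j \<in> {1..2*n+1}} \<longleftrightarrow>
      j = j' \<and> (i' = Suc i \<or> i = Suc i')"
    unfolding doubleton_in_collect using assms by (auto simp: grid_verts_def)
  have 2: "{Vg i j, Vg i' j'} \<in> {{Vg i j, Vg i (j+1)} | i j. i \<in> {1..4} \<and> j \<in> {1..2*n}} \<longleftrightarrow>
      i = i' \<and> (j' = Suc j \<or> j = Suc j')"
    unfolding doubleton_in_collect using assms by (auto simp: grid_verts_def)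
  have 3: "{Vg i j, Vg i' j'} \<in> {{Vg i j, Vg (i+1) (j+1)} | i j. i \<in> {1..3} \<and> j \<in> {1..2*n} \<and> (i + j) mod 2 = 1} \<longleftrightarrow>
      (i' = Suc i \<and> j' = Suc j \<and> odd (i + j)) \<or> (i = Suc i' \<and> j = Suc j' \<and> odd (i' + j'))"
    unfolding doubleton_in_collect mod using assms by (auto simp: grid_verts_def)
  have 4: "{Vg i j, Vg i' j'} \<in> {{Vg i (j+1), Vg (i+1) j} | i j. i \<in> {1..3} \<and> j \<in> {1..2*n} \<and> (i + j) mod 2 = 1} \<longleftrightarrow>
      (i' = Suc i \<and> j = Suc j' \<and> odd (i + j')) \<or> (i = Suc i' \<and> j' = Suc j \<and> odd (i' + j))"
    unfolding doubleton_in_collect mod using assms by (auto simp: grid_verts_def)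
  show ?thesis
    unfolding Gamma5_def ugraph.simps Un_iff 1 2 3 4 grid_adj.simps by (auto simp: min_def)
qed

lemma wedge_of_spheres_extend_Gamma5:
  assumes g: "gadget_of t = (vs, es, ps, qs)" and simple: "simple_graph (extend_graph (Gamma5 n) (L ` set vs) F)"
    and inj: "inj_on L (set vs)" and L: "\<And>a i j. a \<in> set vs \<Longrightarrow> L a \<noteq> Vg i j"
    and LL: "\<And>a b. a \<in> set vs \<Longrightarrow> b \<in> set vs \<Longrightarrow> {L a, L b} \<in> F \<longleftrightarrow> gadget_edge es a b"
    and LV: "\<And>a i j. a \<in> set vs \<Longrightarrow>
      {L a, Vg i j} \<in> F \<longleftrightarrow> a \<in> set ps \<and> (i, j) \<in> grid_P \<or> a \<in> set qs \<and> (i, j) \<in> grid_Q"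
    and VV: "\<And>i j i' j'. {Vg i j, Vg i' j'} \<notin> F"
  shows "homotopy_equivalent_to_wedge_of_spheres (geometric_realization (Ind (extend_graph (Gamma5 n) (L ` set vs) F)))"
proof -
  let ?G = "extend_graph (Gamma5 n) (L ` set vs) F" and ?f = "case_sum L (\<lambda>(i, j). Vg i j)"
  note rel = graph_relation_edges[OF simple]
  have edges: "edges ?G = edges (Gamma5 n) \<union> F" by (simp add: extend_graph_def)
  have LG: "{L a, v} \<notin> edges (Gamma5 n)" if "a \<in> set vs" for a v
    using edges_Gamma5_Vg[of "{L a, v}" n] L[OF that] by (auto simp: doubleton_eq_iff)
  have "graph_relation.graph_level (\<lambda>u v. {u, v} \<in> edges ?G) 1 (verts ?G)"
  proof (rule graph_level_isomorphic[OF graph_relation_grid_attach rel])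
    have "1 \<le> gadget_level t" by (simp add: gadget_level_def)
    then show "graph_relation.graph_level (grid_attach es ps qs) 1 (grid_attach_verts n vs False False)"
      using attach_level_mono[OF attach_level_gadgets[of t n]] unfolding attach_level_def g by simp
    show "inj_on ?f (grid_attach_verts n vs False False)"
    proof (rule inj_onI)
      fix x y assume xy: "x \<in> grid_attach_verts n vs False False" "y \<in> grid_attach_verts n vs False False" "?f x = ?f y"
      show "x = y"
        using xy L L[symmetric] inj_onD[OF inj] by (cases x; cases y) (auto simp: Inl_in_grid_attach_verts)
    qed
    show "?f ` grid_attach_verts n vs False False = verts ?G"
      unfolding attach_verts_def extend_graph_def by (simp add: image_Un image_image verts_Gamma5 Un_commute)
    fix x y assume xy: "x \<in> grid_attach_verts n vs False False" "y \<in> grid_attach_verts n vs False False"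
    show "{?f x, ?f y} \<in> edges ?G \<longleftrightarrow> grid_attach es ps qs x y"
    proof (cases x; cases y)
      fix a b assume "x = Inl a" "y = Inl b"
      then show ?thesis using xy LL LG by (simp add: edges Inl_in_grid_attach_verts)
    next
      fix a h assume *: "x = Inl a" "y = Inr h"
      then show ?thesis using xy LV[of a "fst h" "snd h"] LG by (cases h) (simp add: edges Inl_in_grid_attach_verts)
    next
      fix a h assume *: "x = Inr h" "y = Inl a"
      then show ?thesis
        using xy LV[of a "fst h" "snd h"] LG unfolding insert_commute[of "?f x"]
        by (cases h) (simp add: edges Inl_in_grid_attach_verts)
    next
      fix h h' assume *: "x = Inr h" "y = Inr h'"
      obtain i j i' j' where h: "h = (i, j)" "h' = (i', j')" by (cases h; cases h')
      then have "(i, j) \<in> grid_verts n" "(i', j') \<in> grid_verts n" using xy * by (auto simp: attach_verts_def)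
      from edges_Gamma5[OF this] show ?thesis using VV * h by (simp add: edges del: grid_adj.simps)
    qed
  qed
  then have "sphere_level 1 (indep_space (\<lambda>u v. {u, v} \<in> edges ?G) (verts ?G))"
    unfolding graph_relation.graph_level_def[OF rel] by blast
  then show ?thesis
    unfolding geometric_realization_Ind by (rule sphere_level_imp_wedge) simp
qed

text \<open>With the new vertices named by one constructor \<open>V\<close>, each graph of the
  theorem is its gadget once its vertex and edge sets are recognized as \<open>W\<close> and
  \<open>F\<close>, an identity of explicit finite sets.\<close>

lemma wedge_of_spheres_gadget_Gamma5:
  fixes V :: "nat \<Rightarrow> vertex"
  assumes g: "gadget_of t = (vs, es, ps, qs)" and simple: "simple_graph (extend_graph (Gamma5 n) W F)"
    and V: "inj V" "\<And>a i j. V a \<noteq> Vg i j" and W: "W = (\<lambda>k. V (nat k)) ` set vs"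
    and F: "F = (\<lambda>(a, b). {V (nat a), V (nat b)}) ` set es
      \<union> (\<lambda>(a, v). {V (nat a), v}) ` (set ps \<times> {Vg 1 1, Vg 2 1} \<union> set qs \<times> {Vg 3 1, Vg 4 1})"
  shows "homotopy_equivalent_to_wedge_of_spheres (geometric_realization (Ind (extend_graph (Gamma5 n) W F)))"
proof -
  have pos: "\<forall>x \<in> set vs \<union> fst ` set es \<union> snd ` set es \<union> set ps \<union> set qs. 1 \<le> x"
    using well_formed_gadget_of[of t] unfolding g by simp
  have eq: "V (nat x) = V (nat y) \<longleftrightarrow> x = y" if "1 \<le> x" "1 \<le> y" for x y
    using that injD[OF V(1), of "nat x" "nat y"] by auto
  have V': "Vg i j \<noteq> V a" for a i j using V(2)[of a i j] by metis
  \<comment> \<open>Settles the case \<open>a = b\<close>, where \<open>gadget_edge\<close> excludes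
    loops by definition while \<open>F\<close> excludes them by simplicity of the graph.\<close>
  have irrefl: "{v} \<notin> F" for v
  proof
    assume "{v} \<in> F"
    then have "{v} \<in> edges (extend_graph (Gamma5 n) W F)" by (simp add: extend_graph_def)
    then have "card {v} = 2" using simple unfolding simple_graph_def by blast
    then show False by simp
  qed
  show ?thesis
    unfolding W
  proof (rule wedge_of_spheres_extend_Gamma5[OF g])
    show "simple_graph (extend_graph (Gamma5 n) ((\<lambda>k. V (nat k)) ` set vs) F)" using simple W by simp
    show "inj_on (\<lambda>k. V (nat k)) (set vs)" using pos by (intro inj_onI) (simp add: eq)
    show "V (nat a) \<noteq> Vg i j" for a i j by (rule V(2))
    show "{V (nat a), V (nat b)} \<in> F \<longleftrightarrow> gadget_edge es a b" if ab: "a \<in> set vs" "b \<in> set vs" for a b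
    proof (cases "a = b")
      case True
      then show ?thesis using irrefl by simp
    next
      case False
      have "{V (nat a), V (nat b)} \<in> F \<longleftrightarrow>
          (\<exists>e \<in> set es. {V (nat a), V (nat b)} = {V (nat (fst e)), V (nat (snd e))})"
        unfolding F image_Un image_iff Un_iff split_beta by (auto simp: doubleton_eq_iff V(2))
      also have "\<dots> \<longleftrightarrow> (\<exists>e \<in> set es. a = fst e \<and> b = snd e \<or> a = snd e \<and> b = fst e)"
        using pos ab by (intro bex_cong refl) (simp add: doubleton_eq_iff eq)
      finally show ?thesis using False unfolding gadget_edge_def by force
    qed
    show "{V (nat a), Vg i j} \<in> F \<longleftrightarrow> a \<in> set ps \<and> (i, j) \<in> grid_P \<or> a \<in> set qs \<and> (i, j) \<in> grid_Q"
      if a: "a \<in> set vs" for a i j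
    proof -
      have "{V (nat a), Vg i j} \<in> F \<longleftrightarrow> (\<exists>b \<in> set ps. V (nat a) = V (nat b) \<and> (i, j) \<in> grid_P)
          \<or> (\<exists>b \<in> set qs. V (nat a) = V (nat b) \<and> (i, j) \<in> grid_Q)"
        unfolding F grid_P_def grid_Q_def
        by (auto simp: doubleton_eq_iff V(2) V' image_iff split_beta bex_Un)
      also have "\<dots> \<longleftrightarrow> (\<exists>b \<in> set ps. a = b \<and> (i, j) \<in> grid_P) \<or> (\<exists>b \<in> set qs. a = b \<and> (i, j) \<in> grid_Q)"
        using pos a by (intro arg_cong2[where f = "(\<or>)"] bex_cong refl) (auto simp: eq)
      finally show ?thesis by blast
    qed
    show "{Vg i j, Vg i' j'} \<notin> F" for i j i' j'
    proof
      assume "{Vg i j, Vg i' j'} \<in> F"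
      then obtain a where "V a \<in> {Vg i j, Vg i' j'}" unfolding F by blast
      then show False using V(2) by blast
    qed
  qed
qed

theorem theorem3p18:
  fixes n :: nat and G :: "vertex ugraph"
  assumes "G \<in> {Gamma5 n, Lambda5 n, A5 n, B5 n, C5 n, D5 n, E5 n, F5 n}"
  shows "homotopy_equivalent_to_wedge_of_spheres (geometric_realization (Ind G))"
proof -
  note simple = finite_simple_graphs(1)[OF assms]
  from assms consider "G = Gamma5 n" | "G = Lambda5 n" | "G = A5 n" | "G = B5 n" | "G = C5 n" | "G = D5 n"
    | "G = E5 n" | "G = F5 n" by blast
  then show ?thesis
  proof cases
    case 1
    \<comment> \<open>The gadget of \<open>Gam\<close> is empty, so any constructor other than
      \<open>Vg\<close> may name its vertices; \<open>Vl\<close> is an arbitrary choice.\<close>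
    have "Gamma5 n = extend_graph (Gamma5 n) {} {}" by (simp add: extend_graph_def)
    from wedge_of_spheres_gadget_Gamma5[of Gam _ _ _ _ n "{}" "{}" Vl, folded this] show ?thesis
      using simple unfolding 1 by (simp add: inj_def)
  next
    case 2
    show ?thesis
      unfolding 2 Lambda5_def
      by (rule wedge_of_spheres_gadget_Gamma5[of Lam _ _ _ _ _ _ _ Vl, OF gadget_of.simps(2) simple[unfolded 2 Lambda5_def]])
        (simp_all add: inj_def insert_commute image_Un Un_ac insert_Times_insert)
  next
    case 3
    show ?thesis
      unfolding 3 A5_def
      by (rule wedge_of_spheres_gadget_Gamma5[of GA _ _ _ _ _ _ _ Va, OF gadget_of.simps(3) simple[unfolded 3 A5_def]])
        (simp_all add: inj_def insert_commute image_Un Un_ac insert_Times_insert)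
  next
    case 4
    show ?thesis
      unfolding 4 B5_def
      by (rule wedge_of_spheres_gadget_Gamma5[of GB _ _ _ _ _ _ _ Vb, OF gadget_of.simps(4) simple[unfolded 4 B5_def]])
        (simp_all add: inj_def insert_commute image_Un Un_ac insert_Times_insert)
  next
    case 5
    show ?thesis
      unfolding 5 C5_def
      by (rule wedge_of_spheres_gadget_Gamma5[of GC _ _ _ _ _ _ _ Vc, OF gadget_of.simps(5) simple[unfolded 5 C5_def]])
        (simp_all add: inj_def insert_commute image_Un Un_ac insert_Times_insert)
  next
    case 6
    show ?thesis
      unfolding 6 D5_def
      by (rule wedge_of_spheres_gadget_Gamma5[of GD _ _ _ _ _ _ _ Vd, OF gadget_of.simps(6) simple[unfolded 6 D5_def]])
        (simp_all add: inj_def insert_commute image_Un Un_ac insert_Times_insert)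
  next
    case 7
    show ?thesis
      unfolding 7 E5_def
      by (rule wedge_of_spheres_gadget_Gamma5[of GE _ _ _ _ _ _ _ Ve, OF gadget_of.simps(7) simple[unfolded 7 E5_def]])
        (simp_all add: inj_def insert_commute image_Un Un_ac insert_Times_insert)
  next
    case 8
    show ?thesis
      unfolding 8 F5_def
      by (rule wedge_of_spheres_gadget_Gamma5[of GF _ _ _ _ _ _ _ Vf, OF gadget_of.simps(8) simple[unfolded 8 F5_def]])
        (simp_all add: inj_def insert_commute image_Un Un_ac insert_Times_insert)
  qed
qed

end
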